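(* Let $S$ be a positive dimensional projective algebraic (complex) manifold and let $r\ge 2$ be an integer. There exist a holomorphic vector bundle $E\to S$ of rank $r$ and a positively curved metric $k$ on the line bundle $O_{\mathbb P E}(1)\to\mathbb P E$ such that for no $\mathrm{GL}(\mathbb C^r)$-equivariant map $\Psi:\mathsf K_{\mathbb C^r}\to\mathsf H_{\mathbb C^r}$ does the induced metric $\Psi k$ on $E$ have semipositive curvature.
   Context: **Metrics and curvature.** A hermitian metric on a finite dimensional complex vector space $V$ is a function $\mathsf h:V\to\mathbb R$ of the form $\mathsf h(v)=\hat h(v,v)$, with $\hat h$ a positive definite hermitian form on $V$. A (hermitian) metric on a holomorphic vector bundle $E\to S$ is a function $h:E\to\mathbb R$ on the total space whose restriction to each fiber is a hermitian metric in this sense (no continuity is required a priori); it is smooth if $h$ is $C^\infty$. The metric $h$ is seminegatively curved if $h$ is plurisubharmonic on the total space $E$; it is negatively curved if $h$ is smooth and strongly plurisubharmonic ($i\partial\bar\partial h>0$) on $E$ away from the zero section. The metric $h$ is (semi)positively curved if the dual metric $h^*$ on the dual bundle $E^*$ is (semi)negatively curved. **The bundle $O_{\mathbb P E}(1)$.** For a holomorphic vector bundle $E\to S$, $\mathbb P E=\coprod_{s\in S}\mathbb P E_s$ is the set of hyperplanes (linear subspaces of codimension one) $P\subset E_s$ in the fibers of $E$, with its natural complex manifold structure and projection $\pi:\mathbb P E\to S$. Then $O_{\mathbb P E}(1)\to \mathbb P E$ is the holomorphic line bundle $(\pi^*E)/H$, where $H\subset\pi^*E$ is the tautological subbundle whose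 fiber over $P\in\mathbb P E_s$ is $P$; so its fiber over $P\in\mathbb P E_s$ is $E_s/P$. For a vector space $V$ (the case when $S$ is a point) this gives $O_{\mathbb P V}(1)\to\mathbb P V$. **Equivariant maps.** $\mathsf H_V$ denotes the set of hermitian metrics on the vector space $V$, and $\mathsf K_V$ the set of positively curved metrics on $O_{\mathbb P V}(1)$. An isomorphism $\phi:V'\to V$ induces $\phi_{\mathsf H}:\mathsf H_V\to\mathsf H_{V'}$, $\phi_{\mathsf H}\mathsf h=\mathsf h\circ\phi$. It also induces $\phi_{\mathsf K}:\mathsf K_V\to\mathsf K_{V'}$: the isomorphisms $V'/P\to V/\phi(P)$, $P\in\mathbb P V'$, induced by $\phi$ together define an isomorphism $O_{\mathbb P V'}(1)\to O_{\mathbb P V}(1)$, and $\phi_{\mathsf K}\mathsf k$ is the pullback of $\mathsf k$ along it. A map $\Psi:\mathsf K_{\mathbb C^r}\to\mathsf H_{\mathbb C^r}$ is $\mathrm{GL}(\mathbb C^r)$-equivariant if $\phi_{\mathsf H}\circ\Psi=\Psi\circ\phi_{\mathsf K}$ for all $\phi\in\mathrm{GL}(\mathbb C^r)$. Such a $\Psi$ determines, for every $r$-dimensional complex vector space $V$, a map $\Psi_V=\psi_{\mathsf H}^{-1}\circ\Psi\circ\psi_{\mathsf K}:\mathsf K_V\to\mathsf H_V$, where $\psi:\mathbb C^r\to V$ is any isomorphism (the result does not depend on the choice of $\psi$). If $E\to S$ is a holomorphic vector bundle of rank $r$ and $k$ is a metric on $O_{\mathbb P E}(1)$ whose restriction to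 $O_{\mathbb P E_s}(1)$ is positively curved for every $s\in S$, the metric $\Psi k$ on $E$ is defined by $(\Psi k)|E_s=\Psi_{E_s}\big(k|O_{\mathbb P E_s}(1)\big)$, $s\in S$. *)

theory Defs
  imports "HOL-Analysis.Analysis"
begin

section \<open>Complex model spaces\<close>

text \<open>The types used below as model spaces are finite dimensional complex vector spaces: the zero
  space \<^typ>\<open>unit\<close>, \<^typ>\<open>complex\<close>, and products and finite powers. Real scalar multiplication is
  the restriction of the complex one, so the library's Frechet derivative is available.\<close>

class complex_normed = real_normed_vector +
  fixes scaleC :: "complex \<Rightarrow> 'a \<Rightarrow> 'a"  (infixr "*\<^sub>C" 75)
  assumes scaleC_add_right: "c *\<^sub>C (x + y) = c *\<^sub>C x + c *\<^sub>C y"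
    and scaleC_add_left: "(c + d) *\<^sub>C x = c *\<^sub>C x + d *\<^sub>C x"
    and scaleC_scaleC: "c *\<^sub>C d *\<^sub>C x = (c * d) *\<^sub>C x"
    and scaleC_of_real: "complex_of_real t *\<^sub>C x = scaleR t x"
    and norm_scaleC: "norm (c *\<^sub>C x) = cmod c * norm x"

instantiation complex :: complex_normed
begin
definition scaleC_complex :: "complex \<Rightarrow> complex \<Rightarrow> complex"
  where "scaleC_complex c x = c * x"
instance
  by standard (auto simp: scaleC_complex_def algebra_simps norm_mult scaleR_conv_of_real)
end

instantiation vec :: (complex_normed, finite) complex_normed
begin
definition scaleC_vec :: "complex \<Rightarrow> ('a, 'b) vec \<Rightarrow> ('a, 'b) vec"
  where "scaleC_vec c x = (\<chi> i. c *\<^sub>C (x $ i))"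
instance
proof
  fix c d :: complex and x y :: "('a, 'b) vec" and t :: real
  show "c *\<^sub>C (x + y) = c *\<^sub>C x + c *\<^sub>C y"
    by (simp add: scaleC_vec_def vec_eq_iff scaleC_add_right)
  show "(c + d) *\<^sub>C x = c *\<^sub>C x + d *\<^sub>C x"
    by (simp add: scaleC_vec_def vec_eq_iff scaleC_add_left)
  show "c *\<^sub>C d *\<^sub>C x = (c * d) *\<^sub>C x"
    by (simp add: scaleC_vec_def vec_eq_iff scaleC_scaleC)
  show "complex_of_real t *\<^sub>C x = scaleR t x"
    by (simp add: scaleC_vec_def vec_eq_iff scaleC_of_real)
  show "norm (c *\<^sub>C x) = cmod c * norm x"
    by (simp add: scaleC_vec_def norm_vec_def norm_scaleC L2_set_right_distrib)
qed
end

instantiation prod :: (complex_normed, complex_normed) complex_normed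
begin
definition scaleC_prod :: "complex \<Rightarrow> 'a \<times> 'b \<Rightarrow> 'a \<times> 'b"
  where "scaleC_prod c x = (c *\<^sub>C fst x, c *\<^sub>C snd x)"
instance
proof
  fix c d :: complex and x y :: "'a \<times> 'b" and t :: real
  show "c *\<^sub>C (x + y) = c *\<^sub>C x + c *\<^sub>C y"
    by (simp add: scaleC_prod_def prod_eq_iff scaleC_add_right)
  show "(c + d) *\<^sub>C x = c *\<^sub>C x + d *\<^sub>C x"
    by (simp add: scaleC_prod_def prod_eq_iff scaleC_add_left)
  show "c *\<^sub>C d *\<^sub>C x = (c * d) *\<^sub>C x"
    by (simp add: scaleC_prod_def prod_eq_iff scaleC_scaleC)
  show "complex_of_real t *\<^sub>C x = scaleR t x"
    by (simp add: scaleC_prod_def prod_eq_iff scaleC_of_real)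
  have "sqrt ((cmod c * a)\<^sup>2 + (cmod c * b)\<^sup>2) = cmod c * sqrt (a\<^sup>2 + b\<^sup>2)" for a b
    by (simp add: power_mult_distrib real_sqrt_mult flip: distrib_left)
  then show "norm (c *\<^sub>C x) = cmod c * norm x"
    by (simp add: scaleC_prod_def norm_prod_def norm_scaleC)
qed
end

instantiation unit :: complex_normed
begin
definition zero_unit :: unit where "zero_unit = ()"
definition plus_unit :: "unit \<Rightarrow> unit \<Rightarrow> unit" where "plus_unit x y = ()"
definition scaleR_unit :: "real \<Rightarrow> unit \<Rightarrow> unit" where "scaleR_unit t x = ()"
definition scaleC_unit :: "complex \<Rightarrow> unit \<Rightarrow> unit" where "scaleC_unit c x = ()"
definition norm_unit :: "unit \<Rightarrow> real" where "norm_unit x = 0"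
definition dist_unit :: "unit \<Rightarrow> unit \<Rightarrow> real" where "dist_unit x y = 0"
definition sgn_unit :: "unit \<Rightarrow> unit" where "sgn_unit x = ()"
definition uniformity_unit :: "(unit \<times> unit) filter"
  where "uniformity_unit = (INF e\<in>{0 <..}. principal {(x, y). dist x y < e})"
definition open_unit :: "unit set \<Rightarrow> bool"
  where "open_unit U = (\<forall>x\<in>U. \<forall>\<^sub>F (x', y) in uniformity. x' = x \<longrightarrow> y \<in> U)"
instance
  by standard
    (auto simp: norm_unit_def dist_unit_def uniformity_unit_def open_unit_def)
end


section \<open>Function theory on open subsets of model spaces\<close>

definition holo_on :: "'a::complex_normed set \<Rightarrow> ('a \<Rightarrow> 'b::complex_normed) \<Rightarrow> bool" where
  "holo_on U f \<longleftrightarrow>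
     (\<forall>z\<in>U. \<exists>D. (f has_derivative D) (at z) \<and> (\<forall>c v. D (c *\<^sub>C v) = c *\<^sub>C D v))"

primrec k_smooth_on :: "nat \<Rightarrow> 'a::real_normed_vector set \<Rightarrow> ('a \<Rightarrow> real) \<Rightarrow> bool" where
  "k_smooth_on 0 U u \<longleftrightarrow> continuous_on U u"
| "k_smooth_on (Suc k) U u \<longleftrightarrow>
     (\<forall>z\<in>U. u differentiable (at z)) \<and>
     (\<forall>v. k_smooth_on k U (\<lambda>z. frechet_derivative u (at z) v))"

text \<open>Plurisubharmonic: upper semicontinuous, and subharmonic on complex lines. For a real valued
  upper semicontinuous function, failing to be integrable over a circle means having mean
  $-\infty$ there, so integrability is part of the submean value property.\<close>

definition psh_on :: "'a::complex_normed set \<Rightarrow> ('a \<Rightarrow> real) \<Rightarrow> bool" where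
  "psh_on U u \<longleftrightarrow>
     (\<forall>z\<in>U. \<forall>a>u z. \<forall>\<^sub>F y in at z. u y < a) \<and>
     (\<forall>z w. (\<forall>c. cmod c \<le> 1 \<longrightarrow> z + c *\<^sub>C w \<in> U) \<longrightarrow>
        (\<lambda>t. u (z + cis t *\<^sub>C w)) absolutely_integrable_on {0..2*pi} \<and>
        u z \<le> integral {0..2*pi} (\<lambda>t. u (z + cis t *\<^sub>C w)) / (2*pi))"

text \<open>In linear coordinates, \<open>wirtinger w\<close> is $\sum_j w_j\,\partial/\partial z_j$ and
  \<open>wirtinger_bar w\<close> is $\sum_j \bar w_j\,\partial/\partial\bar z_j$, so that \<open>levi u z w\<close> is
  $\sum_{j,k} w_j\bar w_k\,\partial^2u/\partial z_j\partial\bar z_k$, the value of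
  $\partial\bar\partial u$ on $(w,\bar w)$.\<close>

definition wirtinger :: "'a::complex_normed \<Rightarrow> ('a \<Rightarrow> complex) \<Rightarrow> 'a \<Rightarrow> complex" where
  "wirtinger w g z =
     (frechet_derivative g (at z) w - \<i> * frechet_derivative g (at z) (\<i> *\<^sub>C w)) / 2"

definition wirtinger_bar :: "'a::complex_normed \<Rightarrow> ('a \<Rightarrow> complex) \<Rightarrow> 'a \<Rightarrow> complex" where
  "wirtinger_bar w g z =
     (frechet_derivative g (at z) w + \<i> * frechet_derivative g (at z) (\<i> *\<^sub>C w)) / 2"

definition levi :: "('a::complex_normed \<Rightarrow> real) \<Rightarrow> 'a \<Rightarrow> 'a \<Rightarrow> complex" where
  "levi u z w = wirtinger w (wirtinger_bar w (\<lambda>y. complex_of_real (u y))) z"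


section \<open>Complex manifolds\<close>

text \<open>A chart is a pair of a domain and a coordinate map, only the values of the latter on the
  domain being relevant. Manifolds are pure dimensional, not necessarily connected. A nonempty
  manifold modelled on \<open>complex^'n\<close> is positive dimensional, since \<open>CARD('n) \<ge> 1\<close>.\<close>

record ('a, 'm) cmanifold =
  pts :: "'a set"
  atlas :: "('a set \<times> ('a \<Rightarrow> 'm)) set"

definition mtop :: "('a, 'm::complex_normed) cmanifold \<Rightarrow> 'a topology" where
  "mtop M = topology (\<lambda>A. A \<subseteq> pts M \<and> (\<forall>(U, x)\<in>atlas M. open (x ` (A \<inter> U))))"

definition second_countable_space :: "'a topology \<Rightarrow> bool" where
  "second_countable_space X \<longleftrightarrow>
     (\<exists>\<B>. countable \<B> \<and> (\<forall>V\<in>\<B>. openin X V) \<and>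
          (\<forall>U x. openin X U \<and> x \<in> U \<longrightarrow> (\<exists>V\<in>\<B>. x \<in> V \<and> V \<subseteq> U)))"

definition complex_manifold :: "('a, 'm::complex_normed) cmanifold \<Rightarrow> bool" where
  "complex_manifold M \<longleftrightarrow>
     (\<Union>(U, x)\<in>atlas M. U) = pts M \<and>
     (\<forall>(U, x)\<in>atlas M. inj_on x U \<and> open (x ` U)) \<and>
     (\<forall>(U, x)\<in>atlas M. \<forall>(V, y)\<in>atlas M.
        open (x ` (U \<inter> V)) \<and> holo_on (x ` (U \<inter> V)) (y \<circ> inv_into U x)) \<and>
     Hausdorff_space (mtop M) \<and> second_countable_space (mtop M)"

definition holomorphic_map ::
  "('a, 'm::complex_normed) cmanifold \<Rightarrow> ('b, 'n::complex_normed) cmanifold \<Rightarrow> ('a \<Rightarrow> 'b) \<Rightarrow> bool"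
  where
  "holomorphic_map M N f \<longleftrightarrow>
     continuous_map (mtop M) (mtop N) f \<and>
     (\<forall>(U, x)\<in>atlas M. \<forall>(V, y)\<in>atlas N.
        holo_on (x ` (U \<inter> f -` V)) (y \<circ> f \<circ> inv_into U x))"

definition holomorphic_embedding ::
  "('a, 'm::complex_normed) cmanifold \<Rightarrow> ('b, 'n::complex_normed) cmanifold \<Rightarrow> ('a \<Rightarrow> 'b) \<Rightarrow> bool"
  where
  "holomorphic_embedding M N f \<longleftrightarrow>
     holomorphic_map M N f \<and> embedding_map (mtop M) (mtop N) f \<and>
     (\<forall>(U, x)\<in>atlas M. \<forall>(V, y)\<in>atlas N. \<forall>p\<in>U \<inter> f -` V.
        inj (frechet_derivative (y \<circ> f \<circ> inv_into U x) (at (x p))))"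

definition smooth :: "('a, 'm::complex_normed) cmanifold \<Rightarrow> ('a \<Rightarrow> real) \<Rightarrow> bool" where
  "smooth M u \<longleftrightarrow> (\<forall>(U, x)\<in>atlas M. \<forall>k. k_smooth_on k (x ` U) (u \<circ> inv_into U x))"

definition psh :: "('a, 'm::complex_normed) cmanifold \<Rightarrow> ('a \<Rightarrow> real) \<Rightarrow> bool" where
  "psh M u \<longleftrightarrow> (\<forall>(U, x)\<in>atlas M. psh_on (x ` U) (u \<circ> inv_into U x))"

definition strongly_psh ::
  "('a, 'm::complex_normed) cmanifold \<Rightarrow> 'a set \<Rightarrow> ('a \<Rightarrow> real) \<Rightarrow> bool" where
  "strongly_psh M A u \<longleftrightarrow>
     (\<forall>(U, x)\<in>atlas M. \<forall>p\<in>U \<inter> A. \<forall>w. w \<noteq> 0 \<longrightarrow> 0 < Re (levi (u \<circ> inv_into U x) (x p) w))"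


section \<open>Vector spaces and hermitian metrics\<close>

record 'v cvspace =
  car :: "'v set"
  add :: "'v \<Rightarrow> 'v \<Rightarrow> 'v"
  smult :: "complex \<Rightarrow> 'v \<Rightarrow> 'v"

definition Cspace :: "(complex^'r) cvspace" where
  "Cspace = \<lparr>car = UNIV, add = (+), smult = scaleC\<rparr>"

definition linear_iso :: "'v cvspace \<Rightarrow> 'w cvspace \<Rightarrow> ('v \<Rightarrow> 'w) \<Rightarrow> bool" where
  "linear_iso V W \<phi> \<longleftrightarrow>
     bij_betw \<phi> (car V) (car W) \<and>
     (\<forall>v\<in>car V. \<forall>w\<in>car V. \<phi> (add V v w) = add W (\<phi> v) (\<phi> w)) \<and>
     (\<forall>c. \<forall>v\<in>car V. \<phi> (smult V c v) = smult W c (\<phi> v))"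

definition linear_functional :: "'v cvspace \<Rightarrow> ('v \<Rightarrow> complex) \<Rightarrow> bool" where
  "linear_functional V f \<longleftrightarrow>
     (\<forall>v\<in>car V. \<forall>w\<in>car V. f (add V v w) = f v + f w) \<and>
     (\<forall>c. \<forall>v\<in>car V. f (smult V c v) = c * f v)"

definition positive_hermitian_form :: "'v cvspace \<Rightarrow> ('v \<Rightarrow> 'v \<Rightarrow> complex) \<Rightarrow> bool" where
  "positive_hermitian_form V H \<longleftrightarrow>
     (\<forall>w\<in>car V. linear_functional V (\<lambda>v. H v w)) \<and>
     (\<forall>v\<in>car V. \<forall>w\<in>car V. H w v = cnj (H v w)) \<and>
     (\<forall>v\<in>car V. v \<noteq> smult V 0 v \<longrightarrow> 0 < Re (H v v))"

definition hermitian_metric :: "'v cvspace \<Rightarrow> ('v \<Rightarrow> real) \<Rightarrow> bool" where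
  "hermitian_metric V h \<longleftrightarrow>
     (\<exists>H. positive_hermitian_form V H \<and> (\<forall>v\<in>car V. complex_of_real (h v) = H v v))"

definition hyperplane :: "'v cvspace \<Rightarrow> 'v set \<Rightarrow> bool" where
  "hyperplane V P \<longleftrightarrow>
     P \<subseteq> car V \<and> P \<noteq> {} \<and>
     (\<forall>v\<in>P. \<forall>w\<in>P. add V v w \<in> P) \<and> (\<forall>c. \<forall>v\<in>P. smult V c v \<in> P) \<and>
     (\<exists>v\<in>car V - P. \<forall>w\<in>car V. \<exists>p\<in>P. \<exists>c. w = add V p (smult V c v))"

definition coset :: "'v cvspace \<Rightarrow> 'v set \<Rightarrow> 'v \<Rightarrow> 'v set" where
  "coset V P v = (\<lambda>p. add V v p) ` P"


section \<open>Holomorphic vector bundles\<close>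

text \<open>The total space of a bundle is an abstract set with a projection and fibrewise vector space
  operations; \<open>trivs\<close> is a set of local trivializations $p^{-1}U\to\mathbb C^r$, where the rank $r$
  is the cardinality of \<open>'r\<close>. Choosing a basis in each fibre shows that every bundle is isomorphic
  to one whose total space has type \<open>'s \<times> (complex^'r)\<close>.\<close>

record ('s, 'm, 'e, 'r) vbundle =
  bbase :: "('s, 'm) cmanifold"
  tot :: "'e set"
  bproj :: "'e \<Rightarrow> 's"
  vadd :: "'e \<Rightarrow> 'e \<Rightarrow> 'e"
  vscale :: "complex \<Rightarrow> 'e \<Rightarrow> 'e"
  trivs :: "('s set \<times> ('e \<Rightarrow> complex^'r)) set"

definition fibre :: "('s, 'm, 'e, 'r::finite) vbundle \<Rightarrow> 's \<Rightarrow> 'e cvspace" where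
  "fibre E s = \<lparr>car = {v \<in> tot E. bproj E v = s}, add = vadd E, smult = vscale E\<rparr>"

definition total_manifold ::
  "('s, 'm::complex_normed, 'e, 'r::finite) vbundle \<Rightarrow> ('e, 'm \<times> (complex^'r)) cmanifold" where
  "total_manifold E =
     \<lparr>pts = tot E,
      atlas = {({v \<in> tot E. bproj E v \<in> B \<inter> U}, \<lambda>v. (x (bproj E v), \<phi> v)) | B x U \<phi>.
                 (B, x) \<in> atlas (bbase E) \<and> (U, \<phi>) \<in> trivs E}\<rparr>"

text \<open>The last condition says that the transition functions between the local trivializations are
  holomorphic. That the fibres are vector spaces follows from the trivializations being
  fibrewise isomorphisms.\<close>

definition holomorphic_vector_bundle ::
  "('s, 'm::complex_normed, 'e, 'r::finite) vbundle \<Rightarrow> bool" where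
  "holomorphic_vector_bundle E \<longleftrightarrow>
     complex_manifold (bbase E) \<and>
     bproj E ` tot E \<subseteq> pts (bbase E) \<and>
     (\<forall>s\<in>pts (bbase E). \<forall>v\<in>car (fibre E s).
        (\<forall>w\<in>car (fibre E s). vadd E v w \<in> car (fibre E s)) \<and>
        (\<forall>c. vscale E c v \<in> car (fibre E s))) \<and>
     (\<Union>(U, \<phi>)\<in>trivs E. U) = pts (bbase E) \<and>
     (\<forall>(U, \<phi>)\<in>trivs E. openin (mtop (bbase E)) U \<and> (\<forall>s\<in>U. linear_iso (fibre E s) Cspace \<phi>)) \<and>
     complex_manifold (total_manifold E)"

definition zero_section :: "('s, 'm, 'e, 'r::finite) vbundle \<Rightarrow> 'e set" where
  "zero_section E = {v \<in> tot E. vscale E 0 v = v}"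

definition dual :: "('s, 'm, 'e, 'r::finite) vbundle \<Rightarrow> ('s, 'm, 's \<times> ('e \<Rightarrow> complex), 'r) vbundle"
  where
  "dual E =
     \<lparr>bbase = bbase E,
      tot = {(s, f). s \<in> pts (bbase E) \<and> linear_functional (fibre E s) f \<and>
                     f \<in> extensional (car (fibre E s))},
      bproj = fst,
      vadd = (\<lambda>(s, f) (t, g). (s, restrict (\<lambda>v. f v + g v) (car (fibre E s)))),
      vscale = (\<lambda>c (s, f). (s, restrict (\<lambda>v. c * f v) (car (fibre E s)))),
      trivs = {(U, \<lambda>(s, f). \<chi> j. f (inv_into (car (fibre E s)) \<phi> (axis j 1))) | U \<phi>.
                 (U, \<phi>) \<in> trivs E}\<rparr>"


section \<open>Metrics and curvature\<close>

definition metric_on :: "('s, 'm, 'e, 'r::finite) vbundle \<Rightarrow> ('e \<Rightarrow> real) \<Rightarrow> bool" where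
  "metric_on E h \<longleftrightarrow> (\<forall>s\<in>pts (bbase E). hermitian_metric (fibre E s) h)"

definition dual_metric ::
  "('s, 'm, 'e, 'r::finite) vbundle \<Rightarrow> ('e \<Rightarrow> real) \<Rightarrow> 's \<times> ('e \<Rightarrow> complex) \<Rightarrow> real" where
  "dual_metric E h = (\<lambda>(s, f). Sup {(cmod (f v))\<^sup>2 | v. v \<in> car (fibre E s) \<and> h v \<le> 1})"

definition seminegatively_curved ::
  "('s, 'm::complex_normed, 'e, 'r::finite) vbundle \<Rightarrow> ('e \<Rightarrow> real) \<Rightarrow> bool" where
  "seminegatively_curved E h \<longleftrightarrow> psh (total_manifold E) h"

definition negatively_curved ::
  "('s, 'm::complex_normed, 'e, 'r::finite) vbundle \<Rightarrow> ('e \<Rightarrow> real) \<Rightarrow> bool" where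
  "negatively_curved E h \<longleftrightarrow>
     smooth (total_manifold E) h \<and>
     strongly_psh (total_manifold E) (tot E - zero_section E) h"

definition semipositively_curved ::
  "('s, 'm::complex_normed, 'e, 'r::finite) vbundle \<Rightarrow> ('e \<Rightarrow> real) \<Rightarrow> bool" where
  "semipositively_curved E h \<longleftrightarrow> seminegatively_curved (dual E) (dual_metric E h)"

definition positively_curved ::
  "('s, 'm::complex_normed, 'e, 'r::finite) vbundle \<Rightarrow> ('e \<Rightarrow> real) \<Rightarrow> bool" where
  "positively_curved E h \<longleftrightarrow> negatively_curved (dual E) (dual_metric E h)"


section \<open>The projectivization and its line bundle\<close>

text \<open>To have model spaces of dimension $r$ and $r-1$ at hand, projectivization is defined for
  bundles with fibre index type \<open>'q option\<close>, that is, of rank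
  $r=$ \<open>CARD('q) + 1\<close> $\ge2$. Every $r\ge2$ is of this form. The affine charts of the space of hyperplanes in $\mathbb C^r$ consist of the
  kernels of the functionals having one given coefficient equal to 1; the bijection \<open>\<tau>\<close> singles
  out that coefficient and enumerates the other ones.\<close>

definition affine_form ::
  "('q option \<Rightarrow> 'q option) \<Rightarrow> complex^'q \<Rightarrow> complex^('q::finite option) \<Rightarrow> complex" where
  "affine_form \<tau> \<zeta> w = w $ \<tau> None + (\<Sum>i\<in>UNIV. \<zeta> $ i * w $ \<tau> (Some i))"

definition affine_hyperplane ::
  "('s, 'm, 'e, 'q::finite option) vbundle \<Rightarrow> ('e \<Rightarrow> complex^('q option)) \<Rightarrow>
     ('q option \<Rightarrow> 'q option) \<Rightarrow> 's \<Rightarrow> complex^'q \<Rightarrow> 'e set" where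
  "affine_hyperplane E \<phi> \<tau> s \<zeta> = {v \<in> car (fibre E s). affine_form \<tau> \<zeta> (\<phi> v) = 0}"

definition affine_domain ::
  "('s, 'm, 'e, 'q::finite option) vbundle \<Rightarrow> 's set \<Rightarrow> ('e \<Rightarrow> complex^('q option)) \<Rightarrow>
     ('q option \<Rightarrow> 'q option) \<Rightarrow> 'e set set" where
  "affine_domain E U \<phi> \<tau> = {affine_hyperplane E \<phi> \<tau> s \<zeta> | s \<zeta>. s \<in> U}"

text \<open>The projection $\pi:\mathbb PE\to S$.\<close>

definition foot :: "('s, 'm, 'e, 'r::finite) vbundle \<Rightarrow> 'e set \<Rightarrow> 's" where
  "foot E P = bproj E (SOME v. v \<in> P)"

definition affine_coord ::
  "('s, 'm, 'e, 'q::finite option) vbundle \<Rightarrow> ('e \<Rightarrow> complex^('q option)) \<Rightarrow>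
     ('q option \<Rightarrow> 'q option) \<Rightarrow> 'e set \<Rightarrow> complex^'q" where
  "affine_coord E \<phi> \<tau> P = (THE \<zeta>. P = affine_hyperplane E \<phi> \<tau> (foot E P) \<zeta>)"

definition PP ::
  "('s, 'm::complex_normed, 'e, 'q::finite option) vbundle \<Rightarrow>
     ('e set, 'm \<times> (complex^'q)) cmanifold" where
  "PP E =
     \<lparr>pts = {P. \<exists>s\<in>pts (bbase E). hyperplane (fibre E s) P},
      atlas = {(affine_domain E (B \<inter> U) \<phi> \<tau>, \<lambda>P. (x (foot E P), affine_coord E \<phi> \<tau> P))
               | B x U \<phi> \<tau>. (B, x) \<in> atlas (bbase E) \<and> (U, \<phi>) \<in> trivs E \<and> bij \<tau>}\<rparr>"

text \<open>The bundle $O_{\mathbb PE}(1)=(\pi^*E)/H$: its points over $P$ are the pairs of $P$ and an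
  element of $E_s/P$. Over an affine chart $H$ is the kernel of the affine form, which therefore
  induces a trivialization of the quotient; it does not depend on the representative of the coset.\<close>

definition O1 ::
  "('s, 'm::complex_normed, 'e, 'q::finite option) vbundle \<Rightarrow>
     ('e set, 'm \<times> (complex^'q), 'e set \<times> 'e set, 1) vbundle" where
  "O1 E =
     \<lparr>bbase = PP E,
      tot = {(P, coset (fibre E s) P v) | s P v.
               s \<in> pts (bbase E) \<and> hyperplane (fibre E s) P \<and> v \<in> car (fibre E s)},
      bproj = fst,
      vadd = (\<lambda>(P, a) (Q, b). (P, {vadd E v w | v w. v \<in> a \<and> w \<in> b})),
      vscale = (\<lambda>c (P, a). (P, {vadd E (vscale E c v) p | v p. v \<in> a \<and> p \<in> P})),
      trivs = {(affine_domain E U \<phi> \<tau>,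
                \<lambda>(P, a). \<chi> _. affine_form \<tau> (affine_coord E \<phi> \<tau> P) (\<phi> (SOME v. v \<in> a)))
               | U \<phi> \<tau>. (U, \<phi>) \<in> trivs E \<and> bij \<tau>}\<rparr>"

text \<open>$\mathbb C^r$ as a bundle over a point\<close>

definition point :: "(unit, unit) cmanifold" where
  "point = \<lparr>pts = {()}, atlas = {({()}, \<lambda>s. s)}\<rparr>"

definition Cbundle :: "(unit, unit, complex^'r, 'r::finite) vbundle" where
  "Cbundle =
     \<lparr>bbase = point, tot = UNIV, bproj = (\<lambda>v. ()), vadd = (+), vscale = scaleC,
      trivs = {({()}, \<lambda>v. v)}\<rparr>"


section \<open>Equivariant maps\<close>

definition HH :: "(complex^'r \<Rightarrow> real) set" where
  "HH = {h. hermitian_metric Cspace h}"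

text \<open>Metrics on $O_{\mathbb PV}(1)$ are taken extensional, so that a map on \<open>KK\<close> sees only their
  values on the total space.\<close>

definition KK ::
  "((complex^('q::finite option)) set \<times> (complex^('q option)) set \<Rightarrow> real) set" where
  "KK = {k \<in> extensional (tot (O1 Cbundle)).
           metric_on (O1 Cbundle) k \<and> positively_curved (O1 Cbundle) k}"

text \<open>Pullback $\phi_{\mathsf K}k$ to $O_{\mathbb P\mathbb C^r}(1)$ by an isomorphism
  $\phi:\mathbb C^r\to V$: the induced isomorphism $\mathbb C^r/P\to V/\phi(P)$ sends a coset to its
  image under $\phi$.\<close>

definition pull_K ::
  "(complex^('q::finite option) \<Rightarrow> 'v) \<Rightarrow> ('v set \<times> 'v set \<Rightarrow> real) \<Rightarrow>
     (complex^('q option)) set \<times> (complex^('q option)) set \<Rightarrow> real" where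
  "pull_K \<phi> k = restrict (\<lambda>(P, a). k (\<phi> ` P, \<phi> ` a)) (tot (O1 Cbundle))"

definition equivariant ::
  "(((complex^('q::finite option)) set \<times> (complex^('q option)) set \<Rightarrow> real) \<Rightarrow>
     complex^('q option) \<Rightarrow> real) \<Rightarrow> bool" where
  "equivariant \<Psi> \<longleftrightarrow>
     \<Psi> \<in> KK \<rightarrow> HH \<and>
     (\<forall>\<phi>. linear_iso Cspace Cspace \<phi> \<longrightarrow> (\<forall>k\<in>KK. \<Psi> k \<circ> \<phi> = \<Psi> (pull_K \<phi> k)))"

text \<open>$\Psi_V=\psi_{\mathsf H}^{-1}\circ\Psi\circ\psi_{\mathsf K}$, with the metric on $\mathbb C^r$
  transported to $V$ by $\psi^{-1}$, and the induced metric $\Psi k$ on a bundle\<close>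

definition induced ::
  "(((complex^('q::finite option)) set \<times> (complex^('q option)) set \<Rightarrow> real) \<Rightarrow>
     complex^('q option) \<Rightarrow> real) \<Rightarrow> 'v cvspace \<Rightarrow> ('v set \<times> 'v set \<Rightarrow> real) \<Rightarrow> 'v \<Rightarrow> real" where
  "induced \<Psi> V k =
     (let \<psi> = (SOME \<psi>. linear_iso Cspace V \<psi>) in (\<lambda>v. \<Psi> (pull_K \<psi> k) (inv \<psi> v)))"

definition induced_metric ::
  "(((complex^('q::finite option)) set \<times> (complex^('q option)) set \<Rightarrow> real) \<Rightarrow>
     complex^('q option) \<Rightarrow> real) \<Rightarrow> ('s, 'm, 'e, 'q option) vbundle \<Rightarrow>
     ('e set \<times> 'e set \<Rightarrow> real) \<Rightarrow> 'e \<Rightarrow> real" where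
  "induced_metric \<Psi> E k v = induced \<Psi> (fibre E (bproj E v)) k v"


section \<open>Projective algebraic manifolds\<close>

definition homogeneous_polynomial :: "nat \<Rightarrow> (complex^'i::finite \<Rightarrow> complex) \<Rightarrow> bool" where
  "homogeneous_polynomial d p \<longleftrightarrow>
     (\<exists>a. \<forall>\<xi>. p \<xi> = (\<Sum>\<alpha> | sum \<alpha> UNIV = d. a \<alpha> * (\<Prod>i\<in>UNIV. (\<xi> $ i) ^ \<alpha> i)))"

text \<open>Projective space of dimension $N=$ \<open>CARD('i)\<close> is the space of hyperplanes in
  $\mathbb C^{N+1}$; the point with homogeneous coordinates \<open>\<xi>\<close> is the hyperplane
  $\sum_i\xi_iv_i=0$.\<close>

definition algebraic_set :: "(complex^('i::finite option)) set set \<Rightarrow> bool" where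
  "algebraic_set Z \<longleftrightarrow>
     (\<exists>I. (\<forall>p\<in>I. \<exists>d. homogeneous_polynomial d p) \<and>
          Z = {{v. (\<Sum>i\<in>UNIV. \<xi> $ i * v $ i) = 0} | \<xi>. \<xi> \<noteq> 0 \<and> (\<forall>p\<in>I. p \<xi> = 0)})"

text \<open>\<open>f\<close> identifies the complex manifold \<open>S\<close> with an algebraic submanifold of projective space.\<close>

definition projective_algebraic ::
  "('s, 'm::complex_normed) cmanifold \<Rightarrow> ('s \<Rightarrow> (complex^('i::finite option)) set) \<Rightarrow> bool" where
  "projective_algebraic S f \<longleftrightarrow>
     complex_manifold S \<and> holomorphic_embedding S (PP Cbundle) f \<and> algebraic_set (f ` pts S)"

end

theory Submission
  imports Defs "HOL-Complex_Analysis.Cauchy_Integral_Formula"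
begin

text \<open>On $\mathbb C^r$ consider the function $K_0(y)=(16|y|^4-15\sum_i|y_i|^4)^{1/2}$. It defines a positively curved
  metric on $O(1)$ that is invariant under permutations and changes of sign of the coordinates, so every
  equivariant $\Psi$ maps this metric to a multiple of $|v|^2$. Let $\xi$ be homogeneous
  coordinates on $S$ and $a=\xi(s_0)$ with $a_k=1$, put $X=|\xi_k|^2$ and $Y=\sum_{i\ne k}|\xi_i-a_i\xi_k|^2$,
  and let $A(X,Y)$ be a matrix quadratic in $(X,Y)$ with a small off-diagonal entry. Then $K_0(A(X,Y)\eta)$
  is a metric on the dual of $E=O(4)\otimes\mathbb C^r$. Its square is a sum of squared moduli of holomorphic functions
  that form an immersion, so the corresponding metric on the line bundle is positively curved. By
  equivariance the metric induced by $\Psi$ is dual to a multiple of $|A(X,Y)\eta|^2$, and the off-diagonal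
  entry makes this function have a strict local maximum at $s_0$ along some constant section $\eta$.\<close>

section \<open>Holomorphic functions of several variables\<close>

text \<open>\<Psi> is an arbitrary map, without continuity, so nothing relates its values on fibre
  metrics of different types. All fibre metrics are therefore kept in one GL orbit, that of a metric
  with a large stabilizer; \<Psi> is then known on all fibres up to a single constant. To first
  order in t, |A(1,t) \<eta>|^2 changes by t times 4 \<Sum> |\<eta>_i|^2 over i \<noteq> \<beta>,
  plus |\<eta>_\<beta>|^2 / 288, minus Re(\<eta>_\<beta> cnj \<eta>_\<alpha>) / 4. This form is
  barely indefinite, as (1/4)^2 exceeds 4 * 4 / 288. For K_0 the cross term is harmless: the
  products |y_i|^2 |y_j|^2 with i \<noteq> j weigh 16 times as much in K_0^2 as in |y|^4 and
  dominate it. The entries of A are homogeneous of degree 2 in (X,Y), which leads to the fourth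
  power O(4), and the diagonal stays positive, so A is invertible over all of S. Estimates of second
  derivatives are avoided: for the root of a sum of squares strong plurisubharmonicity follows from
  Cauchy-Schwarz, and the sum of squares comes from a polynomial identity.\<close>

lemma scaleC_zero_right [simp]: "c *\<^sub>C (0::'a::complex_normed) = 0"
  by (metis mult_zero_right norm_eq_zero norm_scaleC norm_zero)

lemma scaleC_zero_left [simp]: "0 *\<^sub>C (x::'a::complex_normed) = 0"
  by (metis mult_zero_left norm_eq_zero norm_scaleC norm_zero)

lemma scaleC_one [simp]: "1 *\<^sub>C (x::'a::complex_normed) = x"
  by (metis of_real_1 scaleC_of_real scaleR_one)

lemma scaleC_complex [simp]: "c *\<^sub>C (x::complex) = c * x"
  by (simp add: scaleC_complex_def)

lemma scaleC_vec_nth [simp]: "(c *\<^sub>C x) $ i = c *\<^sub>C (x $ i)"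
  by (simp add: scaleC_vec_def)

lemma fst_scaleC [simp]: "fst (c *\<^sub>C p) = c *\<^sub>C fst p"
  and snd_scaleC [simp]: "snd (c *\<^sub>C p) = c *\<^sub>C snd p"
  by (simp_all add: scaleC_prod_def)

lemma bounded_linear_scaleC_left: "bounded_linear (\<lambda>c. c *\<^sub>C (v::'a::complex_normed))"
proof (rule bounded_linear_intro[where K="norm v"])
  show "(r *\<^sub>R x) *\<^sub>C v = r *\<^sub>R (x *\<^sub>C v)" for r x
    by (metis scaleC_of_real scaleC_scaleC scaleR_conv_of_real)
qed (auto simp: scaleC_add_left norm_scaleC)

abbreviation Dv :: "('a::real_normed_vector \<Rightarrow> 'b::real_normed_vector) \<Rightarrow> 'a \<Rightarrow> 'a \<Rightarrow> 'b"
  where "Dv f z v \<equiv> frechet_derivative f (at z) v"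

lemma Dv_eqI: "(f has_derivative D) (at z) \<Longrightarrow> Dv f z v = D v"
  by (metis frechet_derivative_at)

lemma holo_onI:
  assumes "\<And>z. z \<in> U \<Longrightarrow> (f has_derivative D z) (at z)"
    and "\<And>z c v. z \<in> U \<Longrightarrow> D z (c *\<^sub>C v) = c *\<^sub>C D z v"
  shows "holo_on U f"
  using assms unfolding holo_on_def by blast

lemma holo_on_has_derivative:
  assumes "holo_on U f" "z \<in> U" shows "(f has_derivative Dv f z) (at z)"
  using assms unfolding holo_on_def by (metis frechet_derivative_at)

lemma holo_on_scaleC:
  assumes "holo_on U f" "z \<in> U" shows "Dv f z (c *\<^sub>C v) = c *\<^sub>C Dv f z v"
  using assms unfolding holo_on_def by (metis frechet_derivative_at)

lemma holo_on_continuous: "holo_on U f \<Longrightarrow> continuous_on U f"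
  unfolding holo_on_def by (meson continuous_at_imp_continuous_on has_derivative_continuous)

lemma holo_on_subset: "holo_on U f \<Longrightarrow> V \<subseteq> U \<Longrightarrow> holo_on V f"
  unfolding holo_on_def by blast

lemma holo_on_cong:
  assumes "holo_on U f" "open U" "\<And>z. z \<in> U \<Longrightarrow> f z = g z" shows "holo_on U g"
  using assms unfolding holo_on_def by (metis has_derivative_transform_within_open)

lemma holo_on_const [intro]: "holo_on U (\<lambda>z. c)"
  by (rule holo_onI[where D="\<lambda>_ _. 0"]) auto

lemma holo_on_linear:
  assumes "bounded_linear f" "\<And>c v. f (c *\<^sub>C v) = c *\<^sub>C f v" shows "holo_on U f"
  by (rule holo_onI[where D="\<lambda>_. f"]) (use assms in \<open>auto intro: bounded_linear_imp_has_derivative\<close>)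

lemma holo_on_add [intro]:
  assumes "holo_on U f" "holo_on U g" shows "holo_on U (\<lambda>z. f z + g z)"
  by (rule holo_onI[where D="\<lambda>z v. Dv f z v + Dv g z v"])
    (use assms in \<open>auto intro!: derivative_eq_intros holo_on_has_derivative
      simp: holo_on_scaleC scaleC_add_right\<close>)

lemma holo_on_mult [intro]:
  fixes f g :: "'a::complex_normed \<Rightarrow> complex"
  assumes "holo_on U f" "holo_on U g" shows "holo_on U (\<lambda>z. f z * g z)"
  by (rule holo_onI[where D="\<lambda>z v. f z * Dv g z v + Dv f z v * g z"])
    (use assms in \<open>auto intro: has_derivative_mult holo_on_has_derivative
      simp: holo_on_scaleC distrib_left\<close>)

lemma holo_on_minus [intro]:
  fixes f :: "'a::complex_normed \<Rightarrow> complex"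
  assumes "holo_on U f" shows "holo_on U (\<lambda>z. - f z)"
  using holo_on_mult[OF holo_on_const[of U "-1"] assms] by simp

lemma holo_on_diff [intro]:
  fixes f g :: "'a::complex_normed \<Rightarrow> complex"
  assumes "holo_on U f" "holo_on U g" shows "holo_on U (\<lambda>z. f z - g z)"
  using holo_on_add[OF assms(1) holo_on_minus[OF assms(2)]] by simp

lemma holo_on_power [intro]:
  fixes f :: "'a::complex_normed \<Rightarrow> complex"
  shows "holo_on U f \<Longrightarrow> holo_on U (\<lambda>z. f z ^ n)"
  by (induction n) auto

lemma holo_on_inverse:
  fixes f :: "'a::complex_normed \<Rightarrow> complex"
  assumes "holo_on U f" "\<And>z. z \<in> U \<Longrightarrow> f z \<noteq> 0" shows "holo_on U (\<lambda>z. inverse (f z))"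
  by (rule holo_onI[where D="\<lambda>z v. - (inverse (f z) * Dv f z v * inverse (f z))"])
    (use assms in \<open>auto intro: Deriv.has_derivative_inverse[OF _ holo_on_has_derivative]
      simp: holo_on_scaleC\<close>)

lemma holo_on_divide [intro]:
  fixes f g :: "'a::complex_normed \<Rightarrow> complex"
  assumes "holo_on U f" "holo_on U g" "\<And>z. z \<in> U \<Longrightarrow> g z \<noteq> 0" shows "holo_on U (\<lambda>z. f z / g z)"
  using holo_on_mult[OF assms(1) holo_on_inverse[OF assms(2,3)]] by (simp add: divide_inverse)

lemma holo_on_compose:
  assumes "holo_on U f" "holo_on V g" "f ` U \<subseteq> V" shows "holo_on U (\<lambda>z. g (f z))"
proof (rule holo_onI)
  fix z assume z: "z \<in> U"
  then have "f z \<in> V" using assms(3) by blast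
  show "((\<lambda>z. g (f z)) has_derivative (\<lambda>v. Dv g (f z) (Dv f z v))) (at z)"
    by (rule has_derivative_compose[OF holo_on_has_derivative[OF assms(1) z]
          holo_on_has_derivative[OF assms(2) \<open>f z \<in> V\<close>]])
  show "Dv g (f z) (Dv f z (c *\<^sub>C v)) = c *\<^sub>C Dv g (f z) (Dv f z v)" for c v
    using z \<open>f z \<in> V\<close> assms by (simp add: holo_on_scaleC)
qed

lemma holo_on_Pair [intro]:
  assumes "holo_on U f" "holo_on U g" shows "holo_on U (\<lambda>z. (f z, g z))"
  by (rule holo_onI[where D="\<lambda>z v. (Dv f z v, Dv g z v)"])
    (use assms in \<open>auto intro!: has_derivative_Pair holo_on_has_derivative
      simp: holo_on_scaleC scaleC_prod_def\<close>)

lemma holo_on_vec: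
  fixes f :: "'a::complex_normed \<Rightarrow> complex^'n::finite"
  assumes "\<And>i. holo_on U (\<lambda>z. f z $ i)" shows "holo_on U f"
proof (rule holo_onI)
  fix z assume z: "z \<in> U"
  let ?D = "\<lambda>v. \<chi> i. Dv (\<lambda>z. f z $ i) z v"
  show "(f has_derivative ?D) (at z)"
  proof (subst has_derivative_componentwise_within, rule ballI)
    fix b :: "complex^'n" assume "b \<in> Basis"
    then obtain i u where b: "b = axis i u" by (auto simp: Basis_vec_def)
    have "((\<lambda>x. f x $ i) has_derivative (\<lambda>v. Dv (\<lambda>z. f z $ i) z v)) (at z)"
      by (rule holo_on_has_derivative[OF assms z])
    then show "((\<lambda>x. f x \<bullet> b) has_derivative (\<lambda>x. ?D x \<bullet> b)) (at z)"
      by (auto simp: b inner_axis intro: has_derivative_inner_left)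
  qed
  show "?D (c *\<^sub>C v) = c *\<^sub>C ?D v" for c v
    using holo_on_scaleC[OF assms z] by (simp add: vec_eq_iff)
qed

lemma holo_on_nth: "holo_on U f \<Longrightarrow> holo_on U (\<lambda>z. f z $ i)"
  by (rule holo_on_compose[where V=UNIV]) (auto intro!: holo_on_linear bounded_linear_vec_nth)

lemma holo_on_fst: "holo_on U f \<Longrightarrow> holo_on U (\<lambda>z. fst (f z))"
  by (rule holo_on_compose[where V=UNIV]) (auto intro!: holo_on_linear bounded_linear_fst)

lemma holo_on_snd: "holo_on U f \<Longrightarrow> holo_on U (\<lambda>z. snd (f z))"
  by (rule holo_on_compose[where V=UNIV]) (auto intro!: holo_on_linear bounded_linear_snd)

lemma holo_on_ident [intro]: "holo_on U (\<lambda>z. z)"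
  by (intro holo_on_linear bounded_linear_ident refl)

section \<open>Cauchy estimates along complex lines, and holomorphy of derivatives\<close>

lemma holo_on_line:
  fixes f :: "'a::complex_normed \<Rightarrow> complex"
  assumes "holo_on U f" "x + c *\<^sub>C h \<in> U"
  shows "((\<lambda>c. f (x + c *\<^sub>C h)) has_field_derivative Dv f (x + c *\<^sub>C h) h) (at c)"
proof -
  have "((\<lambda>c. x + c *\<^sub>C h) has_derivative (\<lambda>c. c *\<^sub>C h)) (at c)"
    by (auto intro!: derivative_eq_intros bounded_linear.has_derivative[OF bounded_linear_scaleC_left])
  from has_derivative_compose[OF this holo_on_has_derivative[OF assms]]
  show ?thesis
    unfolding has_field_derivative_def
    by (rule has_derivative_eq_rhs) (simp add: holo_on_scaleC[OF assms] mult.commute fun_eq_iff)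
qed

text \<open>Cauchy's inequality in one variable, applied to the restriction of f to the complex line
  through x in direction h; working on lines keeps the model space arbitrary. The factor 2 pays for
  a closed disc inside the open ball.\<close>

lemma holo_on_Cauchy_estimate:
  fixes f :: "'a::complex_normed \<Rightarrow> complex"
  assumes f: "holo_on (ball x r) f" and r: "0 < r" and B: "\<And>y. y \<in> ball x r \<Longrightarrow> cmod (f y) \<le> B"
  shows "cmod (Dv f x h) \<le> 2 * B / r * norm h"
proof (cases "h = 0")
  case True
  then show ?thesis
    using holo_on_has_derivative[OF f, of x] r
    by (simp add: bounded_linear.linear has_derivative_bounded_linear linear_0)
next
  case False
  define \<rho> where "\<rho> = r / (2 * norm h)"
  have \<rho>: "0 < \<rho>" "\<rho> * norm h < r" using False r by (auto simp: \<rho>_def)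
  have mem: "x + c *\<^sub>C h \<in> ball x r" if "cmod c \<le> \<rho>" for c
    using that \<rho> mult_right_mono[OF that norm_ge_zero[of h]]
    by (simp add: dist_norm norm_scaleC)
  have der: "((\<lambda>c. f (x + c *\<^sub>C h)) has_field_derivative Dv f (x + c *\<^sub>C h) h) (at c)"
    if "cmod c \<le> \<rho>" for c
    using holo_on_line[OF f mem[OF that]] .
  have "cmod ((deriv ^^ 1) (\<lambda>c. f (x + c *\<^sub>C h)) 0) \<le> fact 1 * B / \<rho> ^ 1"
  proof (rule Cauchy_inequality)
    show "(\<lambda>c. f (x + c *\<^sub>C h)) holomorphic_on ball 0 \<rho>"
      using der by (intro holomorphic_onI) (auto simp: field_differentiable_def dest!: less_imp_le
          intro: has_field_derivative_at_within)
    show "continuous_on (cball 0 \<rho>) (\<lambda>c. f (x + c *\<^sub>C h))"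
      by (intro continuous_at_imp_continuous_on ballI DERIV_isCont[OF der]) simp
    show "cmod (f (x + c *\<^sub>C h)) \<le> B" if "cmod (0 - c) = \<rho>" for c
      using B[OF mem[of c]] that by simp
  qed (use \<rho> in auto)
  moreover have "deriv (\<lambda>c. f (x + c *\<^sub>C h)) 0 = Dv f x h"
    using DERIV_imp_deriv[OF der[of 0]] \<rho> by simp
  ultimately show ?thesis
    using False by (simp add: \<rho>_def mult_ac)
qed

text \<open>Taylor's formula of order one for g(c) = f(x + c h) between c = 0 and c = 1. The second
  derivative on the unit disc is bounded by Cauchy's inequality on discs of radius \<rho> about its
  points; these lie in the disc of radius 2 \<rho>, where g is bounded by B, because \<rho> \<ge>
  1.\<close>

lemma holo_on_second_order:
  fixes f :: "'a::complex_normed \<Rightarrow> complex"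
  assumes f: "holo_on (ball x r) f" and r: "0 < r" and B: "\<And>y. y \<in> ball x r \<Longrightarrow> cmod (f y) \<le> B"
    and h: "4 * norm h \<le> r"
  shows "cmod (f (x + h) - f x - Dv f x h) \<le> 32 * B / r\<^sup>2 * (norm h)\<^sup>2"
proof (cases "h = 0")
  case True
  then show ?thesis
    using holo_on_has_derivative[OF f, of x] r
    by (simp add: bounded_linear.linear has_derivative_bounded_linear linear_0)
next
  case False
  define \<rho> where "\<rho> = r / (4 * norm h)"
  have \<rho>: "1 \<le> \<rho>" "2 * \<rho> * norm h < r" using False r h by (auto simp: \<rho>_def)
  define g where "g = (\<lambda>c. f (x + c *\<^sub>C h))"
  have mem: "x + c *\<^sub>C h \<in> ball x r" if "cmod c \<le> 2 * \<rho>" for c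
    using that \<rho> mult_right_mono[OF that norm_ge_zero[of h]]
    by (simp add: dist_norm norm_scaleC)
  have der: "(g has_field_derivative Dv f (x + c *\<^sub>C h) h) (at c)" if "cmod c \<le> 2 * \<rho>" for c
    using holo_on_line[OF f mem[OF that]] unfolding g_def .
  have hol: "g holomorphic_on ball 0 (2 * \<rho>)"
    using der by (intro holomorphic_onI) (auto simp: field_differentiable_def dest!: less_imp_le
        intro: has_field_derivative_at_within)
  have cont: "continuous_on (cball 0 (2 * \<rho>)) g"
    by (intro continuous_at_imp_continuous_on ballI DERIV_isCont[OF der]) simp
  have sub: "cball c \<rho> \<subseteq> cball 0 (2 * \<rho>)" if "cmod c \<le> 1" for c
    using that \<rho>(1) by (simp add: cball_subset_cball_iff)
  have d2: "cmod ((deriv ^^ 2) g c) \<le> fact 2 * B / \<rho> ^ 2" if c: "cmod c \<le> 1" for c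
  proof (rule Cauchy_inequality)
    show "g holomorphic_on ball c \<rho>"
      using hol by (rule holomorphic_on_subset) (use c \<rho> in \<open>simp add: ball_subset_ball_iff\<close>)
    show "continuous_on (cball c \<rho>) g"
      using cont sub[OF c] continuous_on_subset by blast
    show "cmod (g y) \<le> B" if "cmod (c - y) = \<rho>" for y
    proof -
      have "y \<in> cball c \<rho>" using that by (simp add: dist_norm)
      then have "cmod y \<le> 2 * \<rho>" using sub[OF c] by auto
      then show ?thesis using B[OF mem] by (simp add: g_def)
    qed
  qed (use \<rho> in auto)
  have "cmod (g 1 - (\<Sum>i\<le>1. (deriv ^^ i) g 0 * (1 - 0) ^ i / fact i))
      \<le> (fact 2 * B / \<rho> ^ 2) * cmod (1 - 0) ^ Suc 1 / fact 1"
  proof (rule complex_Taylor[where S="cball 0 1" and f="\<lambda>i. (deriv ^^ i) g", simplified funpow_0])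
    show "((deriv ^^ i) g has_field_derivative (deriv ^^ Suc i) g c) (at c within cball 0 1)"
      if "c \<in> cball 0 1" for c i
    proof -
      have "c \<in> ball 0 (2 * \<rho>)" using that \<rho> by auto
      then have "((deriv ^^ i) g has_field_derivative deriv ((deriv ^^ i) g) c) (at c)"
        using hol by (intro holomorphic_derivI[OF holomorphic_higher_deriv]) auto
      then show ?thesis by (simp add: has_field_derivative_at_within)
    qed
    show "cmod ((deriv ^^ Suc 1) g c) \<le> fact 2 * B / \<rho> ^ 2" if "c \<in> cball 0 1" for c
      using d2[of c] that by (simp add: numeral_2_eq_2)
  qed auto
  moreover have "deriv g 0 = Dv f x h"
    using DERIV_imp_deriv[OF der[of 0]] \<rho> by simp
  ultimately have "cmod (f (x + h) - f x - Dv f x h) \<le> 2 * B / \<rho>\<^sup>2"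
    by (simp add: g_def diff_diff_eq)
  also have "2 * B / \<rho>\<^sup>2 = 32 * B / r\<^sup>2 * (norm h)\<^sup>2"
    using r False by (simp add: \<rho>_def power_divide power_mult_distrib)
  finally show ?thesis .
qed

lemma ball_half_subset:
  fixes x y :: "'a::metric_space"
  assumes "y \<in> ball x (r / 2)" shows "ball y (r / 2) \<subseteq> ball x r"
proof
  fix z assume "z \<in> ball y (r / 2)"
  then show "z \<in> ball x r"
    using assms dist_triangle[of x z y] by simp
qed

text \<open>Weierstrass' theorem. The Cauchy estimate for the differences F_m - F_n turns uniform
  convergence of the functions into uniform convergence of their derivatives as linear maps, on a
  ball of half the radius. The limit is then differentiable, and complex linearity of the
  derivatives passes to the limit.\<close>

lemma holo_on_uniform_limit:
  fixes F :: "nat \<Rightarrow> 'a::complex_normed \<Rightarrow> complex"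
  assumes F: "\<And>n. holo_on (ball x r) (F n)" and r: "0 < r"
    and lim: "uniform_limit (ball x r) F f sequentially"
  shows "holo_on (ball x (r / 2)) f"
proof -
  let ?S = "ball x (r / 2)"
  have sub: "ball y (r / 2) \<subseteq> ball x r" if "y \<in> ?S" for y
    by (rule ball_half_subset[OF that])
  have sub2: "?S \<subseteq> ball x r" using r by (intro subset_ball) simp
  have der: "(F n has_derivative Dv (F n) y) (at y)" if "y \<in> ?S" for n y
    using holo_on_has_derivative[OF F] that sub2 by blast
  have Cau: "\<exists>N. \<forall>m\<ge>N. \<forall>n\<ge>N. \<forall>y\<in>?S. \<forall>h. cmod (Dv (F m) y h - Dv (F n) y h) \<le> e * norm h"
    if e: "0 < e" for e
  proof -
    have "\<forall>\<^sub>F n in sequentially. \<forall>y\<in>ball x r. dist (F n y) (f y) < e * r / 8"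
      using uniform_limitD[OF lim, of "e * r / 8"] e r by simp
    then obtain N where N: "\<And>n y. n \<ge> N \<Longrightarrow> y \<in> ball x r \<Longrightarrow> dist (F n y) (f y) < e * r / 8"
      unfolding eventually_sequentially by blast
    have "cmod (Dv (F m) y h - Dv (F n) y h) \<le> e * norm h"
      if mn: "m \<ge> N" "n \<ge> N" and y: "y \<in> ?S" for m n y h
    proof -
      let ?g = "\<lambda>z. F m z - F n z"
      have holo: "holo_on (ball y (r / 2)) ?g"
        using F sub[OF y] by (intro holo_on_diff) (blast intro: holo_on_subset)+
      have "cmod (?g z) \<le> e * r / 4" if "z \<in> ball y (r / 2)" for z
        using dist_triangle2[of "F m z" "F n z" "f z"] N[OF mn(1), of z] N[OF mn(2), of z] that sub[OF y]
        by (auto simp: dist_norm)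
      from holo_on_Cauchy_estimate[OF holo _ this, of h]
      have "cmod (Dv ?g y h) \<le> e * norm h" using r by simp
      moreover have "Dv ?g y h = Dv (F m) y h - Dv (F n) y h"
        by (intro Dv_eqI has_derivative_diff der y)
      ultimately show ?thesis by simp
    qed
    then show ?thesis by blast
  qed
  define G where "G = (\<lambda>y h. lim (\<lambda>n. Dv (F n) y h))"
  have conv: "(\<lambda>n. Dv (F n) y h) \<longlonglongrightarrow> G y h" if y: "y \<in> ?S" for y h
  proof -
    have "Cauchy (\<lambda>n. Dv (F n) y h)"
    proof (rule metric_CauchyI)
      fix e :: real assume e: "0 < e"
      have pos: "0 < norm h + 1" by (simp add: add_nonneg_pos)
      then have "0 < e / (norm h + 1)" using e by simp
      from Cau[OF this] y obtain N where N: "\<And>m n. m \<ge> N \<Longrightarrow> n \<ge> N \<Longrightarrow>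
          cmod (Dv (F m) y h - Dv (F n) y h) \<le> e / (norm h + 1) * norm h" by blast
      have "e / (norm h + 1) * norm h < e / (norm h + 1) * (norm h + 1)"
        using e pos by (intro mult_strict_left_mono) auto
      also have "\<dots> = e" using pos by simp
      finally have "dist (Dv (F m) y h) (Dv (F n) y h) < e" if "m \<ge> N" "n \<ge> N" for m n
        using N[OF that] by (simp add: dist_norm)
      then show "\<exists>M. \<forall>m\<ge>M. \<forall>n\<ge>M. dist (Dv (F m) y h) (Dv (F n) y h) < e" by blast
    qed
    then show ?thesis
      unfolding G_def by (simp add: Cauchy_convergent_iff convergent_LIMSEQ_iff)
  qed
  have unif: "\<forall>\<^sub>F n in sequentially. \<forall>y\<in>?S. \<forall>h. cmod (Dv (F n) y h - G y h) \<le> e * norm h"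
    if e: "0 < e" for e
  proof -
    from Cau[OF e] obtain N where N: "\<And>m n y h. m \<ge> N \<Longrightarrow> n \<ge> N \<Longrightarrow> y \<in> ?S \<Longrightarrow>
        cmod (Dv (F m) y h - Dv (F n) y h) \<le> e * norm h" by blast
    have "cmod (Dv (F n) y h - G y h) \<le> e * norm h" if "n \<ge> N" "y \<in> ?S" for n y h
    proof (rule Lim_bounded)
      show "(\<lambda>m. cmod (Dv (F n) y h - Dv (F m) y h)) \<longlonglongrightarrow> cmod (Dv (F n) y h - G y h)"
        by (intro tendsto_intros conv that)
      show "\<forall>m\<ge>N. cmod (Dv (F n) y h - Dv (F m) y h) \<le> e * norm h"
        using N that by blast
    qed
    then show ?thesis unfolding eventually_sequentially by blast
  qed
  have ptw: "(\<lambda>n. F n y) \<longlonglongrightarrow> f y" if "y \<in> ?S" for y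
    using tendsto_uniform_limitI[OF lim] that sub2 by blast
  have "\<exists>g. \<forall>y\<in>?S. (\<lambda>n. F n y) \<longlonglongrightarrow> g y \<and> (g has_derivative G y) (at y within ?S)"
  proof (rule has_derivative_sequence[where f'="\<lambda>n. Dv (F n)"])
    show "(F n has_derivative Dv (F n) y) (at y within ?S)" if "y \<in> ?S" for n y
      using der[OF that] by (rule has_derivative_at_withinI)
    show "(\<lambda>n. F n x) \<longlonglongrightarrow> f x" using ptw r by simp
  qed (use unif r in auto)
  then obtain g where g: "\<And>y. y \<in> ?S \<Longrightarrow> (\<lambda>n. F n y) \<longlonglongrightarrow> g y"
    "\<And>y. y \<in> ?S \<Longrightarrow> (g has_derivative G y) (at y within ?S)" by blast
  have "holo_on ?S g"
  proof (rule holo_onI)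
    show "(g has_derivative G y) (at y)" if "y \<in> ?S" for y
      using g(2)[OF that] that by (simp add: at_within_open[OF _ open_ball])
    show "G y (c *\<^sub>C v) = c *\<^sub>C G y v" if y: "y \<in> ?S" for y c v
    proof -
      have "(\<lambda>n. Dv (F n) y (c *\<^sub>C v)) \<longlonglongrightarrow> c *\<^sub>C G y v"
      proof -
        have "(\<lambda>n. c * Dv (F n) y v) \<longlonglongrightarrow> c * G y v" by (intro tendsto_intros conv y)
        moreover have "Dv (F n) y (c *\<^sub>C v) = c * Dv (F n) y v" for n
          using holo_on_scaleC[OF F[of n], of y c v] y sub2 by auto
        ultimately show ?thesis by simp
      qed
      then show ?thesis using conv[OF y] LIMSEQ_unique by blast
    qed
  qed
  then show ?thesis
    by (rule holo_on_cong) (use LIMSEQ_unique[OF g(1) ptw] in auto)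
qed

text \<open>The difference quotients \<open>N (f (z + v / N) - f z)\<close> are holomorphic and converge locally
  uniformly to the directional derivative.\<close>

lemma holo_on_Dv:
  fixes f :: "'a::complex_normed \<Rightarrow> complex"
  assumes f: "holo_on U f" and U: "open U"
  shows "holo_on U (\<lambda>z. Dv f z v)"
proof -
  have "\<exists>r>0. holo_on (ball x r) (\<lambda>z. Dv f z v)" if x: "x \<in> U" for x
  proof -
    have "isCont f x" using holo_on_continuous[OF f] U x continuous_on_eq_continuous_at by blast
    then have "(f \<longlongrightarrow> f x) (nhds x)" by (simp add: isCont_def tendsto_at_iff_tendsto_nhds)
    then have "\<forall>\<^sub>F y in nhds x. y \<in> U \<and> dist (f y) (f x) < 1"
      by (intro eventually_conj tendstoD eventually_nhds_in_open[OF U x]) auto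
    then obtain r where r: "0 < r" and sub: "\<And>y. y \<in> ball x r \<Longrightarrow> y \<in> U \<and> dist (f y) (f x) < 1"
      unfolding eventually_nhds_metric by (auto simp: dist_commute)
    define B where "B = cmod (f x) + 1"
    have B: "cmod (f y) \<le> B" if "y \<in> ball x r" for y
      using sub[OF that] norm_triangle_sub[of "f y" "f x"] by (simp add: B_def dist_norm)
    have B0: "0 < B" by (simp add: B_def add_nonneg_pos)
    have holo: "holo_on (ball x r) f" using f sub by (meson holo_on_subset subsetI)
    \<comment> \<open>With this shift the increment v / (N0 + n) has norm at most r/8 for every n,
      including n = 0, as the second order estimate on balls of radius r/2 demands.\<close>
    define N0 where "N0 = 4 * norm v / (r / 2) + 1"
    have N0: "N0 \<ge> 1" using r by (simp add: N0_def)
    define F where "F = (\<lambda>(n::nat) z. of_real (N0 + n) * (f (z + (1 / (N0 + n)) *\<^sub>R v) - f z))"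
    have small: "4 * norm ((1 / (N0 + n)) *\<^sub>R v) \<le> r / 2" for n :: nat
    proof -
      have "4 * norm v \<le> r / 2 * N0" using r by (simp add: N0_def field_simps)
      also have "\<dots> \<le> r / 2 * (N0 + n)" using r by (intro mult_left_mono) auto
      finally show ?thesis using N0 by (simp add: field_simps)
    qed
    have sub2: "ball y (r / 2) \<subseteq> ball x r" if "y \<in> ball x (r / 2)" for y
      by (rule ball_half_subset[OF that])
    have "holo_on (ball x (r / 2)) (F n)" for n
    proof -
      have "z + (1 / (N0 + n)) *\<^sub>R v \<in> ball x r" if "z \<in> ball x (r / 2)" for z
      proof -
        have "norm ((1 / (N0 + n)) *\<^sub>R v) < r / 2" using small[of n] r norm_ge_zero[of "(1 / (N0 + n)) *\<^sub>R v"] by linarith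
        then have "z + (1 / (N0 + n)) *\<^sub>R v \<in> ball z (r / 2)" by (simp add: dist_norm)
        then show ?thesis using sub2[OF that] by blast
      qed
      then have "holo_on (ball x (r / 2)) (\<lambda>z. f (z + (1 / (N0 + n)) *\<^sub>R v))"
        by (intro holo_on_compose[OF _ holo] holo_on_add holo_on_ident holo_on_const) auto
      moreover have "holo_on (ball x (r / 2)) f"
        by (rule holo_on_subset[OF holo]) (use r in \<open>auto intro: subset_ball\<close>)
      ultimately show ?thesis
        unfolding F_def by (intro holo_on_mult holo_on_diff holo_on_const)
    qed
    moreover have "uniform_limit (ball x (r / 2)) F (\<lambda>z. Dv f z v) sequentially"
    proof (rule uniform_limitI)
      fix e :: real assume e: "0 < e"
      define C where "C = 32 * B / (r / 2)\<^sup>2 * (norm v)\<^sup>2"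
      obtain M :: nat where M: "C / e < M" using reals_Archimedean2 by blast
      have "dist (F n y) (Dv f y v) < e" if y: "y \<in> ball x (r / 2)" and n: "n \<ge> M" for n y
      proof -
        let ?t = "1 / (N0 + n)"
        have t: "0 < ?t" using N0 by simp
        have lin: "Dv f y (?t *\<^sub>R v) = of_real ?t * Dv f y v"
        proof -
          have "y \<in> ball x r" using y r by simp
          then show ?thesis
            unfolding scaleC_of_real[symmetric] by (subst holo_on_scaleC[OF holo]) simp_all
        qed
        have "cmod (f (y + ?t *\<^sub>R v) - f y - Dv f y (?t *\<^sub>R v))
            \<le> 32 * B / (r / 2)\<^sup>2 * (norm (?t *\<^sub>R v))\<^sup>2"
        proof (rule holo_on_second_order)
          show "holo_on (ball y (r / 2)) f" using holo sub2[OF y] holo_on_subset by blast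
          show "cmod (f z) \<le> B" if "z \<in> ball y (r / 2)" for z using B sub2[OF y] that by blast
        qed (use small r in auto)
        also have "\<dots> = C * ?t\<^sup>2"
          by (simp add: C_def power_mult_distrib power_divide)
        finally have est: "cmod (f (y + ?t *\<^sub>R v) - f y - of_real ?t * Dv f y v) \<le> C * ?t\<^sup>2"
          by (simp only: lin)
        have "F n y - Dv f y v
            = of_real (N0 + n) * (f (y + ?t *\<^sub>R v) - f y - of_real ?t * Dv f y v)"
          using N0 by (simp add: F_def field_simps of_real_divide flip: of_real_add)
        then have "dist (F n y) (Dv f y v)
            = (N0 + n) * cmod (f (y + ?t *\<^sub>R v) - f y - of_real ?t * Dv f y v)"
          using N0 by (simp add: dist_norm norm_mult flip: of_real_add)
        also have "\<dots> \<le> (N0 + n) * (C * ?t\<^sup>2)" using est N0 by (intro mult_left_mono) auto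
        also have "\<dots> = C / (N0 + n)"
        proof -
          have "N0 + n \<noteq> 0" using N0 by simp
          then show ?thesis by (simp add: power2_eq_square)
        qed
        also have "\<dots> < e"
        proof -
          have "C / e < N0 + n" using M n N0 by (smt (verit) of_nat_le_iff)
          then show ?thesis using e N0 by (simp add: field_simps)
        qed
        finally show ?thesis .
      qed
      then show "\<forall>\<^sub>F n in sequentially. \<forall>y\<in>ball x (r / 2). dist (F n y) (Dv f y v) < e"
        unfolding eventually_sequentially by blast
    qed
    ultimately have "holo_on (ball x (r / 2 / 2)) (\<lambda>z. Dv f z v)"
      using r by (intro holo_on_uniform_limit[where F=F and r="r / 2"]) auto
    then show ?thesis using r by (intro exI[of _ "r / 2 / 2"]) auto
  qed
  then show ?thesis
    unfolding holo_on_def by (metis centre_in_ball)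
qed

section \<open>Smooth functions and sums of squares of holomorphic functions\<close>

lemma k_smooth_on_cong:
  assumes "open U" "\<And>z. z \<in> U \<Longrightarrow> u z = v z" "k_smooth_on k U u"
  shows "k_smooth_on k U v"
  using assms
proof (induction k arbitrary: u v)
  case 0
  then show ?case using continuous_on_cong[of U U u v] by simp
next
  case (Suc k)
  have der: "(v has_derivative Dv u z) (at z)" if z: "z \<in> U" for z
  proof (rule has_derivative_transform_within_open[OF _ Suc.prems(1) z])
    show "(u has_derivative Dv u z) (at z)"
      using Suc.prems(3) z by (simp add: frechet_derivative_works[symmetric])
  qed (use Suc.prems(2) in simp)
  have "k_smooth_on k U (\<lambda>z. Dv v z w)" for w
  proof (rule Suc.IH[OF Suc.prems(1)])
    show "Dv u z w = Dv v z w" if "z \<in> U" for z using Dv_eqI[OF der[OF that]] by simp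
    show "k_smooth_on k U (\<lambda>z. Dv u z w)" using Suc.prems(3) by simp
  qed
  moreover have "v differentiable (at z)" if "z \<in> U" for z
    using der[OF that] by (rule differentiableI)
  ultimately show ?case by simp
qed

lemma k_smooth_on_Suc_imp: "k_smooth_on (Suc k) U u \<Longrightarrow> k_smooth_on k U u"
proof (induction k arbitrary: u)
  case 0
  then show ?case
    by (auto intro!: continuous_at_imp_continuous_on differentiable_imp_continuous_within)
next
  case (Suc k)
  then have "k_smooth_on k U (\<lambda>z. Dv u z v)" for v
    by (intro Suc.IH) (simp only: k_smooth_on.simps(2)[of "Suc k"])
  with Suc.prems show ?case by simp
qed

lemma k_smooth_on_const [intro]: "k_smooth_on k U (\<lambda>z. c)"
  by (induction k arbitrary: c) simp_all

lemma k_smooth_on_derivI: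
  assumes "open U" "\<And>z. z \<in> U \<Longrightarrow> (u has_derivative D z) (at z)" "\<And>w. k_smooth_on k U (\<lambda>z. D z w)"
  shows "k_smooth_on (Suc k) U u"
proof -
  have "k_smooth_on k U (\<lambda>z. Dv u z w)" for w
    by (rule k_smooth_on_cong[OF assms(1) _ assms(3)]) (rule Dv_eqI[OF assms(2), symmetric])
  then show ?thesis using assms(2) by (auto simp: differentiable_def)
qed

lemma k_smooth_on_has_derivative:
  "k_smooth_on (Suc k) U u \<Longrightarrow> z \<in> U \<Longrightarrow> (u has_derivative Dv u z) (at z)"
  by (simp add: frechet_derivative_works)

lemma k_smooth_on_add [intro]:
  assumes "open U" "k_smooth_on k U u" "k_smooth_on k U v"
  shows "k_smooth_on k U (\<lambda>z. u z + v z)"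
  using assms
proof (induction k arbitrary: u v)
  case (Suc k)
  show ?case
  proof (rule k_smooth_on_derivI[OF Suc.prems(1)])
    show "((\<lambda>z. u z + v z) has_derivative (\<lambda>w. Dv u z w + Dv v z w)) (at z)" if "z \<in> U" for z
      using Suc.prems that by (intro has_derivative_add k_smooth_on_has_derivative)
    show "k_smooth_on k U (\<lambda>z. Dv u z w + Dv v z w)" for w
      using Suc by auto
  qed
qed (auto intro: continuous_intros)

lemma k_smooth_on_mult [intro]:
  assumes "open U" "k_smooth_on k U u" "k_smooth_on k U v"
  shows "k_smooth_on k U (\<lambda>z. u z * v z)"
  using assms
proof (induction k arbitrary: u v)
  case (Suc k)
  show ?case
  proof (rule k_smooth_on_derivI[OF Suc.prems(1)])
    show "((\<lambda>z. u z * v z) has_derivative (\<lambda>w. u z * Dv v z w + Dv u z w * v z)) (at z)"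
      if "z \<in> U" for z
      using Suc.prems that by (intro has_derivative_mult k_smooth_on_has_derivative)
    show "k_smooth_on k U (\<lambda>z. u z * Dv v z w + Dv u z w * v z)" for w
      using Suc.prems k_smooth_on_Suc_imp[OF Suc.prems(2)] k_smooth_on_Suc_imp[OF Suc.prems(3)]
      by (intro k_smooth_on_add Suc.IH) auto
  qed
qed (auto intro: continuous_intros)

text \<open>The induction on k runs over all exponents p at once, since differentiation lowers p by
  one.\<close>

lemma k_smooth_on_powr:
  assumes "open U" "\<And>z. z \<in> U \<Longrightarrow> 0 < u z" "k_smooth_on k U u"
  shows "k_smooth_on k U (\<lambda>z. u z powr p)"
  using assms(3)
proof (induction k arbitrary: p)
  case 0
  have "\<forall>z\<in>U. u z \<noteq> 0" using assms(2) by fastforce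
  with 0 show ?case by (auto intro!: continuous_on_powr)
next
  case (Suc k)
  show ?case
  proof (rule k_smooth_on_derivI[OF assms(1)])
    show "((\<lambda>z. u z powr p) has_derivative (\<lambda>w. p * (u z powr (p - 1) * Dv u z w))) (at z)"
      if z: "z \<in> U" for z
    proof -
      have "((\<lambda>z. u z powr p) has_derivative
          (\<lambda>w. u z powr p * (0 * ln (u z) + Dv u z w * p / u z))) (at z)"
        by (rule has_derivative_powr[OF k_smooth_on_has_derivative[OF Suc.prems z] has_derivative_const])
          (use assms(2) z in auto)
      then show ?thesis
        by (rule has_derivative_eq_rhs)
          (use assms(2)[OF z] in \<open>simp add: fun_eq_iff powr_diff\<close>)
    qed
    show "k_smooth_on k U (\<lambda>z. p * (u z powr (p - 1) * Dv u z w))" for w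
      using Suc assms(1) k_smooth_on_Suc_imp by (intro k_smooth_on_mult k_smooth_on_const) auto
  qed
qed

lemma k_smooth_on_sqrt:
  assumes "open U" "\<And>z. z \<in> U \<Longrightarrow> 0 < u z" "k_smooth_on k U u"
  shows "k_smooth_on k U (\<lambda>z. sqrt (u z))"
  by (rule k_smooth_on_cong[OF assms(1) _ k_smooth_on_powr[OF assms, of "1/2"]])
    (rule powr_half_sqrt[OF less_imp_le[OF assms(2)]])

text \<open>The derivative of Re f in a fixed direction is again the real part of a holomorphic
  function, so the induction on k runs over all f.\<close>

lemma k_smooth_on_Re_holo:
  assumes "open U" "holo_on U f" shows "k_smooth_on k U (\<lambda>z. Re (f z))"
  using assms(2)
proof (induction k arbitrary: f)
  case 0
  then show ?case using holo_on_continuous by (auto intro: continuous_intros)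
next
  case (Suc k)
  show ?case
  proof (rule k_smooth_on_derivI[OF assms(1)])
    show "((\<lambda>z. Re (f z)) has_derivative (\<lambda>w. Re (Dv f z w))) (at z)" if "z \<in> U" for z
      using holo_on_has_derivative[OF Suc.prems that] by (rule has_derivative_Re)
    show "k_smooth_on k U (\<lambda>z. Re (Dv f z w))" for w
      by (rule Suc.IH[OF holo_on_Dv[OF Suc.prems assms(1)]])
  qed
qed

section \<open>Sums of squared moduli and the Levi form of their square roots\<close>

lemma k_smooth_on_cmod2_holo:
  assumes "open U" "holo_on U f" shows "k_smooth_on k U (\<lambda>z. (cmod (f z))\<^sup>2)"
proof -
  have "k_smooth_on k U (\<lambda>z. Re (f z) * Re (f z) + Re (- \<i> * f z) * Re (- \<i> * f z))"
    using assms by (intro k_smooth_on_add k_smooth_on_mult k_smooth_on_Re_holo holo_on_mult) auto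
  then show ?thesis unfolding cmod_power2 unfolding power2_eq_square by simp
qed

text \<open>The list of functions is a parameter because immersivity and the Levi form refer to the
  individual summands; \<open>sos\<close> forgets it and supports the purely algebraic
  manipulations.\<close>

definition sos_rep :: "'a::complex_normed set \<Rightarrow> ('a \<Rightarrow> complex) list \<Rightarrow> ('a \<Rightarrow> real) \<Rightarrow> bool" where
  "sos_rep U qs Q \<longleftrightarrow> (\<forall>q\<in>set qs. holo_on U q) \<and> (\<forall>z\<in>U. Q z = (\<Sum>q\<leftarrow>qs. (cmod (q z))\<^sup>2))"

definition sos :: "'a::complex_normed set \<Rightarrow> ('a \<Rightarrow> real) \<Rightarrow> bool" where
  "sos U Q \<longleftrightarrow> (\<exists>qs. sos_rep U qs Q)"

text \<open>N is where the summands jointly have injective derivative. In the applications it is the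
  complement of the zero section: there Q is homogeneous of degree 4 in the fibre variable, so the
  summands vanish to second order on the zero section and cannot be immersive at it.\<close>

definition immersive_sos :: "'a::complex_normed set \<Rightarrow> 'a set \<Rightarrow> ('a \<Rightarrow> real) \<Rightarrow> bool" where
  "immersive_sos U N Q \<longleftrightarrow> (\<exists>qs. sos_rep U qs Q \<and>
     (\<forall>z\<in>N. \<forall>w. (\<forall>q\<in>set qs. Dv q z w = 0) \<longrightarrow> w = 0))"

lemma sos_rep_smooth:
  assumes "open U" "sos_rep U qs Q" shows "k_smooth_on k U Q"
proof -
  have "\<forall>q\<in>set qs. holo_on U q" using assms(2) by (simp add: sos_rep_def)
  then have "k_smooth_on k U (\<lambda>z. \<Sum>q\<leftarrow>qs. (cmod (q z))\<^sup>2)"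
  proof (induction qs)
    case (Cons q qs)
    have "k_smooth_on k U (\<lambda>z. (cmod (q z))\<^sup>2 + (\<Sum>q\<leftarrow>qs. (cmod (q z))\<^sup>2))"
      by (rule k_smooth_on_add[OF assms(1) k_smooth_on_cmod2_holo[OF assms(1)] Cons.IH])
        (use Cons.prems in simp_all)
    then show ?case by simp
  qed (simp add: k_smooth_on_const)
  then show ?thesis
    by (rule k_smooth_on_cong[OF assms(1), rotated]) (use assms(2) in \<open>simp add: sos_rep_def\<close>)
qed

lemma wirtinger_eq:
  "(g has_derivative D) (at z) \<Longrightarrow> wirtinger w g z = (D w - \<i> * D (\<i> *\<^sub>C w)) / 2"
  by (simp add: wirtinger_def Dv_eqI)

lemma wirtinger_bar_eq:
  "(g has_derivative D) (at z) \<Longrightarrow> wirtinger_bar w g z = (D w + \<i> * D (\<i> *\<^sub>C w)) / 2"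
  by (simp add: wirtinger_bar_def Dv_eqI)

lemma frechet_derivative_cong:
  assumes "open U" "z \<in> U" "\<And>y. y \<in> U \<Longrightarrow> f y = g y"
  shows "frechet_derivative f (at z) = frechet_derivative g (at z)"
proof -
  have "(f has_derivative D) (at z) \<longleftrightarrow> (g has_derivative D) (at z)" for D
    using has_derivative_transform_within_open[OF _ assms(1,2), of f D UNIV g]
      has_derivative_transform_within_open[OF _ assms(1,2), of g D UNIV f] assms(3) by auto
  then show ?thesis by (simp add: frechet_derivative_def)
qed

lemma levi_cong:
  assumes "open U" "z \<in> U" "\<And>y. y \<in> U \<Longrightarrow> u y = v y" shows "levi u z w = levi v z w"
proof -
  have "wirtinger_bar w (\<lambda>y. complex_of_real (u y)) y
      = wirtinger_bar w (\<lambda>y. complex_of_real (v y)) y" if y: "y \<in> U" for y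
    unfolding wirtinger_bar_def
    by (subst (1 2) frechet_derivative_cong[OF assms(1) y, of _ "\<lambda>y. complex_of_real (v y)"])
      (simp_all add: assms(3))
  then show ?thesis
    unfolding levi_def wirtinger_def
    by (subst (1 2) frechet_derivative_cong[OF assms(1,2),
          of _ "wirtinger_bar w (\<lambda>y. complex_of_real (v y))"]) simp_all
qed

lemma complex_Cauchy_Schwarz:
  "(cmod (\<Sum>i\<in>I. a i * cnj (b i)))\<^sup>2 \<le> (\<Sum>i\<in>I. (cmod (a i))\<^sup>2) * (\<Sum>i\<in>I. (cmod (b i))\<^sup>2)"
proof -
  have "cmod (\<Sum>i\<in>I. a i * cnj (b i)) \<le> (\<Sum>i\<in>I. cmod (a i) * cmod (b i))"
    by (rule order_trans[OF norm_sum]) (simp add: norm_mult)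
  then have "(cmod (\<Sum>i\<in>I. a i * cnj (b i)))\<^sup>2 \<le> (\<Sum>i\<in>I. cmod (a i) * cmod (b i))\<^sup>2"
    by (rule power_mono) simp
  also have "\<dots> \<le> (\<Sum>i\<in>I. (cmod (a i))\<^sup>2) * (\<Sum>i\<in>I. (cmod (b i))\<^sup>2)"
    by (rule Cauchy_Schwarz_ineq_sum)
  finally show ?thesis .
qed

text \<open>With P = \<Sum> |D_w q_i|^2 and S = \<Sum> q_i cnj(D_w q_i), the Levi form of sqrt Q in
  direction w is P / (2 sqrt Q) - |S|^2 / (4 Q sqrt Q). Cauchy-Schwarz gives |S|^2 \<le> Q P, so at
  least half of the first term remains, and P > 0 because some summand has nonzero derivative along
  w.\<close>

lemma levi_sqrt_sos_pos:
  assumes U: "open U" and qs: "sos_rep U qs Q" and z: "z \<in> U" "0 < Q z"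
    and nz: "\<exists>q\<in>set qs. Dv q z w \<noteq> 0"
  shows "0 < Re (levi (\<lambda>y. sqrt (Q y)) z w)"
proof -
  define I where "I = {..<length qs}"
  define q where "q = (\<lambda>i. qs ! i)"
  define p where "p = (\<lambda>i y. Dv (q i) y w)"
  define S where "S = (\<lambda>y. \<Sum>i\<in>I. q i y * cnj (p i y))"
  have holo: "holo_on U (q i)" if "i \<in> I" for i
    using that qs by (auto simp: sos_rep_def I_def q_def)
  have Q: "Q y = (\<Sum>i\<in>I. (cmod (q i y))\<^sup>2)" if "y \<in> U" for y
    using qs that by (simp add: sos_rep_def I_def q_def sum_list_sum_nth atLeast0LessThan)
  define Q' where "Q' = (\<lambda>y v. \<Sum>i\<in>I. 2 * Re (cnj (q i y) * Dv (q i) y v))"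
  have dQ: "(Q has_derivative Q' y) (at y)" if y: "y \<in> U" for y
  proof (rule has_derivative_transform_within_open[OF _ U y])
    have "((\<lambda>y. (cmod (q i y))\<^sup>2) has_derivative (\<lambda>v. 2 * Re (cnj (q i y) * Dv (q i) y v))) (at y)"
      if "i \<in> I" for i
    proof -
      note d = has_derivative_Re[OF holo_on_has_derivative[OF holo[OF that] y]]
        has_derivative_Im[OF holo_on_has_derivative[OF holo[OF that] y]]
      have "((\<lambda>y. Re (q i y) * Re (q i y) + Im (q i y) * Im (q i y)) has_derivative
          (\<lambda>v. 2 * Re (cnj (q i y) * Dv (q i) y v))) (at y)"
        by (rule has_derivative_eq_rhs[OF has_derivative_add[OF
              has_derivative_mult[OF d(1) d(1)] has_derivative_mult[OF d(2) d(2)]]]) auto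
      then show ?thesis unfolding cmod_power2 unfolding power2_eq_square .
    qed
    then show "((\<lambda>y. \<Sum>i\<in>I. (cmod (q i y))\<^sup>2) has_derivative Q' y) (at y)"
      unfolding Q'_def by (rule has_derivative_sum)
  qed (use Q in auto)
  \<comment> \<open>The derivatives of Q along w and along \<i> w are twice the real and the
    imaginary part of S; hence S is the antiholomorphic derivative of Q in direction w.\<close>
  have Q'w: "Q' y w = 2 * Re (S y)" and Q'iw: "Q' y (\<i> *\<^sub>C w) = 2 * Im (S y)" if y: "y \<in> U" for y
    using holo_on_scaleC[OF holo y]
    by (auto simp: Q'_def S_def p_def sum_distrib_left intro!: sum.cong)
  have dsqrt: "((\<lambda>y. sqrt (Q y)) has_derivative (\<lambda>v. inverse (sqrt (Q y)) / 2 * Q' y v)) (at y)"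
    if "y \<in> U" "0 < Q y" for y
    using has_derivative_compose[OF dQ[OF that(1)] DERIV_real_sqrt[OF that(2), unfolded has_field_derivative_def]] .
  define N where "N = {y \<in> U. 0 < Q y}"
  have contQ: "continuous_on U Q"
    using dQ by (meson continuous_at_imp_continuous_on has_derivative_continuous)
  have N: "open N" "z \<in> N"
    using continuous_open_preimage[OF contQ U open_greaterThan, of 0] z
    by (auto simp: N_def vimage_def Int_def conj_commute)
  have bar: "wirtinger_bar w (\<lambda>y. complex_of_real (sqrt (Q y))) y
      = of_real (inverse (2 * sqrt (Q y))) * S y" if y: "y \<in> N" for y
  proof -
    have yU: "y \<in> U" "0 < Q y" using y by (auto simp: N_def)
    have "wirtinger_bar w (\<lambda>y. complex_of_real (sqrt (Q y))) y
        = (of_real (inverse (sqrt (Q y)) / 2 * (2 * Re (S y)))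
          + \<i> * of_real (inverse (sqrt (Q y)) / 2 * (2 * Im (S y)))) / 2"
      unfolding wirtinger_bar_eq[OF has_derivative_of_real[OF dsqrt[OF yU]]] Q'w[OF yU(1)] Q'iw[OF yU(1)] ..
    then show ?thesis by (simp add: complex_eq_iff)
  qed
  define D where "D = (\<lambda>v. of_real (inverse (2 * sqrt (Q z))) *
        (\<Sum>i\<in>I. q i z * cnj (Dv (p i) z v) + Dv (q i) z v * cnj (p i z))
      + of_real (- (Q' z v) / (4 * Q z * sqrt (Q z))) * S z)"
  have "((\<lambda>y. of_real (inverse (2 * sqrt (Q y))) * S y) has_derivative D) (at z)"
  proof -
    have pholo: "holo_on U (p i)" if "i \<in> I" for i
      unfolding p_def using holo_on_Dv[OF holo[OF that] U] .
    have "(S has_derivative (\<lambda>v. \<Sum>i\<in>I. q i z * cnj (Dv (p i) z v) + Dv (q i) z v * cnj (p i z))) (at z)"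
      unfolding S_def
      by (intro has_derivative_sum has_derivative_mult has_derivative_cnj
          holo_on_has_derivative[OF holo z(1)] holo_on_has_derivative[OF pholo z(1)])
    moreover have "((\<lambda>y. inverse (2 * sqrt (Q y))) has_derivative
        (\<lambda>v. - (Q' z v) / (4 * Q z * sqrt (Q z)))) (at z)"
    proof -
      have "((\<lambda>y. 2 * sqrt (Q y)) has_derivative (\<lambda>v. 2 * (inverse (sqrt (Q z)) / 2 * Q' z v))) (at z)"
        by (rule has_derivative_mult_right[OF dsqrt[OF z]])
      then have "((\<lambda>y. inverse (2 * sqrt (Q y))) has_derivative
          (\<lambda>v. - (inverse (2 * sqrt (Q z)) * (2 * (inverse (sqrt (Q z)) / 2 * Q' z v)) * inverse (2 * sqrt (Q z))))) (at z)"
        by (rule Deriv.has_derivative_inverse[rotated]) (use z in simp)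
      then show ?thesis
      proof (rule has_derivative_eq_rhs)
        have alg: "- (inverse (2 * r) * (2 * (inverse r / 2 * x)) * inverse (2 * r)) = - x / (4 * (r * r) * r)"
          if "r \<noteq> 0" for r x :: real
          using that by (simp add: field_simps)
        show "(\<lambda>v. - (inverse (2 * sqrt (Q z)) * (2 * (inverse (sqrt (Q z)) / 2 * Q' z v)) * inverse (2 * sqrt (Q z))))
            = (\<lambda>v. - Q' z v / (4 * Q z * sqrt (Q z)))"
          using alg[of "sqrt (Q z)"] z(2) by (simp add: mult_ac)
      qed
    qed
    ultimately show ?thesis
      unfolding D_def by (intro has_derivative_mult has_derivative_of_real)
  qed
  then have "(wirtinger_bar w (\<lambda>y. complex_of_real (sqrt (Q y))) has_derivative D) (at z)"
    by (rule has_derivative_transform_within_open[OF _ N]) (simp add: bar)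
  from wirtinger_eq[OF this, of w]
  have levi: "levi (\<lambda>y. sqrt (Q y)) z w = (D w - \<i> * D (\<i> *\<^sub>C w)) / 2"
    unfolding levi_def .
  define P where "P = (\<Sum>i\<in>I. (cmod (p i z))\<^sup>2)"
  define a b where "a = inverse (2 * sqrt (Q z))" and "b = 1 / (4 * Q z * sqrt (Q z))"
  define X where "X = (\<Sum>i\<in>I. q i z * cnj (Dv (p i) z w))"
  have cP: "(\<Sum>i\<in>I. p i z * cnj (p i z)) = of_real P"
    unfolding P_def of_real_sum by (intro sum.cong refl) (simp add: complex_norm_square[symmetric])
  have D1: "D w = of_real a * (X + of_real P) + of_real (- 2 * b * Re (S z)) * S z"
  proof -
    have "Dv (q i) z w = p i z" for i by (simp add: p_def)
    then show ?thesis by (simp add: D_def Q'w[OF z(1)] sum.distrib cP X_def a_def b_def)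
  qed
  have D2: "D (\<i> *\<^sub>C w) = of_real a * (- \<i> * X + \<i> * of_real P) + of_real (- 2 * b * Im (S z)) * S z"
  proof -
    have "Dv (p i) z (\<i> *\<^sub>C w) = \<i> * Dv (p i) z w" if "i \<in> I" for i
      using holo_on_scaleC[OF holo_on_Dv[OF holo[OF that] U] z(1)] by (simp add: p_def)
    moreover have "Dv (q i) z (\<i> *\<^sub>C w) = \<i> * p i z" if "i \<in> I" for i
      using holo_on_scaleC[OF holo[OF that] z(1)] by (simp add: p_def)
    ultimately have "(\<Sum>i\<in>I. q i z * cnj (Dv (p i) z (\<i> *\<^sub>C w)) + Dv (q i) z (\<i> *\<^sub>C w) * cnj (p i z))
        = (\<Sum>i\<in>I. - \<i> * (q i z * cnj (Dv (p i) z w)) + \<i> * (p i z * cnj (p i z)))"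
      by (intro sum.cong refl) simp
    also have "\<dots> = - \<i> * X + \<i> * of_real P"
      unfolding sum.distrib sum_distrib_left[symmetric] cP X_def ..
    finally show ?thesis by (simp add: D_def Q'iw[OF z(1)] a_def b_def)
  qed
  \<comment> \<open>The terms with second derivatives of the q_i, collected in X, cancel in this
    combination; the two parts of S combine to |S|^2.\<close>
  have "D w - \<i> * D (\<i> *\<^sub>C w) = 2 * (of_real (a * P) - of_real b * (cnj (S z) * S z))"
    unfolding D1 D2 by (simp add: complex_eq_iff algebra_simps)
  then have "levi (\<lambda>y. sqrt (Q y)) z w = of_real (a * P) - of_real b * (cnj (S z) * S z)"
    unfolding levi by simp
  also have "cnj (S z) * S z = of_real ((cmod (S z))\<^sup>2)"
    by (metis complex_norm_square mult.commute)
  finally have "Re (levi (\<lambda>y. sqrt (Q y)) z w) = a * P - b * (cmod (S z))\<^sup>2"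
    by simp
  moreover have "(cmod (S z))\<^sup>2 \<le> Q z * P"
    unfolding S_def P_def Q[OF z(1)] by (rule complex_Cauchy_Schwarz)
  then have "b * (cmod (S z))\<^sup>2 \<le> b * (Q z * P)"
    using z(2) by (intro mult_left_mono) (auto simp: b_def)
  moreover have "0 < P"
  proof -
    obtain i where "i \<in> I" "p i z \<noteq> 0"
      using nz by (auto simp: I_def p_def q_def in_set_conv_nth)
    then show ?thesis unfolding P_def by (intro sum_pos2[of I i]) (auto simp: I_def)
  qed
  moreover have "b * (Q z * P) = a / 2 * P"
  proof -
    have "b * Q z = a / 2" using z(2) by (simp add: a_def b_def inverse_eq_divide)
    then show ?thesis by (simp add: mult.assoc[symmetric])
  qed
  moreover have "0 < a" using z(2) by (simp add: a_def)
  ultimately show ?thesis using mult_pos_pos[of a P] by linarith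
qed

section \<open>Hyperplanes and cosets in the fibres\<close>

definition bil :: "complex^'r::finite \<Rightarrow> complex^'r \<Rightarrow> complex" where
  "bil \<eta> w = (\<Sum>i\<in>UNIV. \<eta> $ i * w $ i)"

lemma bil_add_right: "bil \<eta> (v + w) = bil \<eta> v + bil \<eta> w"
  by (simp add: bil_def distrib_left sum.distrib)

lemma bil_scale_right: "bil \<eta> (c *\<^sub>C w) = c * bil \<eta> w"
  by (simp add: bil_def sum_distrib_left mult_ac)

lemma bil_scale_left: "bil (c *\<^sub>C \<eta>) w = c * bil \<eta> w"
  by (simp add: bil_def sum_distrib_left mult_ac)

lemma bil_axis: "bil \<eta> (axis i c) = \<eta> $ i * c"
  by (simp add: bil_def axis_def if_distrib cong: if_cong)

lemma bil_surj:
  assumes "\<eta> \<noteq> 0" obtains w where "bil \<eta> w = t"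
proof -
  obtain i where "\<eta> $ i \<noteq> 0" using assms by (auto simp: vec_eq_iff)
  then have "bil \<eta> (axis i (t / \<eta> $ i)) = t" by (simp add: bil_axis)
  then show ?thesis using that by blast
qed

text \<open>If \<eta>_i \<noteq> 0, the kernel of \<eta> contains e_j - (\<eta>_j / \<eta>_i) e_i
  for every j; evaluating \<eta>' there gives \<eta>'_j = (\<eta>'_i / \<eta>_i) \<eta>_j.\<close>

lemma bil_proportional:
  assumes "\<eta> \<noteq> 0" "\<And>w. bil \<eta> w = 0 \<Longrightarrow> bil \<eta>' w = 0"
  obtains c where "\<eta>' = c *\<^sub>C \<eta>"
proof -
  obtain i where i: "\<eta> $ i \<noteq> 0" using assms(1) by (auto simp: vec_eq_iff)
  have eq: "\<eta>' $ j = (\<eta>' $ i / \<eta> $ i) * \<eta> $ j" for j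
  proof -
    define c where "c = - \<eta> $ j / \<eta> $ i"
    have bil: "bil \<theta> (axis j 1 + c *\<^sub>C axis i 1) = \<theta> $ j + c * \<theta> $ i" for \<theta>
      by (simp add: bil_add_right bil_scale_right bil_axis)
    have "c * \<eta> $ i = - \<eta> $ j" using i by (simp add: c_def)
    then have "\<eta>' $ j + c * \<eta>' $ i = 0"
      using assms(2)[of "axis j 1 + c *\<^sub>C axis i 1"] unfolding bil by simp
    then have "\<eta>' $ j = - (c * \<eta>' $ i)" by (simp only: eq_neg_iff_add_eq_0)
    also have "\<dots> = \<eta>' $ i / \<eta> $ i * \<eta> $ j" by (simp add: c_def)
    finally show ?thesis .
  qed
  show ?thesis
    by (rule that[of "\<eta>' $ i / \<eta> $ i"], unfold vec_eq_iff scaleC_vec_nth scaleC_complex) (intro allI eq)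
qed

text \<open>The coefficient vector of \<open>affine_form\<close>. It turns the affine charts of the
  space of hyperplanes into the usual normalization of homogeneous coordinates, with the entry at
  \<tau> None equal to 1.\<close>

definition aff :: "('q option \<Rightarrow> 'q option) \<Rightarrow> complex^'q \<Rightarrow> complex^('q::finite option)" where
  "aff \<tau> \<zeta> = (\<chi> j. case inv \<tau> j of None \<Rightarrow> 1 | Some i \<Rightarrow> \<zeta> $ i)"

lemma aff_nth:
  assumes "bij \<tau>" shows "aff \<tau> \<zeta> $ \<tau> j = (case j of None \<Rightarrow> 1 | Some i \<Rightarrow> \<zeta> $ i)"
  unfolding aff_def vec_lambda_beta inv_f_f[OF bij_is_inj[OF assms]] ..

lemma aff_None [simp]: "bij \<tau> \<Longrightarrow> aff \<tau> \<zeta> $ \<tau> None = 1"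
  by (simp only: aff_nth option.case)

lemma aff_Some [simp]: "bij \<tau> \<Longrightarrow> aff \<tau> \<zeta> $ \<tau> (Some i) = \<zeta> $ i"
  by (simp only: aff_nth option.case)

lemma aff_nonzero [simp]:
  assumes "bij \<tau>" shows "aff \<tau> \<zeta> \<noteq> 0"
proof
  assume "aff \<tau> \<zeta> = 0"
  then have "aff \<tau> \<zeta> $ \<tau> None = 0" by (simp only: zero_index)
  then show False using aff_None[OF assms] by simp
qed

lemma affine_form_eq:
  assumes "bij \<tau>" shows "affine_form \<tau> \<zeta> w = bil (aff \<tau> \<zeta>) w"
proof -
  have "bil (aff \<tau> \<zeta>) w = (\<Sum>j\<in>UNIV. aff \<tau> \<zeta> $ \<tau> j * w $ \<tau> j)"
    unfolding bil_def
    by (rule sum.reindex_bij_betw[of \<tau> UNIV UNIV "\<lambda>j. aff \<tau> \<zeta> $ j * w $ j", symmetric]) (rule assms)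
  also have "\<dots> = affine_form \<tau> \<zeta> w"
    unfolding UNIV_option_conv using assms by (simp add: affine_form_def sum.reindex)
  finally show ?thesis by simp
qed

lemma aff_normalize:
  assumes "bij \<tau>" "\<eta> $ \<tau> None \<noteq> 0"
  shows "aff \<tau> (\<chi> i. \<eta> $ \<tau> (Some i) / \<eta> $ \<tau> None) = inverse (\<eta> $ \<tau> None) *\<^sub>C \<eta>"
proof (unfold vec_eq_iff, rule allI)
  fix j
  obtain j' where j: "j = \<tau> j'" using assms(1) by (auto elim: bij_pointE)
  show "aff \<tau> (\<chi> i. \<eta> $ \<tau> (Some i) / \<eta> $ \<tau> None) $ j = (inverse (\<eta> $ \<tau> None) *\<^sub>C \<eta>) $ j"
    unfolding j using assms by (cases j') (simp_all add: divide_inverse)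
qed

lemma aff_eq_scale:
  assumes "bij \<tau>" "aff \<tau> \<zeta> = c *\<^sub>C aff \<tau> \<zeta>'" shows "\<zeta> = \<zeta>'"
proof -
  have "c = 1" using arg_cong[OF assms(2), of "\<lambda>v. v $ \<tau> None"] assms(1) by simp
  then show ?thesis
    using arg_cong[OF assms(2), of "\<lambda>v. v $ \<tau> (Some i)" for i] assms(1) by (simp add: vec_eq_iff)
qed

text \<open>A single map \<open>co\<close> identifies all fibres with the standard space. It is
  linear on each fibre but carries no continuity along the base. Through it hyperplanes and cosets
  in every fibre are described by coefficient vectors \<eta>.\<close>

locale fibre_coordinates =
  fixes E :: "('s, 'm::complex_normed, 'e, 'q::finite option) vbundle"
    and co :: "'e \<Rightarrow> complex^('q option)"
  assumes co: "s \<in> pts (bbase E) \<Longrightarrow> linear_iso (fibre E s) Cspace co"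
    and closed_add: "s \<in> pts (bbase E) \<Longrightarrow> v \<in> car (fibre E s) \<Longrightarrow> w \<in> car (fibre E s) \<Longrightarrow>
      vadd E v w \<in> car (fibre E s)"
    and closed_scale: "s \<in> pts (bbase E) \<Longrightarrow> v \<in> car (fibre E s) \<Longrightarrow> vscale E c v \<in> car (fibre E s)"
begin

definition iv :: "'s \<Rightarrow> complex^('q option) \<Rightarrow> 'e" where
  "iv s w = inv_into (car (fibre E s)) co w"

lemma fibre_simps [simp]: "add (fibre E s) = vadd E" "smult (fibre E s) = vscale E"
  by (simp_all add: fibre_def)

context
  fixes s assumes s: "s \<in> pts (bbase E)"
begin

lemma co_bij: "bij_betw co (car (fibre E s)) UNIV"
  using co[OF s] by (simp add: linear_iso_def Cspace_def)

lemma co_add: "v \<in> car (fibre E s) \<Longrightarrow> w \<in> car (fibre E s) \<Longrightarrow> co (vadd E v w) = co v + co w"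
  using co[OF s] by (simp add: linear_iso_def Cspace_def)

lemma co_scale: "v \<in> car (fibre E s) \<Longrightarrow> co (vscale E c v) = c *\<^sub>C co v"
  using co[OF s] by (simp add: linear_iso_def Cspace_def)

lemma iv_car: "iv s w \<in> car (fibre E s)" and co_iv: "co (iv s w) = w"
  using co_bij by (auto simp: iv_def bij_betw_def inv_into_into f_inv_into_f)

lemma co_inj: "v \<in> car (fibre E s) \<Longrightarrow> w \<in> car (fibre E s) \<Longrightarrow> co v = co w \<Longrightarrow> v = w"
  using co_bij by (auto simp: bij_betw_def inj_on_def)

end

text \<open>For \<eta> \<noteq> 0 the level 0 is a hyperplane and the levels t are its cosets, so t
  is a linear coordinate on the fibre of O(1) over ker \<eta>.\<close>

definition lev :: "'s \<Rightarrow> complex^('q option) \<Rightarrow> complex \<Rightarrow> 'e set" where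
  "lev s \<eta> t = {v \<in> car (fibre E s). bil \<eta> (co v) = t}"

lemma lev_nonempty:
  assumes "s \<in> pts (bbase E)" "\<eta> \<noteq> 0" obtains v where "v \<in> lev s \<eta> t"
proof -
  obtain w where "bil \<eta> w = t" using bil_surj[OF assms(2)] by blast
  then have "iv s w \<in> lev s \<eta> t" by (simp add: lev_def iv_car co_iv assms(1))
  then show ?thesis using that by blast
qed

lemma coset_lev:
  assumes s: "s \<in> pts (bbase E)" and v: "v \<in> car (fibre E s)"
  shows "coset (fibre E s) (lev s \<eta> 0) v = lev s \<eta> (bil \<eta> (co v))"
proof (intro equalityI subsetI)
  fix u assume "u \<in> coset (fibre E s) (lev s \<eta> 0) v"
  then show "u \<in> lev s \<eta> (bil \<eta> (co v))"
    using closed_add[OF s v] by (auto simp: coset_def lev_def co_add[OF s v] bil_add_right)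
next
  fix u assume u: "u \<in> lev s \<eta> (bil \<eta> (co v))"
  define p where "p = iv s (co u - co v)"
  have p: "p \<in> car (fibre E s)" "co p = co u - co v" by (simp_all add: p_def iv_car co_iv s)
  have "bil \<eta> (co u) = bil \<eta> (co p) + bil \<eta> (co v)"
    using p(2) by (simp add: bil_add_right[symmetric])
  then have "p \<in> lev s \<eta> 0" using u p by (simp add: lev_def)
  moreover have "u = vadd E v p"
    by (rule co_inj[OF s]) (use u p v closed_add[OF s] in \<open>auto simp: lev_def co_add[OF s]\<close>)
  ultimately show "u \<in> coset (fibre E s) (lev s \<eta> 0) v" by (auto simp: coset_def)
qed

lemma hyperplane_lev:
  assumes s: "s \<in> pts (bbase E)" and \<eta>: "\<eta> \<noteq> 0"
  shows "hyperplane (fibre E s) (lev s \<eta> 0)"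
  unfolding hyperplane_def fibre_simps
proof (intro conjI)
  show "lev s \<eta> 0 \<subseteq> car (fibre E s)" by (auto simp: lev_def)
  show "lev s \<eta> 0 \<noteq> {}" using lev_nonempty[OF s \<eta>] by blast
  show "\<forall>v\<in>lev s \<eta> 0. \<forall>w\<in>lev s \<eta> 0. vadd E v w \<in> lev s \<eta> 0"
    by (auto simp: lev_def closed_add[OF s] co_add[OF s] bil_add_right)
  show "\<forall>c. \<forall>v\<in>lev s \<eta> 0. vscale E c v \<in> lev s \<eta> 0"
    by (auto simp: lev_def closed_scale[OF s] co_scale[OF s] bil_scale_right)
  obtain v where v: "v \<in> lev s \<eta> 1" using lev_nonempty[OF s \<eta>] by blast
  show "\<exists>v\<in>car (fibre E s) - lev s \<eta> 0. \<forall>w\<in>car (fibre E s). \<exists>p\<in>lev s \<eta> 0. \<exists>c. w = vadd E p (vscale E c v)"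
  proof (rule bexI[of _ v], rule ballI)
    fix w assume w: "w \<in> car (fibre E s)"
    define c where "c = bil \<eta> (co w)"
    define p where "p = iv s (co w + (- c) *\<^sub>C co v)"
    have vc: "v \<in> car (fibre E s)" using v by (simp add: lev_def)
    have p: "p \<in> car (fibre E s)" "co p = co w + (- c) *\<^sub>C co v" by (simp_all add: p_def iv_car co_iv s)
    have "p \<in> lev s \<eta> 0"
      using v p by (simp add: lev_def bil_add_right bil_scale_right c_def)
    moreover have "w = vadd E p (vscale E c v)"
    proof (rule co_inj[OF s w closed_add[OF s p(1) closed_scale[OF s vc]]])
      have "(- c) *\<^sub>C co v + c *\<^sub>C co v = 0"
        by (simp add: scaleC_add_left[symmetric])
      then show "co w = co (vadd E p (vscale E c v))"
        by (simp add: co_add[OF s p(1) closed_scale[OF s vc]] co_scale[OF s vc] p(2) add.assoc)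
    qed
    ultimately show "\<exists>p\<in>lev s \<eta> 0. \<exists>c. w = vadd E p (vscale E c v)" by blast
  qed (use v in \<open>auto simp: lev_def\<close>)
qed

text \<open>The definition of a hyperplane provides a vector v spanning a complement of P. The
  functional sought is the coefficient of v in the decomposition along P and v, and \<eta> lists its
  values at the basis vectors.\<close>

lemma hyperplane_eq_lev:
  assumes s: "s \<in> pts (bbase E)" and P: "hyperplane (fibre E s) P"
  obtains \<eta> where "\<eta> \<noteq> 0" "P = lev s \<eta> 0"
proof -
  note P' = P[unfolded hyperplane_def fibre_simps]
  have sub: "P \<subseteq> car (fibre E s)" and ne: "P \<noteq> {}" using P' by simp_all
  have Padd: "vadd E u w \<in> P" if "u \<in> P" "w \<in> P" for u w
    using conjunct1[OF conjunct2[OF conjunct2[OF P']]] that by simp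
  have Pscale: "vscale E c u \<in> P" if "u \<in> P" for c u
    using conjunct1[OF conjunct2[OF conjunct2[OF conjunct2[OF P']]]] that by simp
  obtain v where v: "v \<in> car (fibre E s)" "v \<notin> P"
    and span: "\<forall>w\<in>car (fibre E s). \<exists>p\<in>P. \<exists>c. w = vadd E p (vscale E c v)"
    using conjunct2[OF conjunct2[OF conjunct2[OF conjunct2[OF P']]]] by (elim bexE DiffE)
  define W where "W = co ` P"
  have W_add: "x + y \<in> W" if xy: "x \<in> W" "y \<in> W" for x y
  proof -
    obtain u w where "u \<in> P" "w \<in> P" "x = co u" "y = co w" using xy by (auto simp: W_def)
    then have "x + y = co (vadd E u w)" "vadd E u w \<in> P"
      using Padd co_add[OF s subsetD[OF sub] subsetD[OF sub]] by simp_all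
    then show ?thesis by (simp add: W_def)
  qed
  have W_scale: "c *\<^sub>C x \<in> W" if x: "x \<in> W" for c x
  proof -
    obtain u where "u \<in> P" "x = co u" using x by (auto simp: W_def)
    then have "c *\<^sub>C x = co (vscale E c u)" "vscale E c u \<in> P"
      using Pscale co_scale[OF s subsetD[OF sub]] by simp_all
    then show ?thesis by (simp add: W_def)
  qed
  have vW: "co v \<notin> W"
  proof
    assume "co v \<in> W"
    then obtain u where u: "u \<in> P" "co v = co u" by (auto simp: W_def)
    then have "v = u" by (intro co_inj[OF s v(1) subsetD[OF sub]])
    then show False using u v by simp
  qed
  have W_span: "\<exists>c. y + (- c) *\<^sub>C co v \<in> W" for y
  proof -
    obtain p c where p: "p \<in> P" "iv s y = vadd E p (vscale E c v)"
      using bspec[OF span iv_car[OF s, of y]] by (elim bexE exE)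
    have "y = co p + c *\<^sub>C co v"
      using arg_cong[OF p(2), of co]
      by (simp add: co_iv[OF s] co_add[OF s subsetD[OF sub p(1)] closed_scale[OF s v(1)]] co_scale[OF s v(1)])
    then have "y + (- c) *\<^sub>C co v = co p"
      by (simp add: add.assoc scaleC_add_left[symmetric])
    then show ?thesis using p(1) by (auto simp: W_def)
  qed
  have uniq: "c = d" if "y + (- c) *\<^sub>C co v \<in> W" "y + (- d) *\<^sub>C co v \<in> W" for y c d
  proof (rule ccontr)
    assume "c \<noteq> d"
    have "(y + (- c) *\<^sub>C co v) + (- 1) *\<^sub>C (y + (- d) *\<^sub>C co v) \<in> W"
      by (intro W_add W_scale that)
    also have "(y + (- c) *\<^sub>C co v) + (- 1) *\<^sub>C (y + (- d) *\<^sub>C co v) = (d - c) *\<^sub>C co v"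
      by (simp add: vec_eq_iff algebra_simps)
    finally have "inverse (d - c) *\<^sub>C (d - c) *\<^sub>C co v \<in> W" by (rule W_scale)
    then show False using vW \<open>c \<noteq> d\<close> by (simp add: scaleC_scaleC)
  qed
  define f where "f = (\<lambda>y. THE c. y + (- c) *\<^sub>C co v \<in> W)"
  have f: "f y = c \<longleftrightarrow> y + (- c) *\<^sub>C co v \<in> W" for y c
  proof
    obtain d where d: "y + (- d) *\<^sub>C co v \<in> W" using W_span by blast
    have "f y = d" unfolding f_def by (rule the_equality, rule d) (rule uniq[OF _ d])
    then show "y + (- c) *\<^sub>C co v \<in> W" if "f y = c" using d that by simp
    show "f y = c" if "y + (- c) *\<^sub>C co v \<in> W" using uniq[OF that d] \<open>f y = d\<close> by simp
  qed
  have fW: "y + (- f y) *\<^sub>C co v \<in> W" for y using f[of y "f y"] by simp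
  have f_add: "f (x + y) = f x + f y" for x y
  proof (subst f)
    have "(x + (- f x) *\<^sub>C co v) + (y + (- f y) *\<^sub>C co v) = x + y + (- (f x + f y)) *\<^sub>C co v"
      by (simp add: vec_eq_iff algebra_simps)
    then show "x + y + (- (f x + f y)) *\<^sub>C co v \<in> W"
      using W_add[OF fW[of x] fW[of y]] by (simp only:)
  qed
  have f_scale: "f (c *\<^sub>C x) = c * f x" for c x
  proof (subst f)
    have "c *\<^sub>C (x + (- f x) *\<^sub>C co v) = c *\<^sub>C x + (- (c * f x)) *\<^sub>C co v"
      by (simp add: vec_eq_iff algebra_simps)
    then show "c *\<^sub>C x + (- (c * f x)) *\<^sub>C co v \<in> W"
      using W_scale[OF fW[of x], of c] by (simp only:)
  qed
  define \<eta> where "\<eta> = (\<chi> i. f (axis i 1))"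
  have f0: "f 0 = 0" using f_scale[of 0 0] by simp
  have f_bil: "f y = bil \<eta> y" for y
  proof -
    have h1: "f (\<Sum>i\<in>I. y $ i *\<^sub>C axis i 1) = (\<Sum>i\<in>I. \<eta> $ i * y $ i)" if "finite I" for I
      using that by (induction I rule: finite_induct) (simp_all add: f0 f_add f_scale \<eta>_def)
    have h2: "(\<Sum>i\<in>UNIV. y $ i *\<^sub>C axis i 1) = y"
      by (simp add: vec_eq_iff axis_def if_distrib cong: if_cong)
    show ?thesis using h1[of UNIV] unfolding h2 by (simp add: bil_def)
  qed
  have Wf: "y \<in> W \<longleftrightarrow> bil \<eta> y = 0" for y
    using f[of y 0] f_bil[of y] by simp
  have PW: "u \<in> P \<longleftrightarrow> co u \<in> W" if "u \<in> car (fibre E s)" for u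
  proof
    assume "co u \<in> W"
    then obtain w where w: "w \<in> P" "co u = co w" by (auto simp: W_def)
    then have "u = w" by (intro co_inj[OF s that subsetD[OF sub]])
    then show "u \<in> P" using w by simp
  qed (simp add: W_def)
  have "P = lev s \<eta> 0"
  proof (intro equalityI subsetI)
    show "u \<in> lev s \<eta> 0" if u: "u \<in> P" for u
      using PW[OF subsetD[OF sub u]] u subsetD[OF sub u] by (simp add: lev_def Wf)
    show "u \<in> P" if u: "u \<in> lev s \<eta> 0" for u
      using u by (simp add: lev_def PW Wf)
  qed
  moreover have "\<eta> \<noteq> 0"
  proof
    assume "\<eta> = 0"
    then have "bil \<eta> (co v) = 0" by (simp add: bil_def)
    then show False using vW unfolding Wf by simp
  qed
  ultimately show ?thesis using that by simp
qed

lemma lev_eq_iff: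
  assumes "s \<in> pts (bbase E)" "s' \<in> pts (bbase E)" "\<eta> \<noteq> 0" "\<eta>' \<noteq> 0" "lev s \<eta> 0 = lev s' \<eta>' 0"
  obtains c where "s = s'" "\<eta>' = c *\<^sub>C \<eta>" "c \<noteq> 0"
proof -
  obtain v where "v \<in> lev s \<eta> 0" using lev_nonempty assms by blast
  then have ss: "s = s'" using assms(5) by (auto simp: lev_def fibre_def)
  have "bil \<eta>' w = 0" if "bil \<eta> w = 0" for w
  proof -
    have "iv s w \<in> lev s \<eta> 0" using that by (simp add: lev_def iv_car co_iv assms)
    then have "iv s w \<in> lev s' \<eta>' 0" using assms(5) by simp
    then show ?thesis by (simp add: lev_def co_iv assms(1))
  qed
  then obtain c where "\<eta>' = c *\<^sub>C \<eta>" using bil_proportional[OF assms(3)] by blast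
  then show ?thesis using that[OF ss] assms(4) by (cases "c = 0") auto
qed

lemma foot_lev:
  assumes "s \<in> pts (bbase E)" "\<eta> \<noteq> 0" shows "foot E (lev s \<eta> 0) = s"
proof -
  obtain v where "v \<in> lev s \<eta> 0" using lev_nonempty assms by blast
  then have "(SOME v. v \<in> lev s \<eta> 0) \<in> lev s \<eta> 0" by (rule someI)
  then show ?thesis by (simp add: foot_def lev_def fibre_def)
qed

lemma lev_scale: "c \<noteq> 0 \<Longrightarrow> lev s (c *\<^sub>C \<eta>) t = lev s \<eta> (t / c)"
  by (simp add: lev_def bil_scale_left eq_divide_eq mult.commute)

lemma PP_pts: "pts (PP E) = {lev s \<eta> 0 | s \<eta>. s \<in> pts (bbase E) \<and> \<eta> \<noteq> 0}"
proof (intro equalityI subsetI)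
  fix P assume "P \<in> pts (PP E)"
  then obtain s where s: "s \<in> pts (bbase E)" "hyperplane (fibre E s) P" by (auto simp: PP_def)
  obtain \<eta> where "\<eta> \<noteq> 0" "P = lev s \<eta> 0" using hyperplane_eq_lev[OF s] .
  then show "P \<in> {lev s \<eta> 0 | s \<eta>. s \<in> pts (bbase E) \<and> \<eta> \<noteq> 0}" using s(1) by auto
next
  fix P assume "P \<in> {lev s \<eta> 0 | s \<eta>. s \<in> pts (bbase E) \<and> \<eta> \<noteq> 0}"
  then show "P \<in> pts (PP E)" using hyperplane_lev by (auto simp: PP_def)
qed

lemma O1_tot: "tot (O1 E) = {(lev s \<eta> 0, lev s \<eta> t) | s \<eta> t. s \<in> pts (bbase E) \<and> \<eta> \<noteq> 0}"
proof (intro equalityI subsetI)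
  fix p assume "p \<in> tot (O1 E)"
  then obtain s P v where p: "p = (P, coset (fibre E s) P v)" "s \<in> pts (bbase E)"
    "hyperplane (fibre E s) P" "v \<in> car (fibre E s)" by (auto simp: O1_def)
  obtain \<eta> where "\<eta> \<noteq> 0" "P = lev s \<eta> 0" using hyperplane_eq_lev[OF p(2,3)] .
  then show "p \<in> {(lev s \<eta> 0, lev s \<eta> t) | s \<eta> t. s \<in> pts (bbase E) \<and> \<eta> \<noteq> 0}"
    using p coset_lev[OF p(2,4)] by blast
next
  fix p assume "p \<in> {(lev s \<eta> 0, lev s \<eta> t) | s \<eta> t. s \<in> pts (bbase E) \<and> \<eta> \<noteq> 0}"
  then obtain s \<eta> t where p: "p = (lev s \<eta> 0, lev s \<eta> t)" "s \<in> pts (bbase E)" "\<eta> \<noteq> 0" by blast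
  obtain v where v: "v \<in> lev s \<eta> t" using lev_nonempty[OF p(2,3)] .
  then have "p = (lev s \<eta> 0, coset (fibre E s) (lev s \<eta> 0) v)" "v \<in> car (fibre E s)"
    using coset_lev[OF p(2), of v \<eta>] p(1) by (auto simp: lev_def)
  then show "p \<in> tot (O1 E)"
    using hyperplane_lev[OF p(2,3)] p(2) unfolding O1_def by auto
qed

end

section \<open>Curvature of a Finsler type metric on the line bundle\<close>

lemma sos_rep_compose:
  assumes "sos_rep U qs Q" "holo_on W f" "f ` W \<subseteq> U"
  shows "sos_rep W (map (\<lambda>q z. q (f z)) qs) (\<lambda>z. Q (f z))"
  unfolding sos_rep_def
proof (intro conjI ballI)
  show "holo_on W q" if q: "q \<in> set (map (\<lambda>q z. q (f z)) qs)" for q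
  proof -
    obtain p where p: "p \<in> set qs" "q = (\<lambda>z. p (f z))" using q by auto
    then have "holo_on U p" using assms(1) by (simp add: sos_rep_def)
    then show ?thesis unfolding p(2) by (rule holo_on_compose[OF assms(2) _ assms(3)])
  qed
  show "Q (f z) = (\<Sum>q\<leftarrow>map (\<lambda>q z. q (f z)) qs. (cmod (q z))\<^sup>2)" if "z \<in> W" for z
  proof -
    have "f z \<in> U" using that assms(3) by blast
    then show ?thesis using assms(1) by (simp add: sos_rep_def o_def)
  qed
qed

text \<open>The chain rule for the identity g(f(y)) = y. It serves to show that the map from the
  dual of O(1) to the dual bundle of E is an immersion away from the zero section.\<close>

lemma derivative_left_inverse:
  fixes f :: "'a::real_normed_vector \<Rightarrow> 'b::real_normed_vector"
  assumes N: "open N" "w \<in> N" and inv: "\<And>y. y \<in> N \<Longrightarrow> g (f y) = y"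
    and f: "(f has_derivative D) (at w)" and g: "(g has_derivative D') (at (f w))" and v: "D v = 0"
  shows "v = 0"
proof -
  have "((\<lambda>y. g (f y)) has_derivative (\<lambda>v. D' (D v))) (at w)"
    by (rule has_derivative_compose[OF f g])
  then have "((\<lambda>y. y) has_derivative (\<lambda>v. D' (D v))) (at w)"
    by (rule has_derivative_transform_within_open[OF _ N]) (rule inv)
  then have "(\<lambda>v. D' (D v)) = (\<lambda>v. v)"
    by (rule has_derivative_unique) (rule has_derivative_ident)
  then have "D' (D v) = v" by (rule fun_cong)
  then show ?thesis
    unfolding v using has_derivative_bounded_linear[OF g] by (simp add: bounded_linear.linear linear_0)
qed

text \<open>Charts enter the curvature conditions through \<open>inv_into\<close>. An explicit
  \<Theta> that is a right inverse of c and covers the domain A yields both the image and the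
  inverse of the chart.\<close>

lemma parametrized_chart:
  assumes "\<And>w. w \<in> W \<Longrightarrow> \<Theta> w \<in> A \<and> c (\<Theta> w) = w" "A \<subseteq> \<Theta> ` W"
  shows "c ` A = W" and "w \<in> W \<Longrightarrow> inv_into A c w = \<Theta> w"
proof -
  have eq: "p = \<Theta> (c p)" "c p \<in> W" if "p \<in> A" for p
    using assms that by (force simp: image_iff)+
  show "c ` A = W"
  proof (intro equalityI subsetI)
    show "w \<in> W" if "w \<in> c ` A" for w using that eq by auto
    show "w \<in> c ` A" if "w \<in> W" for w using assms(1)[OF that] by (auto intro: rev_image_eqI)
  qed
  show "inv_into A c w = \<Theta> w" if "w \<in> W"
  proof (rule inv_into_f_eq)
    show "inj_on c A" by (rule inj_on_inverseI[of A \<Theta>]) (rule eq(1)[symmetric])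
  qed (use assms(1)[OF that] in auto)
qed

text \<open>The data of a Finsler metric K on the dual bundle, read through \<open>co\<close>. On
  each fibre a trivialization differs from \<open>co\<close> by a scalar g. Neither g nor K need be
  regular along the base; \<open>K_sos\<close> asks for regularity of K at g \<eta>, where the
  irregularities of both cancel. The aim is that the metric on O(1) determined by K is positively
  curved.\<close>

locale finsler_bundle = fibre_coordinates E co
  for E :: "('s, 'm::complex_normed, 'e, 'q::finite option) vbundle"
    and co :: "'e \<Rightarrow> complex^('q option)" +
  fixes g :: "('e \<Rightarrow> complex^('q option)) \<Rightarrow> 's \<Rightarrow> complex"
    and K :: "'s \<Rightarrow> complex^('q option) \<Rightarrow> real"
  assumes triv_pts: "(U, \<phi>) \<in> trivs E \<Longrightarrow> s \<in> U \<Longrightarrow> s \<in> pts (bbase E)"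
    and triv_eq: "(U, \<phi>) \<in> trivs E \<Longrightarrow> s \<in> U \<Longrightarrow> v \<in> car (fibre E s) \<Longrightarrow> \<phi> v = g \<phi> s *\<^sub>C co v"
    and g_nz: "(U, \<phi>) \<in> trivs E \<Longrightarrow> s \<in> U \<Longrightarrow> g \<phi> s \<noteq> 0"
    and atlas_inj: "(B, x) \<in> atlas (bbase E) \<Longrightarrow> inj_on x B"
    and chart_open: "(B, x) \<in> atlas (bbase E) \<Longrightarrow> (U, \<phi>) \<in> trivs E \<Longrightarrow> (U', \<phi>') \<in> trivs E \<Longrightarrow>
      open (x ` (B \<inter> U \<inter> U'))"
    and K_scale: "K s (c *\<^sub>C \<eta>) = (cmod c)\<^sup>2 * K s \<eta>"
    and K_pos: "s \<in> pts (bbase E) \<Longrightarrow> \<eta> \<noteq> 0 \<Longrightarrow> 0 < K s \<eta>"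
    and K_sos: "(B, x) \<in> atlas (bbase E) \<Longrightarrow> (U, \<phi>) \<in> trivs E \<Longrightarrow>
      immersive_sos (x ` (B \<inter> U) \<times> UNIV) (x ` (B \<inter> U) \<times> (- {0}))
        (\<lambda>(z, \<eta>). (K (inv_into B x z) (g \<phi> (inv_into B x z) *\<^sub>C \<eta>))\<^sup>2)"
begin

text \<open>The class of v modulo ker \<eta> has squared length |\<eta>(v)|^2 / K(\<eta>). By
  \<open>K_scale\<close> rescaling \<eta> does not change this, and \<eta>(v) depends only on the
  coset, so both choices are harmless. Restriction to the total space makes the metric extensional,
  as \<open>KK\<close> requires.\<close>

definition kk :: "'e set \<times> 'e set \<Rightarrow> real" where
  "kk = restrict (\<lambda>(P, a).
     let \<eta> = (SOME \<eta>. \<eta> \<noteq> 0 \<and> P = lev (foot E P) \<eta> 0)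
     in (cmod (bil \<eta> (co (SOME v. v \<in> a))))\<^sup>2 / K (foot E P) \<eta>) (tot (O1 E))"

definition pt :: "'s \<Rightarrow> complex^('q option) \<Rightarrow> complex \<Rightarrow> 'e set \<times> 'e set" where
  "pt s \<eta> t = (lev s \<eta> 0, lev s \<eta> t)"

lemma pt_tot: "s \<in> pts (bbase E) \<Longrightarrow> \<eta> \<noteq> 0 \<Longrightarrow> pt s \<eta> t \<in> tot (O1 E)"
  by (auto simp: O1_tot pt_def)

lemma K_nonneg: "s \<in> pts (bbase E) \<Longrightarrow> 0 \<le> K s \<eta>"
  using K_pos[of s \<eta>] K_scale[of s 0 \<eta>] by (cases "\<eta> = 0") auto

lemma some_lev:
  assumes "s \<in> pts (bbase E)" "\<eta> \<noteq> 0"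
  shows "(SOME v. v \<in> lev s \<eta> t) \<in> car (fibre E s)" "bil \<eta> (co (SOME v. v \<in> lev s \<eta> t)) = t"
proof -
  obtain v where "v \<in> lev s \<eta> t" using lev_nonempty[OF assms] .
  then have "(SOME v. v \<in> lev s \<eta> t) \<in> lev s \<eta> t" by (rule someI)
  then show "(SOME v. v \<in> lev s \<eta> t) \<in> car (fibre E s)" "bil \<eta> (co (SOME v. v \<in> lev s \<eta> t)) = t"
    by (simp_all add: lev_def)
qed

lemma kk_pt:
  assumes s: "s \<in> pts (bbase E)" and \<eta>: "\<eta> \<noteq> 0"
  shows "kk (pt s \<eta> t) = (cmod t)\<^sup>2 / K s \<eta>"
proof -
  define \<eta>' where "\<eta>' = (SOME \<eta>'. \<eta>' \<noteq> 0 \<and> lev s \<eta> 0 = lev s \<eta>' 0)"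
  have \<eta>': "\<eta>' \<noteq> 0 \<and> lev s \<eta> 0 = lev s \<eta>' 0"
    unfolding \<eta>'_def by (rule someI[of _ \<eta>]) (simp add: \<eta>)
  obtain c where c: "\<eta>' = c *\<^sub>C \<eta>" "c \<noteq> 0"
    using lev_eq_iff[OF s s \<eta> conjunct1[OF \<eta>'] conjunct2[OF \<eta>']] by blast
  have "kk (pt s \<eta> t) = (cmod (bil \<eta>' (co (SOME v. v \<in> lev s \<eta> t))))\<^sup>2 / K s \<eta>'"
    using pt_tot[OF s \<eta>, of t] by (simp add: kk_def pt_def foot_lev[OF s \<eta>] \<eta>'_def Let_def)
  also have "\<dots> = (cmod t)\<^sup>2 / K s \<eta>"
    unfolding c(1) bil_scale_left some_lev(2)[OF s \<eta>] K_scale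
    using c(2) by (simp add: norm_mult power_mult_distrib)
  finally show ?thesis .
qed

context
  fixes s :: 's and \<eta> :: "complex^('q option)" assumes s: "s \<in> pts (bbase E)" and \<eta>: "\<eta> \<noteq> 0"
begin

lemma O1_fibre_car: "car (fibre (O1 E) (lev s \<eta> 0)) = range (pt s \<eta>)"
proof (intro equalityI subsetI)
  fix p assume "p \<in> car (fibre (O1 E) (lev s \<eta> 0))"
  then have "p \<in> tot (O1 E)" "fst p = lev s \<eta> 0" by (auto simp: fibre_def O1_def)
  then obtain s' \<eta>' t where p: "p = (lev s' \<eta>' 0, lev s' \<eta>' t)" "s' \<in> pts (bbase E)" "\<eta>' \<noteq> 0"
    "lev s \<eta> 0 = lev s' \<eta>' 0" unfolding O1_tot by auto
  obtain c where "s = s'" "\<eta>' = c *\<^sub>C \<eta>" "c \<noteq> 0" using lev_eq_iff[OF s p(2) \<eta> p(3,4)] .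
  then have "p = pt s \<eta> (t / c)" using p(1) by (simp add: pt_def lev_scale)
  then show "p \<in> range (pt s \<eta>)" by simp
next
  fix p assume "p \<in> range (pt s \<eta>)"
  then obtain t where "p = pt s \<eta> t" by blast
  then show "p \<in> car (fibre (O1 E) (lev s \<eta> 0))"
    using pt_tot[OF s \<eta>, of t] by (simp add: fibre_def pt_def) (simp add: O1_def)
qed

lemma pt_inj: "inj (pt s \<eta>)"
proof (rule injI)
  fix t t' assume "pt s \<eta> t = pt s \<eta> t'"
  then have "lev s \<eta> t = lev s \<eta> t'" by (simp add: pt_def)
  then have "bil \<eta> (co (SOME v. v \<in> lev s \<eta> t)) = bil \<eta> (co (SOME v. v \<in> lev s \<eta> t'))"
    by (rule arg_cong)
  then show "t = t'" unfolding some_lev(2)[OF s \<eta>] .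
qed

lemma O1_vadd: "vadd (O1 E) (pt s \<eta> t) (pt s \<eta> t') = pt s \<eta> (t + t')"
proof -
  have "{vadd E v w | v w. v \<in> lev s \<eta> t \<and> w \<in> lev s \<eta> t'} = lev s \<eta> (t + t')" (is "?L = _")
  proof (intro equalityI subsetI)
    show "u \<in> lev s \<eta> (t + t')" if "u \<in> ?L" for u
      using that by (auto simp: lev_def closed_add[OF s] co_add[OF s] bil_add_right)
    show "u \<in> ?L" if u: "u \<in> lev s \<eta> (t + t')" for u
    proof -
      have uc: "u \<in> car (fibre E s)" "bil \<eta> (co u) = t + t'" using u by (simp_all add: lev_def)
      obtain v where v: "v \<in> lev s \<eta> t" using lev_nonempty[OF s \<eta>] .
      have vc: "v \<in> car (fibre E s)" "bil \<eta> (co v) = t" using v by (simp_all add: lev_def)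
      define w where "w = iv s (co u - co v)"
      have w: "w \<in> car (fibre E s)" "co w = co u - co v" by (simp_all add: w_def iv_car co_iv s)
      have "bil \<eta> (co v) + bil \<eta> (co w) = bil \<eta> (co u)"
        unfolding w(2) bil_add_right[symmetric] by simp
      then have "w \<in> lev s \<eta> t'" using w(1) vc(2) uc(2) by (simp add: lev_def)
      moreover have "u = vadd E v w"
        by (rule co_inj[OF s uc(1) closed_add[OF s vc(1) w(1)]])
          (simp add: co_add[OF s vc(1) w(1)] w(2))
      ultimately show ?thesis
        unfolding mem_Collect_eq using v by (intro exI[of _ v] exI[of _ w] conjI)
    qed
  qed
  then show ?thesis by (simp add: O1_def pt_def)
qed

lemma O1_vscale: "vscale (O1 E) c (pt s \<eta> t) = pt s \<eta> (c * t)"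
proof -
  have "{vadd E (vscale E c v) p | v p. v \<in> lev s \<eta> t \<and> p \<in> lev s \<eta> 0} = lev s \<eta> (c * t)" (is "?L = _")
  proof (intro equalityI subsetI)
    show "u \<in> lev s \<eta> (c * t)" if "u \<in> ?L" for u
      using that by (auto simp: lev_def closed_add[OF s] closed_scale[OF s] co_add[OF s] co_scale[OF s]
          bil_add_right bil_scale_right)
    show "u \<in> ?L" if u: "u \<in> lev s \<eta> (c * t)" for u
    proof -
      have uc: "u \<in> car (fibre E s)" "bil \<eta> (co u) = c * t" using u by (simp_all add: lev_def)
      obtain v where v: "v \<in> lev s \<eta> t" using lev_nonempty[OF s \<eta>] .
      have vc: "v \<in> car (fibre E s)" "bil \<eta> (co v) = t" using v by (simp_all add: lev_def)
      have cv: "vscale E c v \<in> car (fibre E s)" "co (vscale E c v) = c *\<^sub>C co v"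
        using closed_scale[OF s vc(1)] co_scale[OF s vc(1)] by auto
      define w where "w = iv s (co u - c *\<^sub>C co v)"
      have w: "w \<in> car (fibre E s)" "co w = co u - c *\<^sub>C co v" by (simp_all add: w_def iv_car co_iv s)
      have "bil \<eta> (c *\<^sub>C co v) + bil \<eta> (co w) = bil \<eta> (co u)"
        unfolding w(2) bil_add_right[symmetric] by simp
      then have "w \<in> lev s \<eta> 0" using w(1) vc(2) uc(2) by (simp add: lev_def bil_scale_right)
      moreover have "u = vadd E (vscale E c v) w"
        by (rule co_inj[OF s uc(1) closed_add[OF s cv(1) w(1)]])
          (simp add: co_add[OF s cv(1) w(1)] cv(2) w(2))
      ultimately show ?thesis
        unfolding mem_Collect_eq using v by (intro exI[of _ v] exI[of _ w] conjI)
    qed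
  qed
  then show ?thesis by (simp add: O1_def pt_def)
qed

lemma O1_linear_functional:
  "linear_functional (fibre (O1 E) (lev s \<eta> 0)) F \<longleftrightarrow> (\<exists>\<mu>. \<forall>t. F (pt s \<eta> t) = \<mu> * t)"
proof
  assume F: "linear_functional (fibre (O1 E) (lev s \<eta> 0)) F"
  have "F (pt s \<eta> t) = F (pt s \<eta> 1) * t" for t
  proof -
    have "pt s \<eta> 1 \<in> car (fibre (O1 E) (lev s \<eta> 0))" unfolding O1_fibre_car by simp
    from bspec[OF spec[OF conjunct2[OF F[unfolded linear_functional_def]]] this, of t]
    have "F (vscale (O1 E) t (pt s \<eta> 1)) = t * F (pt s \<eta> 1)" by (simp add: fibre_def)
    then show ?thesis by (simp add: O1_vscale mult.commute)
  qed
  then show "\<exists>\<mu>. \<forall>t. F (pt s \<eta> t) = \<mu> * t" by blast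
next
  assume "\<exists>\<mu>. \<forall>t. F (pt s \<eta> t) = \<mu> * t"
  then obtain \<mu> where \<mu>: "\<And>t. F (pt s \<eta> t) = \<mu> * t" by blast
  have simps: "add (fibre (O1 E) P) = vadd (O1 E)" "smult (fibre (O1 E) P) = vscale (O1 E)" for P
    by (simp_all add: fibre_def)
  show "linear_functional (fibre (O1 E) (lev s \<eta> 0)) F"
    unfolding linear_functional_def simps O1_fibre_car
    by (auto simp: O1_vadd O1_vscale \<mu> distrib_left)
qed

end

lemma metric_on_kk: "metric_on (O1 E) kk"
  unfolding metric_on_def
proof
  fix P assume "P \<in> pts (bbase (O1 E))"
  then have "P \<in> pts (PP E)" by (simp add: O1_def)
  then obtain s \<eta> where P: "P = lev s \<eta> 0" and s: "s \<in> pts (bbase E)" and \<eta>: "\<eta> \<noteq> 0"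
    unfolding PP_pts by blast
  define T where "T = inv (pt s \<eta>)"
  have T: "T (pt s \<eta> t) = t" for t unfolding T_def by (rule inv_f_f[OF pt_inj[OF s \<eta>]])
  define H where "H = (\<lambda>a b. T a * cnj (T b) / of_real (K s \<eta>))"
  have simps: "smult (fibre (O1 E) P) = vscale (O1 E)" for P by (simp add: fibre_def)
  have "positive_hermitian_form (fibre (O1 E) P) H"
    unfolding positive_hermitian_form_def P O1_fibre_car[OF s \<eta>] simps
  proof (intro conjI ballI impI)
    show "linear_functional (fibre (O1 E) (lev s \<eta> 0)) (\<lambda>v. H v w)" if "w \<in> range (pt s \<eta>)" for w
      unfolding O1_linear_functional[OF s \<eta>]
      by (rule exI[of _ "cnj (T w) / of_real (K s \<eta>)"]) (simp add: H_def T)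
    show "H w v = cnj (H v w)" for v w by (simp add: H_def)
    show "0 < Re (H v v)" if v: "v \<in> range (pt s \<eta>)" "v \<noteq> vscale (O1 E) 0 v" for v
    proof -
      obtain t where t: "v = pt s \<eta> t" using v(1) by blast
      then have "t \<noteq> 0" using v(2) by (auto simp: O1_vscale[OF s \<eta>])
      moreover have "H v v = of_real ((cmod t)\<^sup>2 / K s \<eta>)"
        unfolding H_def t T by (simp only: complex_norm_square of_real_divide)
      ultimately show ?thesis using K_pos[OF s \<eta>] by simp
    qed
  qed
  moreover have "complex_of_real (kk v) = H v v" if v: "v \<in> car (fibre (O1 E) P)" for v
  proof -
    obtain t where t: "v = pt s \<eta> t" using v unfolding P O1_fibre_car[OF s \<eta>] by blast
    show ?thesis
      unfolding H_def t T kk_pt[OF s \<eta>] by (simp only: complex_norm_square of_real_divide)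
  qed
  ultimately show "hermitian_metric (fibre (O1 E) P) kk" unfolding hermitian_metric_def by blast
qed

text \<open>The functional t \<mapsto> \<mu> t on the fibre over ker \<eta>. For \<mu> \<noteq> 0 it
  depends only on \<mu> \<eta>: the dual of O(1) at ker \<eta> is the line spanned by \<eta>, and
  off the zero section its total space is the dual bundle of E without zero.\<close>

definition Fn :: "'s \<Rightarrow> complex^('q option) \<Rightarrow> complex \<Rightarrow> 'e set \<times> ('e set \<times> 'e set \<Rightarrow> complex)" where
  "Fn s \<eta> \<mu> = (lev s \<eta> 0, restrict (\<lambda>p. \<mu> * inv (pt s \<eta>) p) (range (pt s \<eta>)))"

lemma Fn_apply:
  assumes "s \<in> pts (bbase E)" "\<eta> \<noteq> 0" shows "snd (Fn s \<eta> \<mu>) (pt s \<eta> t) = \<mu> * t"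
  by (simp add: Fn_def inv_f_f[OF pt_inj[OF assms]])

lemma Fn_tot:
  assumes "s \<in> pts (bbase E)" "\<eta> \<noteq> 0" shows "Fn s \<eta> \<mu> \<in> tot (dual (O1 E))"
proof -
  have "lev s \<eta> 0 \<in> pts (PP E)" unfolding PP_pts using assms by blast
  moreover have "linear_functional (fibre (O1 E) (lev s \<eta> 0)) (snd (Fn s \<eta> \<mu>))"
    unfolding O1_linear_functional[OF assms] using Fn_apply[OF assms] by blast
  ultimately show ?thesis
    by (simp add: dual_def Fn_def O1_fibre_car[OF assms]) (simp add: O1_def)
qed

lemma tot_dual_Fn:
  assumes s: "s \<in> pts (bbase E)" and \<eta>: "\<eta> \<noteq> 0"
    and p: "p \<in> tot (dual (O1 E))" "fst p = lev s \<eta> 0"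
  obtains \<mu> where "p = Fn s \<eta> \<mu>"
proof -
  obtain F where F: "p = (lev s \<eta> 0, F)" using p(2) by (cases p) simp
  have "linear_functional (fibre (O1 E) (lev s \<eta> 0)) F" "F \<in> extensional (range (pt s \<eta>))"
    using p(1) unfolding F by (simp_all add: dual_def O1_fibre_car[OF s \<eta>])
  moreover obtain \<mu> where \<mu>: "\<And>t. F (pt s \<eta> t) = \<mu> * t"
    using calculation(1) unfolding O1_linear_functional[OF s \<eta>] by blast
  ultimately have "F = restrict (\<lambda>p. \<mu> * inv (pt s \<eta>) p) (range (pt s \<eta>))"
    by (intro extensionalityI[of F "range (pt s \<eta>)"]) (auto simp: inv_f_f[OF pt_inj[OF s \<eta>]])
  then show ?thesis using that F by (simp add: Fn_def)
qed

text \<open>The unit ball of the one dimensional fibre is |t|^2 \<le> K(\<eta>), and the supremum is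
  attained at t = sqrt K(\<eta>). So the dual of \<open>kk\<close> is K itself, evaluated at the
  functional \<mu> \<eta>.\<close>

lemma dual_metric_Fn:
  assumes s: "s \<in> pts (bbase E)" and \<eta>: "\<eta> \<noteq> 0"
  shows "dual_metric (O1 E) kk (Fn s \<eta> \<mu>) = K s (\<mu> *\<^sub>C \<eta>)"
proof -
  have K: "0 < K s \<eta>" by (rule K_pos[OF s \<eta>])
  have F: "snd (Fn s \<eta> \<mu>) (pt s \<eta> t) = \<mu> * t" for t by (rule Fn_apply[OF s \<eta>])
  let ?A = "{(cmod (snd (Fn s \<eta> \<mu>) v))\<^sup>2 | v. v \<in> car (fibre (O1 E) (lev s \<eta> 0)) \<and> kk v \<le> 1}"
  have "Sup ?A = (cmod \<mu>)\<^sup>2 * K s \<eta>"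
  proof (rule cSup_eq_maximum)
    let ?t = "of_real (sqrt (K s \<eta>)) :: complex"
    have "(cmod (snd (Fn s \<eta> \<mu>) (pt s \<eta> ?t)))\<^sup>2 = (cmod \<mu>)\<^sup>2 * K s \<eta>"
      unfolding F using K by (simp add: norm_mult power_mult_distrib)
    moreover have "kk (pt s \<eta> ?t) \<le> 1" unfolding kk_pt[OF s \<eta>] using K by simp
    ultimately show "(cmod \<mu>)\<^sup>2 * K s \<eta> \<in> ?A"
      unfolding O1_fibre_car[OF s \<eta>] mem_Collect_eq
      by (intro exI[of _ "pt s \<eta> ?t"] conjI rangeI) simp_all
    fix y assume "y \<in> ?A"
    then obtain t where y: "y = (cmod (snd (Fn s \<eta> \<mu>) (pt s \<eta> t)))\<^sup>2" "kk (pt s \<eta> t) \<le> 1"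
      unfolding O1_fibre_car[OF s \<eta>] by blast
    have "(cmod t)\<^sup>2 \<le> K s \<eta>" using y(2) K unfolding kk_pt[OF s \<eta>] by simp
    then show "y \<le> (cmod \<mu>)\<^sup>2 * K s \<eta>"
      unfolding y(1) F by (simp add: norm_mult power_mult_distrib mult_left_mono)
  qed
  then show ?thesis unfolding K_scale by (simp add: dual_metric_def Fn_def)
qed

end

section \<open>Charts of the dual line bundle and the curvature of the dual metric\<close>

lemma vec_1_eqI: "(v::'a^1) $ 1 = w $ 1 \<Longrightarrow> v = w"
  by (simp add: vec_eq_iff)

lemma inv_into_image_eq: "inj_on x B \<Longrightarrow> A \<subseteq> B \<Longrightarrow> z \<in> x ` A \<Longrightarrow> inv_into B x z \<in> A \<and> x (inv_into B x z) = z"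
  by (auto simp: subset_iff)

lemma holo_on_aff: "holo_on U f \<Longrightarrow> holo_on U (\<lambda>z. aff \<tau> (f z) $ j)"
  by (cases "inv \<tau> j") (auto simp: aff_def intro: holo_on_nth)

lemma atlas_total_manifold:
  "atlas (total_manifold F) =
     {({v \<in> tot F. bproj F v \<in> B \<inter> U}, \<lambda>v. (x (bproj F v), \<phi> v)) | B x U \<phi>.
       (B, x) \<in> atlas (bbase F) \<and> (U, \<phi>) \<in> trivs F}"
  by (simp add: total_manifold_def)

lemma bbase_dual [simp]: "bbase (dual F) = bbase F"
  by (simp add: dual_def)

lemma bproj_dual [simp]: "bproj (dual F) = fst"
  by (simp add: dual_def)

lemma trivs_dual:
  "trivs (dual F) = {(U, \<lambda>(s, f). \<chi> j. f (inv_into (car (fibre F s)) \<phi> (axis j 1))) | U \<phi>. (U, \<phi>) \<in> trivs F}"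
  by (simp add: dual_def)

lemma bbase_O1 [simp]: "bbase (O1 F) = PP F"
  by (simp add: O1_def)

lemma trivs_O1:
  "trivs (O1 F) = {(affine_domain F U \<phi> \<tau>,
     \<lambda>(P, a). \<chi> _. affine_form \<tau> (affine_coord F \<phi> \<tau> P) (\<phi> (SOME v. v \<in> a))) | U \<phi> \<tau>.
       (U, \<phi>) \<in> trivs F \<and> bij \<tau>}"
  by (simp add: O1_def)

lemma atlas_PP:
  "atlas (PP F) = {(affine_domain F (B \<inter> U) \<phi> \<tau>, \<lambda>P. (x (foot F P), affine_coord F \<phi> \<tau> P)) | B x U \<phi> \<tau>.
     (B, x) \<in> atlas (bbase F) \<and> (U, \<phi>) \<in> trivs F \<and> bij \<tau>}"
  by (simp add: PP_def)

context finsler_bundle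
begin

lemma affine_hyperplane_lev:
  assumes "(U, \<phi>) \<in> trivs E" "s \<in> U" "bij \<tau>"
  shows "affine_hyperplane E \<phi> \<tau> s \<zeta> = lev s (aff \<tau> \<zeta>) 0"
proof -
  have "affine_form \<tau> \<zeta> (\<phi> v) = 0 \<longleftrightarrow> bil (aff \<tau> \<zeta>) (co v) = 0" if "v \<in> car (fibre E s)" for v
    using g_nz[OF assms(1,2)]
    by (simp add: affine_form_eq[OF assms(3)] triv_eq[OF assms(1,2) that] bil_scale_right)
  then show ?thesis by (auto simp: affine_hyperplane_def lev_def)
qed

lemma affine_coord_lev:
  assumes "(U, \<phi>) \<in> trivs E" "s \<in> U" "bij \<tau>"
  shows "affine_coord E \<phi> \<tau> (lev s (aff \<tau> \<zeta>) 0) = \<zeta>"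
proof -
  have s: "s \<in> pts (bbase E)" by (rule triv_pts[OF assms(1,2)])
  show ?thesis
    unfolding affine_coord_def foot_lev[OF s aff_nonzero[OF assms(3)]] affine_hyperplane_lev[OF assms]
  proof (rule the_equality)
    fix \<zeta>' assume "lev s (aff \<tau> \<zeta>) 0 = lev s (aff \<tau> \<zeta>') 0"
    then obtain c where "aff \<tau> \<zeta>' = c *\<^sub>C aff \<tau> \<zeta>"
      using lev_eq_iff[OF s s aff_nonzero[OF assms(3)] aff_nonzero[OF assms(3)]] by blast
    then show "\<zeta>' = \<zeta>" by (rule aff_eq_scale[OF assms(3)])
  qed (rule refl)
qed

lemma Fn_zero:
  assumes "s \<in> pts (bbase E)" "\<eta> \<noteq> 0" shows "Fn s \<eta> 0 \<in> zero_section (dual (O1 E))"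
proof -
  have "vscale (dual (O1 E)) 0 (Fn s \<eta> 0) = Fn s \<eta> 0"
    by (simp add: dual_def Fn_def O1_fibre_car[OF assms] restrict_def fun_eq_iff)
  then show ?thesis using Fn_tot[OF assms] by (simp add: zero_section_def)
qed

context
  fixes B :: "'s set" and x :: "'s \<Rightarrow> 'm" and U :: "'s set" and \<phi> :: "'e \<Rightarrow> complex^('q option)"
    and \<tau> :: "'q option \<Rightarrow> 'q option" and U2 :: "'s set" and \<phi>2 :: "'e \<Rightarrow> complex^('q option)"
    and \<tau>2 :: "'q option \<Rightarrow> 'q option"
begin

definition O1_triv :: "'e set \<times> 'e set \<Rightarrow> complex^1" where
  "O1_triv = (\<lambda>(P, a). \<chi> _. affine_form \<tau>2 (affine_coord E \<phi>2 \<tau>2 P) (\<phi>2 (SOME v. v \<in> a)))"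

text \<open>A chart of the total space pairs a chart of the projectivization, given by B, U, \<tau>,
  with an independent trivialization of O(1), given by U2, \<tau>2. The two need not match, which is
  why every chart carries both sets of data.\<close>

definition dual_chart_dom :: "('e set \<times> ('e set \<times> 'e set \<Rightarrow> complex)) set" where
  "dual_chart_dom = {p \<in> tot (dual (O1 E)). fst p \<in> affine_domain E (B \<inter> U) \<phi> \<tau> \<inter> affine_domain E U2 \<phi>2 \<tau>2}"

definition dual_chart :: "'e set \<times> ('e set \<times> 'e set \<Rightarrow> complex) \<Rightarrow> ('m \<times> (complex^'q)) \<times> (complex^1)" where
  "dual_chart = (\<lambda>p. ((x (foot E (fst p)), affine_coord E \<phi> \<tau> (fst p)),
     (\<chi> j. snd p (inv_into (car (fibre (O1 E) (fst p))) O1_triv (axis j 1)))))"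

definition chart_img :: "(('m \<times> (complex^'q)) \<times> (complex^1)) set" where
  "chart_img = {w. fst (fst w) \<in> x ` (B \<inter> U \<inter> U2) \<and> aff \<tau> (snd (fst w)) $ \<tau>2 None \<noteq> 0}"

text \<open>The inverse of \<open>dual_chart\<close>. Dividing by the entry at \<tau>2 None passes
  from the normalization of \<eta> for \<tau> to the one for \<tau>2, and g converts the fibre
  coordinate of the trivialization \<phi>2 into the one given by \<open>co\<close>.\<close>

definition dual_param :: "('m \<times> (complex^'q)) \<times> (complex^1) \<Rightarrow> 'e set \<times> ('e set \<times> 'e set \<Rightarrow> complex)" where
  "dual_param = (\<lambda>w. Fn (inv_into B x (fst (fst w)))
     (inverse (aff \<tau> (snd (fst w)) $ \<tau>2 None) *\<^sub>C aff \<tau> (snd (fst w)))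
     (snd w $ 1 * g \<phi>2 (inv_into B x (fst (fst w)))))"

definition metric_sq :: "'m \<times> (complex^('q option)) \<Rightarrow> real" where
  "metric_sq = (\<lambda>(z, \<eta>). (K (inv_into B x z) (g \<phi>2 (inv_into B x z) *\<^sub>C \<eta>))\<^sup>2)"

text \<open>The map from the dual of O(1) to the dual bundle of E in coordinates, sending the
  functional \<mu> over ker \<eta> to \<mu> \<eta>. It collapses the zero section and is an
  immersion elsewhere.\<close>

definition chart_functional :: "('m \<times> (complex^'q)) \<times> (complex^1) \<Rightarrow> 'm \<times> (complex^('q option))" where
  "chart_functional = (\<lambda>w. (fst (fst w), (snd w $ 1 * inverse (aff \<tau> (snd (fst w)) $ \<tau>2 None)) *\<^sub>C aff \<tau> (snd (fst w))))"

context
  assumes B: "(B, x) \<in> atlas (bbase E)" and U: "(U, \<phi>) \<in> trivs E" and \<tau>: "bij \<tau>"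
    and U2: "(U2, \<phi>2) \<in> trivs E" and \<tau>2: "bij \<tau>2"
begin

lemma inv_into_BU:
  assumes "z \<in> x ` (B \<inter> U \<inter> U2)"
  shows "inv_into B x z \<in> B \<inter> U \<inter> U2" "x (inv_into B x z) = z"
proof -
  have "B \<inter> U \<inter> U2 \<subseteq> B" by blast
  from inv_into_image_eq[OF atlas_inj[OF B] this assms]
  show "inv_into B x z \<in> B \<inter> U \<inter> U2" "x (inv_into B x z) = z" by auto
qed

lemma O1_triv_pt:
  assumes "s \<in> U2" shows "O1_triv (pt s (aff \<tau>2 \<zeta>) t) $ i = g \<phi>2 s * t"
proof -
  note s = triv_pts[OF U2 assms]
  show ?thesis
    by (simp add: O1_triv_def pt_def affine_coord_lev[OF U2 assms \<tau>2] affine_form_eq[OF \<tau>2]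
        triv_eq[OF U2 assms some_lev(1)[OF s aff_nonzero[OF \<tau>2]]] bil_scale_right
        some_lev(2)[OF s aff_nonzero[OF \<tau>2]])
qed

lemma dual_chart_param:
  assumes "w \<in> chart_img"
  shows "dual_param w \<in> dual_chart_dom" and "dual_chart (dual_param w) = w"
proof -
  define s where "s = inv_into B x (fst (fst w))"
  define \<zeta> where "\<zeta> = snd (fst w)"
  define e where "e = aff \<tau> \<zeta>"
  define \<mu> where "\<mu> = snd w $ 1 * g \<phi>2 s"
  have sB: "s \<in> B" "s \<in> U" "s \<in> U2" and xs: "x s = fst (fst w)"
    using inv_into_BU[of "fst (fst w)"] assms by (auto simp: chart_img_def s_def)
  have e0: "e $ \<tau>2 None \<noteq> 0" using assms by (simp add: chart_img_def e_def \<zeta>_def)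
  have s: "s \<in> pts (bbase E)" by (rule triv_pts[OF U sB(2)])
  \<comment> \<open>The same hyperplane in the affine coordinates for \<tau>2, in which the
    trivialization of O(1) is explicit.\<close>
  define \<zeta>2 where "\<zeta>2 = (\<chi> i. e $ \<tau>2 (Some i) / e $ \<tau>2 None)"
  have aff2: "aff \<tau>2 \<zeta>2 = inverse (e $ \<tau>2 None) *\<^sub>C e"
    unfolding \<zeta>2_def by (rule aff_normalize[OF \<tau>2 e0])
  have param: "dual_param w = Fn s (aff \<tau>2 \<zeta>2) \<mu>"
    by (simp only: dual_param_def s_def[symmetric] \<zeta>_def[symmetric] e_def[symmetric] aff2 \<mu>_def)
  have fst: "fst (dual_param w) = lev s (aff \<tau>2 \<zeta>2) 0" by (simp only: param Fn_def fst_conv)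
  also have fst': "\<dots> = lev s (aff \<tau> \<zeta>) 0"
    unfolding aff2 e_def[symmetric] using e0 by (simp add: lev_scale)
  finally have fst2: "fst (dual_param w) = lev s (aff \<tau> \<zeta>) 0" .
  have "dual_param w \<in> tot (dual (O1 E))" unfolding param by (rule Fn_tot[OF s aff_nonzero[OF \<tau>2]])
  moreover have "fst (dual_param w) \<in> affine_domain E (B \<inter> U) \<phi> \<tau>"
    unfolding affine_domain_def fst2 affine_hyperplane_lev[OF U sB(2) \<tau>, symmetric] using sB by blast
  moreover have "fst (dual_param w) \<in> affine_domain E U2 \<phi>2 \<tau>2"
    unfolding affine_domain_def fst affine_hyperplane_lev[OF U2 sB(3) \<tau>2, symmetric] using sB by blast
  ultimately show "dual_param w \<in> dual_chart_dom" by (simp add: dual_chart_dom_def)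
  have foot: "foot E (fst (dual_param w)) = s" unfolding fst2 by (rule foot_lev[OF s aff_nonzero[OF \<tau>]])
  have coord: "affine_coord E \<phi> \<tau> (fst (dual_param w)) = \<zeta>"
    unfolding fst2 by (rule affine_coord_lev[OF U sB(2) \<tau>])
  have g2: "g \<phi>2 s \<noteq> 0" by (rule g_nz[OF U2 sB(3)])
  have inv: "inv_into (range (pt s (aff \<tau>2 \<zeta>2))) O1_triv (axis j 1) = pt s (aff \<tau>2 \<zeta>2) (1 / g \<phi>2 s)" for j
  proof (rule inv_into_f_eq)
    show "inj_on O1_triv (range (pt s (aff \<tau>2 \<zeta>2)))"
    proof (rule inj_onI, elim rangeE)
      fix p q t t' assume pq: "p = pt s (aff \<tau>2 \<zeta>2) t" "q = pt s (aff \<tau>2 \<zeta>2) t'" "O1_triv p = O1_triv q"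
      then have "O1_triv p $ 1 = O1_triv q $ 1" by simp
      then have "t = t'" unfolding pq(1,2) O1_triv_pt[OF sB(3)] using g2 by simp
      then show "p = q" using pq by simp
    qed
    show "O1_triv (pt s (aff \<tau>2 \<zeta>2) (1 / g \<phi>2 s)) = axis j 1"
      by (rule vec_1_eqI) (simp add: O1_triv_pt[OF sB(3)] g2 axis_def)
  qed simp
  have "(\<chi> j. snd (dual_param w) (inv_into (car (fibre (O1 E) (fst (dual_param w)))) O1_triv (axis j 1))) = snd w"
  proof (rule vec_1_eqI)
    show "(\<chi> j. snd (dual_param w) (inv_into (car (fibre (O1 E) (fst (dual_param w)))) O1_triv (axis j 1))) $ 1
        = snd w $ 1"
      unfolding vec_lambda_beta fst O1_fibre_car[OF s aff_nonzero[OF \<tau>2]] inv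
      unfolding param Fn_apply[OF s aff_nonzero[OF \<tau>2]] \<mu>_def using g2 by simp
  qed
  then show "dual_chart (dual_param w) = w"
    by (simp add: dual_chart_def foot coord xs) (simp add: \<zeta>_def)
qed

lemma dual_chart_dom_param: "dual_chart_dom \<subseteq> dual_param ` chart_img"
proof
  fix p assume p: "p \<in> dual_chart_dom"
  obtain s \<zeta> where s: "s \<in> B" "s \<in> U" and ps: "fst p = affine_hyperplane E \<phi> \<tau> s \<zeta>"
    using p by (auto simp: dual_chart_dom_def affine_domain_def)
  obtain s2 \<zeta>2 where s2: "s2 \<in> U2" and ps2: "fst p = affine_hyperplane E \<phi>2 \<tau>2 s2 \<zeta>2"
    using p by (auto simp: dual_chart_dom_def affine_domain_def)
  note pp = triv_pts[OF U s(2)] triv_pts[OF U2 s2] aff_nonzero[OF \<tau>] aff_nonzero[OF \<tau>2]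
  have eq: "lev s (aff \<tau> \<zeta>) 0 = lev s2 (aff \<tau>2 \<zeta>2) 0"
    using ps ps2 by (simp add: affine_hyperplane_lev[OF U s(2) \<tau>] affine_hyperplane_lev[OF U2 s2 \<tau>2])
  obtain c where c: "s = s2" "aff \<tau>2 \<zeta>2 = c *\<^sub>C aff \<tau> \<zeta>" "c \<noteq> 0"
    using lev_eq_iff[OF pp(1,2,3,4) eq] .
  have c1: "c * aff \<tau> \<zeta> $ \<tau>2 None = 1"
    using arg_cong[OF c(2), of "\<lambda>v. v $ \<tau>2 None"] \<tau>2 by simp
  have e0: "aff \<tau> \<zeta> $ \<tau>2 None \<noteq> 0"
  proof
    assume "aff \<tau> \<zeta> $ \<tau>2 None = 0" then show False using c1 by simp
  qed
  have cinv: "c = inverse (aff \<tau> \<zeta> $ \<tau>2 None)"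
    using c1 e0 by (simp add: field_simps)
  have tot: "p \<in> tot (dual (O1 E))" using p by (simp add: dual_chart_dom_def)
  have "fst p = lev s (aff \<tau>2 \<zeta>2) 0" using eq unfolding ps affine_hyperplane_lev[OF U s(2) \<tau>] c(1)[symmetric] .
  then obtain \<mu> where \<mu>: "p = Fn s (aff \<tau>2 \<zeta>2) \<mu>" using tot_dual_Fn[OF pp(1) aff_nonzero[OF \<tau>2] tot] by blast
  have g2: "g \<phi>2 s \<noteq> 0" using g_nz[OF U2 s2] c(1) by simp
  define w :: "('m \<times> (complex^'q)) \<times> (complex^1)" where "w = ((x s, \<zeta>), (\<chi> _. \<mu> / g \<phi>2 s))"
  have "inv_into B x (x s) = s" using atlas_inj[OF B] s(1) by (rule inv_into_f_f)
  then have "dual_param w = p"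
    unfolding \<mu> c(2) cinv using g2 by (simp add: dual_param_def w_def)
  moreover have "w \<in> chart_img" using s s2 c(1) e0 by (simp add: chart_img_def w_def)
  ultimately show "p \<in> dual_param ` chart_img" by blast
qed

lemma dual_chart_image: "dual_chart ` dual_chart_dom = chart_img"
  and dual_chart_inv: "w \<in> chart_img \<Longrightarrow> inv_into dual_chart_dom dual_chart w = dual_param w"
proof -
  have *: "dual_param w \<in> dual_chart_dom \<and> dual_chart (dual_param w) = w" if "w \<in> chart_img" for w
    using dual_chart_param[OF that] by simp
  show "dual_chart ` dual_chart_dom = chart_img"
    by (rule parametrized_chart(1)[OF * dual_chart_dom_param])
  show "inv_into dual_chart_dom dual_chart w = dual_param w" if "w \<in> chart_img"
    by (rule parametrized_chart(2)[OF * dual_chart_dom_param that])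
qed

lemma dual_metric_param:
  assumes "w \<in> chart_img"
  shows "dual_metric (O1 E) kk (dual_param w) = sqrt (metric_sq (chart_functional w))"
proof -
  define s where "s = inv_into B x (fst (fst w))"
  have "s \<in> U" using inv_into_BU(1)[of "fst (fst w)"] assms by (simp add: s_def chart_img_def)
  then have s: "s \<in> pts (bbase E)" by (rule triv_pts[OF U])
  define e where "e = aff \<tau> (snd (fst w))"
  have "e $ \<tau>2 None \<noteq> 0" using assms by (simp add: chart_img_def e_def)
  then have \<eta>: "inverse (e $ \<tau>2 None) *\<^sub>C e \<noteq> 0" by (auto simp: vec_eq_iff)
  have "dual_metric (O1 E) kk (dual_param w)
      = K s ((snd w $ 1 * g \<phi>2 s) *\<^sub>C inverse (e $ \<tau>2 None) *\<^sub>C e)"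
    unfolding dual_param_def s_def[symmetric] e_def[symmetric] by (rule dual_metric_Fn[OF s \<eta>])
  also have "(snd w $ 1 * g \<phi>2 s) *\<^sub>C inverse (e $ \<tau>2 None) *\<^sub>C e
      = g \<phi>2 s *\<^sub>C (snd w $ 1 * inverse (e $ \<tau>2 None)) *\<^sub>C e"
    by (simp add: scaleC_scaleC mult_ac)
  also have "K s \<dots> = sqrt (metric_sq (chart_functional w))"
    using K_nonneg[OF s] by (simp add: metric_sq_def chart_functional_def s_def e_def)
  finally show ?thesis .
qed

lemma chart_img_open: "open chart_img"
proof -
  have "continuous_on UNIV (\<lambda>w::('m \<times> (complex^'q)) \<times> (complex^1). aff \<tau> (snd (fst w)) $ \<tau>2 None)"
    by (intro holo_on_continuous holo_on_aff holo_on_snd holo_on_fst holo_on_ident)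
  then have "open ((\<lambda>w::('m \<times> (complex^'q)) \<times> (complex^1). aff \<tau> (snd (fst w)) $ \<tau>2 None) -` (- {0}))"
    by (intro open_vimage) auto
  moreover have "open ((\<lambda>w::('m \<times> (complex^'q)) \<times> (complex^1). fst (fst w)) -` (x ` (B \<inter> U \<inter> U2)))"
    by (intro open_vimage chart_open[OF B U U2] continuous_intros)
  ultimately have "open ((\<lambda>w::('m \<times> (complex^'q)) \<times> (complex^1). fst (fst w)) -` (x ` (B \<inter> U \<inter> U2))
      \<inter> (\<lambda>w. aff \<tau> (snd (fst w)) $ \<tau>2 None) -` (- {0}))" by (rule open_Int[rotated])
  also have "\<dots> = chart_img" by (auto simp: chart_img_def)
  finally show ?thesis .
qed

lemma chart_functional_holo: "holo_on chart_img chart_functional"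
  unfolding chart_functional_def
proof (intro holo_on_Pair holo_on_fst holo_on_ident holo_on_vec)
  fix j
  have "holo_on chart_img (\<lambda>w. snd w $ 1 * inverse (aff \<tau> (snd (fst w)) $ \<tau>2 None) * aff \<tau> (snd (fst w)) $ j)"
    by (intro holo_on_mult holo_on_nth holo_on_aff holo_on_snd holo_on_fst holo_on_ident holo_on_inverse)
      (simp add: chart_img_def)
  then show "holo_on chart_img (\<lambda>z. ((snd z $ 1 * inverse (aff \<tau> (snd (fst z)) $ \<tau>2 None)) *\<^sub>C
      aff \<tau> (snd (fst z))) $ j)" by simp
qed

text \<open>On the zero section \<mu> \<eta> vanishes, and there the root of a sum of squares need
  not be smooth. By homogeneity |\<mu>|^2 splits off, and the root is left at a normalized \<eta>,
  which is nonzero.\<close>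

lemma chart_metric_smooth:
  "k_smooth_on k chart_img (dual_metric (O1 E) kk \<circ> inv_into dual_chart_dom dual_chart)"
proof -
  let ?h = "\<lambda>w::('m \<times> (complex^'q)) \<times> (complex^1).
    (fst (fst w), inverse (aff \<tau> (snd (fst w)) $ \<tau>2 None) *\<^sub>C aff \<tau> (snd (fst w)))"
  have h: "holo_on chart_img ?h"
  proof (intro holo_on_Pair holo_on_fst holo_on_ident holo_on_vec)
    fix j
    have "holo_on chart_img (\<lambda>w. inverse (aff \<tau> (snd (fst w)) $ \<tau>2 None) * aff \<tau> (snd (fst w)) $ j)"
      by (intro holo_on_mult holo_on_aff holo_on_snd holo_on_fst holo_on_ident holo_on_inverse)
        (simp add: chart_img_def)
    then show "holo_on chart_img (\<lambda>z. (inverse (aff \<tau> (snd (fst z)) $ \<tau>2 None) *\<^sub>C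
        aff \<tau> (snd (fst z))) $ j)" by simp
  qed
  have img: "?h ` chart_img \<subseteq> x ` (B \<inter> U2) \<times> UNIV" by (auto simp: chart_img_def)
  obtain qs where qs: "sos_rep (x ` (B \<inter> U2) \<times> UNIV) qs metric_sq"
    using K_sos[OF B U2] by (auto simp: immersive_sos_def metric_sq_def)
  have nz: "aff \<tau> (snd (fst w)) $ \<tau>2 None \<noteq> 0"
    "inv_into B x (fst (fst w)) \<in> pts (bbase E)" "g \<phi>2 (inv_into B x (fst (fst w))) \<noteq> 0"
    if "w \<in> chart_img" for w
    using that inv_into_BU(1)[of "fst (fst w)"] triv_pts[OF U] g_nz[OF U2] by (auto simp: chart_img_def)
  have pos: "0 < metric_sq (?h w)" if w: "w \<in> chart_img" for w
  proof -
    have "aff \<tau> (snd (fst w)) \<noteq> 0" by (rule aff_nonzero[OF \<tau>])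
    then have "g \<phi>2 (inv_into B x (fst (fst w))) *\<^sub>C inverse (aff \<tau> (snd (fst w)) $ \<tau>2 None) *\<^sub>C aff \<tau> (snd (fst w)) \<noteq> 0"
      using nz(1,3)[OF w] by (auto simp: vec_eq_iff)
    from K_pos[OF nz(2)[OF w] this] show ?thesis by (simp add: metric_sq_def)
  qed
  have eq: "(cmod (snd w $ 1))\<^sup>2 * sqrt (metric_sq (?h w)) = dual_metric (O1 E) kk (dual_param w)"
    if w: "w \<in> chart_img" for w
  proof -
    have sq: "metric_sq (chart_functional w) = ((cmod (snd w $ 1))\<^sup>2)\<^sup>2 * metric_sq (?h w)"
      by (simp add: metric_sq_def chart_functional_def K_scale norm_mult power_mult_distrib)
    show ?thesis unfolding dual_metric_param[OF w] sq real_sqrt_mult real_sqrt_abs by simp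
  qed
  have "k_smooth_on k chart_img (\<lambda>w. (cmod (snd w $ 1))\<^sup>2 * sqrt (metric_sq (?h w)))"
    by (intro k_smooth_on_mult k_smooth_on_cmod2_holo k_smooth_on_sqrt chart_img_open pos
        sos_rep_smooth[OF chart_img_open sos_rep_compose[OF qs h img]]
        holo_on_nth holo_on_snd holo_on_ident)
  then show ?thesis
    by (rule k_smooth_on_cong[OF chart_img_open, rotated]) (simp add: eq dual_chart_inv)
qed

text \<open>Here the metric is the root of an immersive sum of squares composed with
  \<open>chart_functional\<close>. Off the zero section the composition stays immersive, because
  \<open>chart_functional\<close> has a holomorphic left inverse there.\<close>

lemma chart_metric_levi:
  assumes w: "w \<in> chart_img" and nz: "snd w $ 1 \<noteq> 0" and v: "v \<noteq> 0"
  shows "0 < Re (levi (dual_metric (O1 E) kk \<circ> inv_into dual_chart_dom dual_chart) w v)"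
proof -
  obtain qs where qs: "sos_rep (x ` (B \<inter> U2) \<times> UNIV) qs metric_sq"
    and imm: "\<forall>z\<in>x ` (B \<inter> U2) \<times> (- {0}). \<forall>w. (\<forall>q\<in>set qs. Dv q z w = 0) \<longrightarrow> w = 0"
    using K_sos[OF B U2] unfolding immersive_sos_def metric_sq_def[symmetric] by (elim exE conjE)
  have img: "chart_functional ` chart_img \<subseteq> x ` (B \<inter> U2) \<times> UNIV"
    by (auto simp: chart_img_def chart_functional_def)
  have rep: "sos_rep chart_img (map (\<lambda>q z. q (chart_functional z)) qs) (\<lambda>z. metric_sq (chart_functional z))"
    by (rule sos_rep_compose[OF qs chart_functional_holo img])
  have e0: "aff \<tau> (snd (fst w)) $ \<tau>2 None \<noteq> 0" using w by (simp add: chart_img_def)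
  have "(snd w $ 1 * inverse (aff \<tau> (snd (fst w)) $ \<tau>2 None)) *\<^sub>C aff \<tau> (snd (fst w)) \<noteq> 0"
    using nz e0 aff_nonzero[OF \<tau>, of "snd (fst w)"] by (auto simp: vec_eq_iff)
  then have "snd (chart_functional w) \<noteq> 0" by (simp add: chart_functional_def)
  moreover have wimg: "chart_functional w \<in> x ` (B \<inter> U2) \<times> UNIV" using w img by blast
  ultimately have cw: "chart_functional w \<in> x ` (B \<inter> U2) \<times> (- {0})"
    by (simp add: mem_Times_iff)
  define s where "s = inv_into B x (fst (fst w))"
  have sU: "s \<in> U" "s \<in> U2" using inv_into_BU(1)[of "fst (fst w)"] w by (simp_all add: s_def chart_img_def)
  have "g \<phi>2 s *\<^sub>C snd (chart_functional w) \<noteq> 0"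
    using g_nz[OF U2 sU(2)] \<open>snd (chart_functional w) \<noteq> 0\<close> by (auto simp: vec_eq_iff)
  from K_pos[OF triv_pts[OF U sU(1)] this]
  have pos: "0 < metric_sq (chart_functional w)"
    by (simp add: metric_sq_def chart_functional_def s_def)
  note Df = holo_on_has_derivative[OF chart_functional_holo w]
  have Dv0: "Dv chart_functional w v \<noteq> 0"
  proof
    assume D0: "Dv chart_functional w v = 0"
    define N where "N = chart_img \<inter> (\<lambda>w. snd w $ 1) -` (- {0})"
    have N: "open N" "w \<in> N"
      unfolding N_def using w nz
      by (auto intro!: open_Int chart_img_open open_vimage continuous_intros)
    \<comment> \<open>The left inverse: ratios of the components of the functional return the affine
      coordinates for \<tau>, and the component at \<tau>2 None returns the fibre coordinate, by the
      normalization for \<tau>2.\<close>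
    define \<Psi> :: "'m \<times> (complex^('q option)) \<Rightarrow> ('m \<times> (complex^'q)) \<times> (complex^1)"
      where "\<Psi> = (\<lambda>p. ((fst p, \<chi> i. snd p $ \<tau> (Some i) / snd p $ \<tau> None), \<chi> _. snd p $ \<tau>2 None))"
    define V where "V = {p::'m \<times> (complex^('q option)). snd p $ \<tau> None \<noteq> 0}"
    have "holo_on V \<Psi>"
      unfolding \<Psi>_def
    proof (intro holo_on_Pair holo_on_fst holo_on_ident holo_on_vec)
      show "holo_on V (\<lambda>z. (\<chi> i. snd z $ \<tau> (Some i) / snd z $ \<tau> None) $ i)" for i
        unfolding vec_lambda_beta
        by (intro holo_on_divide holo_on_nth holo_on_snd holo_on_ident) (simp add: V_def)
      show "holo_on V (\<lambda>z. (\<chi> _. snd z $ \<tau>2 None) $ i)" for i :: 1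
        unfolding vec_lambda_beta by (intro holo_on_nth holo_on_snd holo_on_ident)
    qed
    moreover have "chart_functional w \<in> V"
      using nz e0 \<tau> by (simp add: V_def chart_functional_def)
    ultimately have D\<Psi>: "(\<Psi> has_derivative Dv \<Psi> (chart_functional w)) (at (chart_functional w))"
      by (rule holo_on_has_derivative)
    have "\<Psi> (chart_functional y) = y" if y: "y \<in> N" for y
    proof -
      have nz: "snd y $ 1 \<noteq> 0" "aff \<tau> (snd (fst y)) $ \<tau>2 None \<noteq> 0"
        using y by (auto simp: N_def chart_img_def)
      have "(\<chi> _. snd (chart_functional y) $ \<tau>2 None) = snd y"
        by (rule vec_1_eqI) (use nz in \<open>simp add: chart_functional_def\<close>)
      moreover have "(\<chi> i. snd (chart_functional y) $ \<tau> (Some i) / snd (chart_functional y) $ \<tau> None) = snd (fst y)"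
        using nz \<tau> by (simp add: chart_functional_def vec_eq_iff)
      ultimately show ?thesis by (simp add: \<Psi>_def) (simp add: chart_functional_def)
    qed
    from derivative_left_inverse[OF N this Df D\<Psi> D0] show False using v by simp
  qed
  have "\<exists>q\<in>set (map (\<lambda>q z. q (chart_functional z)) qs). Dv q w v \<noteq> 0"
  proof -
    obtain q where q: "q \<in> set qs" "Dv q (chart_functional w) (Dv chart_functional w v) \<noteq> 0"
      using spec[OF bspec[OF imm cw], of "Dv chart_functional w v"] Dv0 by auto
    have "holo_on (x ` (B \<inter> U2) \<times> UNIV) q" using qs q(1) by (simp add: sos_rep_def)
    from has_derivative_compose[OF Df holo_on_has_derivative[OF this wimg]]
    have "Dv (\<lambda>z. q (chart_functional z)) w v = Dv q (chart_functional w) (Dv chart_functional w v)"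
      by (rule Dv_eqI)
    then show ?thesis using q by (auto intro!: bexI[of _ q])
  qed
  from levi_sqrt_sos_pos[OF chart_img_open rep w pos this]
  have "0 < Re (levi (\<lambda>y. sqrt (metric_sq (chart_functional y))) w v)" .
  moreover have "levi (dual_metric (O1 E) kk \<circ> inv_into dual_chart_dom dual_chart) w v
      = levi (\<lambda>y. sqrt (metric_sq (chart_functional y))) w v"
    by (rule levi_cong[OF chart_img_open w]) (simp add: dual_chart_inv dual_metric_param)
  ultimately show ?thesis by simp
qed

lemma zero_section_chart:
  assumes "p \<in> dual_chart_dom" "p \<notin> zero_section (dual (O1 E))"
  shows "dual_chart p \<in> chart_img" "snd (dual_chart p) $ 1 \<noteq> 0"
proof -
  obtain w where w: "w \<in> chart_img" "p = dual_param w" using dual_chart_dom_param assms(1) by blast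
  have cw: "dual_chart p = w" using dual_chart_param(2)[OF w(1)] w(2) by simp
  then show "dual_chart p \<in> chart_img" using w(1) by simp
  show "snd (dual_chart p) $ 1 \<noteq> 0"
  proof
    assume z: "snd (dual_chart p) $ 1 = 0"
    define s where "s = inv_into B x (fst (fst w))"
    have "s \<in> U" using inv_into_BU(1)[of "fst (fst w)"] w(1) by (simp add: s_def chart_img_def)
    then have s: "s \<in> pts (bbase E)" by (rule triv_pts[OF U])
    define e where "e = aff \<tau> (snd (fst w))"
    have "e $ \<tau>2 None \<noteq> 0" using w(1) by (simp add: chart_img_def e_def)
    then have \<eta>: "inverse (e $ \<tau>2 None) *\<^sub>C e \<noteq> 0" by (auto simp: vec_eq_iff)
    have "p = Fn s (inverse (e $ \<tau>2 None) *\<^sub>C e) 0"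
      using z cw unfolding w(2) dual_param_def by (simp add: s_def e_def)
    then show False using Fn_zero[OF s \<eta>] assms(2) by simp
  qed
qed

end

end

lemma dual_O1_atlas:
  assumes "(A, c) \<in> atlas (total_manifold (dual (O1 E)))"
  obtains B x U \<phi> \<tau> U2 \<phi>2 \<tau>2 where "(B, x) \<in> atlas (bbase E)" "(U, \<phi>) \<in> trivs E" "bij \<tau>"
    "(U2, \<phi>2) \<in> trivs E" "bij \<tau>2" "A = dual_chart_dom B U \<phi> \<tau> U2 \<phi>2 \<tau>2"
    "c = dual_chart x \<phi> \<tau> \<phi>2 \<tau>2"
proof -
  from assms obtain B' x' U' \<phi>' where B': "(B', x') \<in> atlas (PP E)" and U': "(U', \<phi>') \<in> trivs (dual (O1 E))"
    and A: "A = {v \<in> tot (dual (O1 E)). bproj (dual (O1 E)) v \<in> B' \<inter> U'}"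
    and c: "c = (\<lambda>v. (x' (bproj (dual (O1 E)) v), \<phi>' v))"
    unfolding atlas_total_manifold bbase_dual bbase_O1 by blast
  obtain B x U \<phi> \<tau> where 1: "(B, x) \<in> atlas (bbase E)" "(U, \<phi>) \<in> trivs E" "bij \<tau>"
    "B' = affine_domain E (B \<inter> U) \<phi> \<tau>" "x' = (\<lambda>P. (x (foot E P), affine_coord E \<phi> \<tau> P))"
    using B' unfolding atlas_PP by blast
  obtain \<psi> where \<psi>: "(U', \<psi>) \<in> trivs (O1 E)"
    "\<phi>' = (\<lambda>(s, f). \<chi> j. f (inv_into (car (fibre (O1 E) s)) \<psi> (axis j 1)))"
    using U' unfolding trivs_dual by blast
  obtain U2 \<phi>2 \<tau>2 where 2: "(U2, \<phi>2) \<in> trivs E" "bij \<tau>2" "U' = affine_domain E U2 \<phi>2 \<tau>2"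
    "\<psi> = O1_triv \<phi>2 \<tau>2"
    using \<psi>(1) unfolding trivs_O1 O1_triv_def by blast
  have proj: "bproj (dual (O1 E)) = fst" by (simp add: dual_def)
  show ?thesis
    by (rule that[OF 1(1-3) 2(1,2)])
      (auto simp: A c proj 1 2 \<psi>(2) dual_chart_dom_def dual_chart_def fun_eq_iff)
qed

lemma positively_curved_kk: "positively_curved (O1 E) kk"
  unfolding positively_curved_def negatively_curved_def
proof
  show "smooth (total_manifold (dual (O1 E))) (dual_metric (O1 E) kk)"
    unfolding smooth_def
  proof (intro ballI, clarify)
    fix A c k assume "(A, c) \<in> atlas (total_manifold (dual (O1 E)))"
    then obtain B x U \<phi> \<tau> U2 \<phi>2 \<tau>2 where *: "(B, x) \<in> atlas (bbase E)" "(U, \<phi>) \<in> trivs E" "bij \<tau>"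
      "(U2, \<phi>2) \<in> trivs E" "bij \<tau>2" and A: "A = dual_chart_dom B U \<phi> \<tau> U2 \<phi>2 \<tau>2"
      and c: "c = dual_chart x \<phi> \<tau> \<phi>2 \<tau>2" by (rule dual_O1_atlas)
    show "k_smooth_on k (c ` A) (dual_metric (O1 E) kk \<circ> inv_into A c)"
      unfolding A c dual_chart_image[OF *] by (rule chart_metric_smooth[OF *])
  qed
  show "strongly_psh (total_manifold (dual (O1 E))) (tot (dual (O1 E)) - zero_section (dual (O1 E)))
     (dual_metric (O1 E) kk)"
    unfolding strongly_psh_def
  proof (intro ballI, clarify)
    fix A c p and w :: "('m \<times> (complex^'q)) \<times> (complex^1)"
    assume "(A, c) \<in> atlas (total_manifold (dual (O1 E)))" and p: "p \<in> A" "p \<notin> zero_section (dual (O1 E))"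
      and w: "w \<noteq> 0"
    from this(1) obtain B x U \<phi> \<tau> U2 \<phi>2 \<tau>2 where *: "(B, x) \<in> atlas (bbase E)" "(U, \<phi>) \<in> trivs E" "bij \<tau>"
      "(U2, \<phi>2) \<in> trivs E" "bij \<tau>2" and A: "A = dual_chart_dom B U \<phi> \<tau> U2 \<phi>2 \<tau>2"
      and c: "c = dual_chart x \<phi> \<tau> \<phi>2 \<tau>2" by (rule dual_O1_atlas)
    show "0 < Re (levi (dual_metric (O1 E) kk \<circ> inv_into A c) (c p) w)"
      using chart_metric_levi[OF * zero_section_chart[OF *] w] p unfolding A c by simp
  qed
qed

end

section \<open>A family of Finsler metrics whose squares are sums of squares\<close>

lemma sos_cong: "sos U f \<Longrightarrow> (\<And>z. z \<in> U \<Longrightarrow> f z = h z) \<Longrightarrow> sos U h"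
  unfolding sos_def sos_rep_def by auto

lemma sos_rep_add:
  assumes "sos_rep U ps P" "sos_rep U qs Q" shows "sos_rep U (ps @ qs) (\<lambda>z. P z + Q z)"
  using assms by (auto simp: sos_rep_def)

lemma sos_rep_mult:
  assumes "sos_rep U ps P" "sos_rep U qs Q"
  shows "sos_rep U (concat (map (\<lambda>p. map (\<lambda>q z. p z * q z) qs) ps)) (\<lambda>z. P z * Q z)"
proof -
  have "(\<Sum>f\<leftarrow>concat (map (\<lambda>p. map (\<lambda>q z. p z * q z) qs) rs). (cmod (f z))\<^sup>2)
      = (\<Sum>p\<leftarrow>rs. (cmod (p z))\<^sup>2) * (\<Sum>q\<leftarrow>qs. (cmod (q z))\<^sup>2)" for rs z
    by (induction rs)
      (simp_all add: o_def norm_mult power_mult_distrib sum_list_const_mult distrib_right)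
  then show ?thesis using assms by (auto simp: sos_rep_def)
qed

lemma sos_add: "sos U f \<Longrightarrow> sos U h \<Longrightarrow> sos U (\<lambda>z. f z + h z)"
  unfolding sos_def using sos_rep_add by blast

lemma sos_mult: "sos U f \<Longrightarrow> sos U h \<Longrightarrow> sos U (\<lambda>z. f z * h z)"
  unfolding sos_def using sos_rep_mult by blast

lemma sos_cmod2: "holo_on U q \<Longrightarrow> sos U (\<lambda>z. (cmod (q z))\<^sup>2)"
  unfolding sos_def sos_rep_def by (rule exI[of _ "[q]"]) simp

lemma sos_const: "0 \<le> c \<Longrightarrow> sos U (\<lambda>z. c)"
  using sos_cmod2[OF holo_on_const, of U "of_real (sqrt c)"] by simp

lemma sos_power: "sos U f \<Longrightarrow> sos U (\<lambda>z. f z ^ n)"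
  by (induction n) (simp_all add: sos_const sos_mult)

lemma sos_sum: "(\<And>i. i \<in> I \<Longrightarrow> sos U (f i)) \<Longrightarrow> sos U (\<lambda>z. \<Sum>i\<in>I. f i z)"
  by (induction I rule: infinite_finite_induct) (simp_all add: sos_const sos_add)

lemmas sos_intros = sos_add sos_mult sos_power sos_const

text \<open>In the application $A=|e|^2$, $B=|b|^2$ and $R={\rm Re}(b\bar e)$, while $D$, $E$, $S$ are $|b-288e|^2$,
  $|b-e/2|^2$, $|b^2+e^2|^2$. The latter absorb all terms containing $R$, which has no sign.\<close>

lemma finsler_identity:
  fixes T V P A B R r S D E \<delta> :: real
  assumes D: "D = B + 82944 * A - 576 * R" and E: "E = B + A / 4 - R"
    and S: "S = A^2 + B^2 + 4 * R^2 - 2 * A * B"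
  shows "T^4 * (A + r)^2 + 32 * T^2 * (A + r) * (V^2 * B + P^2 * A / 64 - V * P * R / 4)
      + (V^2 * B + P^2 * A / 64 - V * P * R / 4)^2 - \<delta> * T^4 * (A + r + B)^2 =
    (1 / 64 * V^2 * P^2) * S + (1 / 1152 * V^3 * P) * (B * D) + (1 / 128 * V * P^3) * (A * E)
      + (8 * T^2 * V * P) * ((A + r) * E)
      + (V^4 - V^2 * P^2 / 64 - V^3 * P / 1152 - \<delta> * T^4) * B^2
      + (V^2 * P^2 / 16 - 72 * V^3 * P - V * P^3 / 128 + 32 * T^2 * V^2 - 8 * T^2 * V * P - 2 * \<delta> * T^4) * (A * B)
      + (P^4 / 4096 - V^2 * P^2 / 64 - V * P^3 / 512 + T^2 * P^2 / 2 - 2 * T^2 * V * P + T^4 - \<delta> * T^4) * A^2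
      + (32 * T^2 * V^2 - 8 * T^2 * V * P - 2 * \<delta> * T^4) * (r * B)
      + (T^2 * P^2 / 2 - 2 * T^2 * V * P + 2 * T^4 - 2 * \<delta> * T^4) * (r * A)
      + ((1 - \<delta>) * T^4) * r^2"
  unfolding D E S
  by (simp add: algebra_simps power2_eq_square power3_eq_cube power4_eq_xxxx
      add_divide_distrib diff_divide_distrib)

text \<open>The coefficients of the preceding identity are polynomials with nonnegative coefficients in
  $N = X^2+Y^2$, $P = XY$ and $M = X^4+Y^4$.\<close>

context
  fixes N P M T V :: real
  assumes M: "M = N^2 - 2 * P^2" and T: "T = N + 2 * P" and V: "V = N + P / 576"
begin

text \<open>V^2 and V^2 - V P / 1152 - P^2 / 64 both exceed T^2 / 2304 by polynomials with
  nonnegative coefficients, hence their product exceeds (T^2 / 2304)^2. This is what the summand P /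
  576 of V is for: in the second difference N P has the coefficient 2/576 - 1/1152 - 4/2304 =
  1/1152, which would be negative without it.\<close>

lemma coeff_BB:
  defines "p1 \<equiv> 2303 / 2304 * M + 1 / 576 * (N * P) + 1 * P^2 + (1 + 1 / 331776 - 6 / 2304) * P^2"
    and "p2 \<equiv> 2303 / 2304 * M + 1 / 1152 * (N * P) + 1 * P^2 + (1 + 1 / 663552 - 1 / 64 - 6 / 2304) * P^2"
  shows "V^4 - V^2 * P^2 / 64 - V^3 * P / 1152 - (1 / 2304)^2 * T^4
    = 1 / 2304 * T^2 * p2 + p1 * (1 / 2304 * T^2 + p2)"
proof -
  have 1: "V^2 = 1 / 2304 * T^2 + p1"
    unfolding p1_def M T V by (simp add: field_simps power2_eq_square)
  have 2: "V^2 - V * P / 1152 - P^2 / 64 = 1 / 2304 * T^2 + p2"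
    unfolding p2_def M T V by (simp add: field_simps power2_eq_square)
  have "V^4 - V^2 * P^2 / 64 - V^3 * P / 1152 - (1 / 2304)^2 * T^4
      = V^2 * (V^2 - V * P / 1152 - P^2 / 64) - (1 / 2304 * T^2) * (1 / 2304 * T^2)"
    by (simp add: algebra_simps power2_eq_square power3_eq_cube power4_eq_xxxx)
  also have "\<dots> = 1 / 2304 * T^2 * p2 + p1 * (1 / 2304 * T^2 + p2)"
    unfolding 1[symmetric] 2[symmetric] unfolding 2 by (simp add: 1 algebra_simps)
  finally show ?thesis .
qed

text \<open>The loss 72 V^3 P is the price of using D, as 82944 / 1152 = 72; the mixed term 32 T^2
  V^2 pays for it. After V is factored out, the rest exceeds T^3, while V exceeds T / 1152, so T^4 /
  1152 is available to cover the subtracted multiple of T^4.\<close>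

lemma coeff_AB:
  defines "h \<equiv> 31 * (N * M) + (42 + 32 / 576) * (M * P) + (146 + 1/16 - 16 / 576) * (N * P^2)
      + (44 + 192 / 576 - 72 / 331776 + 1 / 9216 - 1 / 128) * P^3"
  shows "V^2 * P^2 / 16 - 72 * V^3 * P - V * P^3 / 128 + 32 * T^2 * V^2 - 8 * T^2 * V * P - 2 * (1 / 2304)^2 * T^4
    = (1 / 1152 - 2 * (1 / 2304)^2) * T^4 + 1 / 1152 * T * h + 1151 / 1152 * N * (T^3 + h)"
proof -
  have 1: "32 * T^2 * V - 72 * V^2 * P + V * P^2 / 16 - P^3 / 128 - 8 * T^2 * P = T^3 + h"
    unfolding h_def M T V by (simp add: field_simps power2_eq_square power3_eq_cube)
  have 2: "V = 1 / 1152 * T + 1151 / 1152 * N"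
    unfolding V T by (simp add: field_simps)
  have "V^2 * P^2 / 16 - 72 * V^3 * P - V * P^3 / 128 + 32 * T^2 * V^2 - 8 * T^2 * V * P - 2 * (1 / 2304)^2 * T^4
      = V * (32 * T^2 * V - 72 * V^2 * P + V * P^2 / 16 - P^3 / 128 - 8 * T^2 * P) - 2 * (1 / 2304)^2 * T^4"
    by (simp add: algebra_simps power2_eq_square power3_eq_cube power4_eq_xxxx)
  also have "\<dots> = (1 / 1152 * T + 1151 / 1152 * N) * (T^3 + h) - 2 * (1 / 2304)^2 * T^4"
    unfolding 1 unfolding 2 ..
  also have "\<dots> = (1 / 1152 - 2 * (1 / 2304)^2) * T^4 + 1 / 1152 * T * h + 1151 / 1152 * N * (T^3 + h)"
    by (simp add: algebra_simps power3_eq_cube power4_eq_xxxx)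
  finally show ?thesis .
qed

lemma coeff_AA:
  "P^4 / 4096 - V^2 * P^2 / 64 - V * P^3 / 512 + T^2 * P^2 / 2 - 2 * T^2 * V * P + T^4 - (1 / 2304)^2 * T^4
    = T^2 * ((1 - (1 / 2304)^2) * M + (2 - 4 * (1 / 2304)^2) * (N * P)
        + (6 - 6 * (1 / 2304)^2 - 2 / 576 + 1 / 2 - 1 / 64 - 1 / 512) * P^2)
      + 1 / 4096 * P^4 + 1 / 64 * P^2 * ((4 - 2 / 576) * (N * P) + (4 - 1 / 331776) * P^2)
      + 1 / 512 * P^2 * (M + 3 * (N * P) + (6 - 1 / 576) * P^2)"
proof -
  have 1: "T^2 - V^2 = (4 - 2 / 576) * (N * P) + (4 - 1 / 331776) * P^2"
    and 2: "T^2 - V * P = M + 3 * (N * P) + (6 - 1 / 576) * P^2"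
    and 3: "(1 - (1 / 2304)^2) * T^2 - 2 * V * P + P^2 * (1 / 2 - 1 / 64 - 1 / 512)
      = (1 - (1 / 2304)^2) * M + (2 - 4 * (1 / 2304)^2) * (N * P)
        + (6 - 6 * (1 / 2304)^2 - 2 / 576 + 1 / 2 - 1 / 64 - 1 / 512) * P^2"
    unfolding M T V by (simp_all add: field_simps power2_eq_square)
  show ?thesis
    unfolding 1[symmetric] 2[symmetric] 3[symmetric]
    by (simp add: algebra_simps power2_eq_square power3_eq_cube power4_eq_xxxx
        add_divide_distrib diff_divide_distrib)
qed

lemma coeff_rB:
  defines "h \<equiv> 31 * (N * M) + (114 + 32 / 576) * (M * P) + (146 + 128 / 576) * (N * P^2)
      + (188 + 192 / 576) * P^3"
  shows "32 * T^2 * V^2 - 8 * T^2 * V * P - 2 * (1 / 2304)^2 * T^4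
    = (1 / 1152 - 2 * (1 / 2304)^2) * T^4 + 1 / 1152 * T * h + 1151 / 1152 * N * (T^3 + h)"
proof -
  have 1: "32 * T^2 * V - 8 * T^2 * P = T^3 + h"
    unfolding h_def M T V by (simp add: field_simps power2_eq_square power3_eq_cube)
  have 2: "V = 1 / 1152 * T + 1151 / 1152 * N"
    unfolding V T by (simp add: field_simps)
  have "32 * T^2 * V^2 - 8 * T^2 * V * P - 2 * (1 / 2304)^2 * T^4
      = V * (32 * T^2 * V - 8 * T^2 * P) - 2 * (1 / 2304)^2 * T^4"
    by (simp add: algebra_simps power2_eq_square)
  also have "\<dots> = (1 / 1152 * T + 1151 / 1152 * N) * (T^3 + h) - 2 * (1 / 2304)^2 * T^4"
    unfolding 1 unfolding 2 ..
  also have "\<dots> = (1 / 1152 - 2 * (1 / 2304)^2) * T^4 + 1 / 1152 * T * h + 1151 / 1152 * N * (T^3 + h)"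
    by (simp add: algebra_simps power3_eq_cube power4_eq_xxxx)
  finally show ?thesis .
qed

lemma coeff_rA:
  "T^2 * P^2 / 2 - 2 * T^2 * V * P + 2 * T^4 - 2 * (1 / 2304)^2 * T^4
    = T^2 * ((2 - 2 * (1 / 2304)^2) * M + (6 - 8 * (1 / 2304)^2) * (N * P)
        + (12 - 12 * (1 / 2304)^2 - 2 / 576 + 1 / 2) * P^2)"
proof -
  have 1: "(2 - 2 * (1 / 2304)^2) * T^2 - 2 * V * P + P^2 / 2
      = (2 - 2 * (1 / 2304)^2) * M + (6 - 8 * (1 / 2304)^2) * (N * P)
        + (12 - 12 * (1 / 2304)^2 - 2 / 576 + 1 / 2) * P^2"
    unfolding M T V by (simp add: field_simps power2_eq_square)
  show ?thesis
    unfolding 1[symmetric] by (simp add: algebra_simps power2_eq_square power4_eq_xxxx)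
qed

end

text \<open>Here b and e stand for the components \<beta> and \<alpha> of \<eta>, and r for the
  squared length of the others. The expression is K_0^2 of the twisted functional, without the
  products among components other than \<beta>, minus a small multiple of (X + Y)^8 |\<eta>|^4. The
  shifts in D and E are chosen so that each term containing R is cancelled by one product.\<close>

lemma sos_two_variables:
  fixes e b :: "'a::complex_normed \<Rightarrow> complex" and X Y r :: "'a \<Rightarrow> real"
  assumes X: "sos U X" and Y: "sos U Y" and r: "sos U r" and e: "holo_on U e" and b: "holo_on U b"
  shows "sos U (\<lambda>z. ((X z + Y z)^2)^4 * ((cmod (e z))^2 + r z)^2
      + 32 * ((X z + Y z)^2)^2 * ((cmod (e z))^2 + r z) *
        (cmod (of_real (X z^2 + Y z^2 + X z * Y z / 576) * b z - of_real (X z * Y z / 8) * e z))^2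
      + ((cmod (of_real (X z^2 + Y z^2 + X z * Y z / 576) * b z - of_real (X z * Y z / 8) * e z))^2)^2
      - (1 / 2304)^2 * ((X z + Y z)^2)^4 * ((cmod (e z))^2 + r z + (cmod (b z))^2)^2)"
proof -
  define N where "N = (\<lambda>z. X z^2 + Y z^2)"
  define P where "P = (\<lambda>z. X z * Y z)"
  define M where "M = (\<lambda>z. X z^4 + Y z^4)"
  define T where "T = (\<lambda>z. (X z + Y z)^2)"
  define V where "V = (\<lambda>z. N z + 1 / 576 * P z)"
  define A where "A = (\<lambda>z. (cmod (e z))^2)"
  define B where "B = (\<lambda>z. (cmod (b z))^2)"
  define R where "R = (\<lambda>z. Re (b z * cnj (e z)))"
  define D where "D = (\<lambda>z. (cmod (b z - 288 * e z))^2)"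
  define E where "E = (\<lambda>z. (cmod (b z - 1 / 2 * e z))^2)"
  define S where "S = (\<lambda>z. (cmod (b z ^ 2 + e z ^ 2))^2)"
  have sos: "sos U N" "sos U P" "sos U M" "sos U T" "sos U V" "sos U A" "sos U B" "sos U D" "sos U E" "sos U S"
  proof -
    show N: "sos U N" and P: "sos U P" and "sos U M" "sos U T"
      unfolding N_def P_def M_def T_def by (intro sos_intros X Y)+
    show "sos U V" unfolding V_def by (intro sos_intros N P) simp
    show "sos U A" "sos U B" unfolding A_def B_def by (intro sos_cmod2 e b)+
    show "sos U D" "sos U E" "sos U S" unfolding D_def E_def S_def
      by (intro sos_cmod2 holo_on_diff holo_on_add holo_on_mult holo_on_power holo_on_const e b)+
  qed
  have rel: "M z = N z^2 - 2 * P z^2" "T z = N z + 2 * P z" "V z = N z + P z / 576"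
    "D z = B z + 82944 * A z - 576 * R z" "E z = B z + A z / 4 - R z"
    "S z = A z^2 + B z^2 + 4 * R z^2 - 2 * A z * B z"
    "(cmod (of_real (V z) * b z - of_real (P z / 8) * e z))^2 = V z^2 * B z + P z^2 * A z / 64 - V z * P z * R z / 4"
    for z
    unfolding M_def N_def P_def T_def V_def A_def B_def R_def D_def E_def S_def cmod_power2
    by (simp_all add: algebra_simps power2_eq_square power4_eq_xxxx add_divide_distrib diff_divide_distrib)
  have "sos U (\<lambda>z. (1 / 64 * V z^2 * P z^2) * S z + (1 / 1152 * V z^3 * P z) * (B z * D z)
      + (1 / 128 * V z * P z^3) * (A z * E z) + (8 * T z^2 * V z * P z) * ((A z + r z) * E z)
      + (1 / 2304 * T z^2 * (2303 / 2304 * M z + 1 / 1152 * (N z * P z) + 1 * P z^2 + (1 + 1 / 663552 - 1 / 64 - 6 / 2304) * P z^2)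
        + (2303 / 2304 * M z + 1 / 576 * (N z * P z) + 1 * P z^2 + (1 + 1 / 331776 - 6 / 2304) * P z^2)
        * (1 / 2304 * T z^2 + (2303 / 2304 * M z + 1 / 1152 * (N z * P z) + 1 * P z^2 + (1 + 1 / 663552 - 1 / 64 - 6 / 2304) * P z^2))) * B z^2
      + ((1 / 1152 - 2 * (1 / 2304)^2) * T z^4 + 1 / 1152 * T z * (31 * (N z * M z) + (42 + 32 / 576) * (M z * P z)
          + (146 + 1/16 - 16 / 576) * (N z * P z^2) + (44 + 192 / 576 - 72 / 331776 + 1 / 9216 - 1 / 128) * P z^3)
        + 1151 / 1152 * N z * (T z^3 + (31 * (N z * M z) + (42 + 32 / 576) * (M z * P z)
          + (146 + 1/16 - 16 / 576) * (N z * P z^2) + (44 + 192 / 576 - 72 / 331776 + 1 / 9216 - 1 / 128) * P z^3))) * (A z * B z)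
      + (T z^2 * ((1 - (1 / 2304)^2) * M z + (2 - 4 * (1 / 2304)^2) * (N z * P z)
          + (6 - 6 * (1 / 2304)^2 - 2 / 576 + 1 / 2 - 1 / 64 - 1 / 512) * P z^2)
        + 1 / 4096 * P z^4 + 1 / 64 * P z^2 * ((4 - 2 / 576) * (N z * P z) + (4 - 1 / 331776) * P z^2)
        + 1 / 512 * P z^2 * (M z + 3 * (N z * P z) + (6 - 1 / 576) * P z^2)) * A z^2
      + ((1 / 1152 - 2 * (1 / 2304)^2) * T z^4 + 1 / 1152 * T z * (31 * (N z * M z) + (114 + 32 / 576) * (M z * P z)
          + (146 + 128 / 576) * (N z * P z^2) + (188 + 192 / 576) * P z^3)
        + 1151 / 1152 * N z * (T z^3 + (31 * (N z * M z) + (114 + 32 / 576) * (M z * P z)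
          + (146 + 128 / 576) * (N z * P z^2) + (188 + 192 / 576) * P z^3))) * (r z * B z)
      + (T z^2 * ((2 - 2 * (1 / 2304)^2) * M z + (6 - 8 * (1 / 2304)^2) * (N z * P z)
          + (12 - 12 * (1 / 2304)^2 - 2 / 576 + 1 / 2) * P z^2)) * (r z * A z)
      + ((1 - (1 / 2304)^2) * T z^4) * r z^2)"
    by (intro sos_intros sos r) (simp_all add: power2_eq_square)
  then have "sos U (\<lambda>z. T z^4 * (A z + r z)^2 + 32 * T z^2 * (A z + r z) * (V z^2 * B z + P z^2 * A z / 64 - V z * P z * R z / 4)
      + (V z^2 * B z + P z^2 * A z / 64 - V z * P z * R z / 4)^2 - (1 / 2304)^2 * T z^4 * (A z + r z + B z)^2)"
    unfolding finsler_identity[OF rel(4-6)] coeff_BB[OF rel(1-3)] coeff_AB[OF rel(1-3)]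
      coeff_AA[OF rel(1-3)] coeff_rB[OF rel(1-3)] coeff_rA[OF rel(1-3)] .
  then show ?thesis
    unfolding rel(7)[symmetric] by (simp only: T_def A_def B_def V_def N_def P_def mult_1 times_divide_eq_left)
qed

section \<open>The invariant Finsler norm and its twist\<close>

definition sqn :: "complex^'r::finite \<Rightarrow> real" where
  "sqn y = (\<Sum>i\<in>UNIV. (cmod (y $ i))\<^sup>2)"

text \<open>Equivalently, K_0^2 is the sum of all |y_i|^4 and of 16 |y_i|^2 |y_j|^2 over ordered
  pairs i \<noteq> j, a sum of squared moduli of monomials that is symmetric in the |y_i|^2.\<close>

definition K0 :: "complex^'r::finite \<Rightarrow> real" where
  "K0 y = sqrt (16 * (sqn y)\<^sup>2 - 15 * (\<Sum>i\<in>UNIV. (cmod (y $ i)) ^ 4))"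

lemma sum_square_split:
  fixes f :: "'i \<Rightarrow> real"
  assumes "finite J"
  shows "(\<Sum>i\<in>J. f i)\<^sup>2 = (\<Sum>i\<in>J. (f i)\<^sup>2) + (\<Sum>i\<in>J. \<Sum>j\<in>J - {i}. f i * f j)"
proof -
  have "(\<Sum>i\<in>J. f i)\<^sup>2 = (\<Sum>i\<in>J. \<Sum>j\<in>J. f i * f j)"
    by (simp add: power2_eq_square sum_product)
  also have "\<dots> = (\<Sum>i\<in>J. (f i)\<^sup>2 + (\<Sum>j\<in>J - {i}. f i * f j))"
    by (rule sum.cong[OF refl]) (simp add: sum.remove[OF assms] power2_eq_square)
  finally show ?thesis by (simp add: sum.distrib)
qed

lemma sqn_nonneg: "0 \<le> sqn y"
  by (simp add: sqn_def sum_nonneg)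

lemma sqn_scale: "sqn (c *\<^sub>C y) = (cmod c)\<^sup>2 * sqn y"
  by (simp add: sqn_def norm_mult power_mult_distrib sum_distrib_left)

lemma sqn_pos: "y \<noteq> 0 \<Longrightarrow> 0 < sqn y"
proof -
  assume "y \<noteq> 0"
  then obtain i where "y $ i \<noteq> 0" by (auto simp: vec_eq_iff)
  then show ?thesis unfolding sqn_def by (intro sum_pos2[of UNIV i]) auto
qed

lemma sum_fourth_le: "(\<Sum>i\<in>UNIV. (cmod (y $ i)) ^ 4) \<le> (sqn y)\<^sup>2"
proof -
  have "0 \<le> (\<Sum>i\<in>UNIV. \<Sum>j\<in>UNIV - {i}. (cmod (y $ i))\<^sup>2 * (cmod (y $ j))\<^sup>2)"
    by (intro sum_nonneg) auto
  then show ?thesis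
    unfolding sqn_def sum_square_split[OF finite, of "\<lambda>i. (cmod (y $ i))\<^sup>2"] by (simp flip: power_mult)
qed

lemma K0_sq: "(K0 y)\<^sup>2 = 16 * (sqn y)\<^sup>2 - 15 * (\<Sum>i\<in>UNIV. (cmod (y $ i)) ^ 4)"
proof -
  have "0 \<le> 16 * (sqn y)\<^sup>2 - 15 * (\<Sum>i\<in>UNIV. (cmod (y $ i)) ^ 4)"
    using sum_fourth_le[of y] zero_le_power2[of "sqn y"] by linarith
  then show ?thesis by (simp add: K0_def)
qed

lemma K0_scale: "K0 (c *\<^sub>C y) = (cmod c)\<^sup>2 * K0 y"
proof -
  have "16 * (sqn (c *\<^sub>C y))\<^sup>2 - 15 * (\<Sum>i\<in>UNIV. (cmod ((c *\<^sub>C y) $ i)) ^ 4)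
      = ((cmod c)\<^sup>2)\<^sup>2 * (16 * (sqn y)\<^sup>2 - 15 * (\<Sum>i\<in>UNIV. (cmod (y $ i)) ^ 4))"
    by (simp add: sqn_scale norm_mult power_mult_distrib sum_distrib_left[symmetric] algebra_simps)
  then show ?thesis unfolding K0_def by (simp only: real_sqrt_mult real_sqrt_abs) simp
qed

lemma K0_pos: "y \<noteq> 0 \<Longrightarrow> 0 < K0 y"
proof -
  assume "y \<noteq> 0"
  then have "0 < (sqn y)\<^sup>2" using sqn_pos[of y] by simp
  then show ?thesis
    using sum_fourth_le[of y] unfolding K0_def real_sqrt_gt_0_iff by linarith
qed

lemma K0_signed_permutation:
  assumes "bij \<pi>" "\<And>i. cmod (u i) = 1"
  shows "K0 (\<chi> i. u i * y $ \<pi> i) = K0 y"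
proof -
  have "sum (\<lambda>i. (cmod (y $ \<pi> i)) ^ n) UNIV = sum (\<lambda>i. (cmod (y $ i)) ^ n) UNIV" for n
    by (rule sum.reindex_bij_betw[of \<pi> UNIV UNIV "\<lambda>i. (cmod (y $ i)) ^ n"]) (rule assms(1))
  then show ?thesis by (simp add: K0_def sqn_def norm_mult assms(2))
qed

text \<open>The substitution $\eta\mapsto A\eta$ with $A = A(X,Y)$ depending on the squared lengths $X$, $Y$;
  \<open>cotwist\<close> is the inverse of the transpose.\<close>

definition twist :: "'r \<Rightarrow> 'r \<Rightarrow> real \<Rightarrow> real \<Rightarrow> complex^'r::finite \<Rightarrow> complex^'r" where
  "twist \<alpha> \<beta> X Y \<eta> = (\<chi> i. if i = \<beta>
     then of_real (X^2 + Y^2 + X * Y / 576) * \<eta> $ \<beta> - of_real (X * Y / 8) * \<eta> $ \<alpha>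
     else of_real ((X + Y)^2) * \<eta> $ i)"

definition cotwist :: "'r \<Rightarrow> 'r \<Rightarrow> real \<Rightarrow> real \<Rightarrow> complex^'r::finite \<Rightarrow> complex^'r" where
  "cotwist \<alpha> \<beta> X Y v = (\<chi> i. if i = \<beta> then v $ \<beta> / of_real (X^2 + Y^2 + X * Y / 576)
     else if i = \<alpha> then (v $ \<alpha> + of_real (X * Y / 8) * (v $ \<beta> / of_real (X^2 + Y^2 + X * Y / 576))) / of_real ((X + Y)^2)
     else v $ i / of_real ((X + Y)^2))"

lemma twist_scale: "twist \<alpha> \<beta> X Y (c *\<^sub>C \<eta>) = c *\<^sub>C twist \<alpha> \<beta> X Y \<eta>"
  by (simp add: twist_def vec_eq_iff algebra_simps)

lemma twist_1_0 [simp]: "twist \<alpha> \<beta> 1 0 \<eta> = \<eta>"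
  by (simp add: twist_def vec_eq_iff)

lemma twist_homogeneous: "twist \<alpha> \<beta> (c * X) (c * Y) \<eta> = of_real (c\<^sup>2) *\<^sub>C twist \<alpha> \<beta> X Y \<eta>"
proof -
  have "(c * X)^2 + (c * Y)^2 + (c * X) * (c * Y) / 576 = c^2 * (X^2 + Y^2 + X * Y / 576)"
    "(c * X) * (c * Y) / 8 = c^2 * (X * Y / 8)" "(c * X + c * Y)^2 = c^2 * (X + Y)^2"
    by (simp_all add: algebra_simps power2_eq_square add_divide_distrib)
  then show ?thesis unfolding twist_def by (simp only: of_real_mult) (simp add: vec_eq_iff algebra_simps)
qed

lemma twist_factors:
  fixes X Y :: real
  assumes "0 \<le> X" "0 \<le> Y" "0 < X + Y"
  shows "0 < X^2 + Y^2 + X * Y / 576" "0 < (X + Y)^2"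
proof -
  have "0 < X \<or> 0 < Y" using assms by linarith
  then have "0 < X^2 \<or> 0 < Y^2" by auto
  moreover have "0 \<le> X * Y / 576" "0 \<le> X^2" "0 \<le> Y^2" using assms by auto
  ultimately show "0 < X^2 + Y^2 + X * Y / 576" by linarith
  show "0 < (X + Y)^2" using assms(3) by simp
qed

lemma sum_remove2:
  fixes f :: "'r::finite \<Rightarrow> 'a::comm_monoid_add"
  assumes "\<alpha> \<noteq> \<beta>" shows "(\<Sum>i\<in>UNIV. f i) = f \<beta> + (f \<alpha> + (\<Sum>i\<in>UNIV - {\<beta>} - {\<alpha>}. f i))"
  using assms by (subst sum.remove[of UNIV \<beta>]; simp; subst sum.remove[of "UNIV - {\<beta>}" \<alpha>]; simp)

lemma bil_twist_cotwist:
  assumes "\<alpha> \<noteq> \<beta>" "0 \<le> X" "0 \<le> Y" "0 < X + Y"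
  shows "bil (twist \<alpha> \<beta> X Y \<eta>) (cotwist \<alpha> \<beta> X Y v) = bil \<eta> v"
proof -
  define V where "V = complex_of_real (X^2 + Y^2 + X * Y / 576)"
  define T where "T = complex_of_real ((X + Y)^2)"
  define p where "p = complex_of_real (X * Y / 8)"
  have VT: "V \<noteq> 0" "T \<noteq> 0"
    using twist_factors[OF assms(2-4)] unfolding V_def T_def of_real_eq_0_iff by (metis less_irrefl)+
  have "bil (twist \<alpha> \<beta> X Y \<eta>) (cotwist \<alpha> \<beta> X Y v)
      = (V * \<eta> $ \<beta> - p * \<eta> $ \<alpha>) * (v $ \<beta> / V) + ((T * \<eta> $ \<alpha>) * ((v $ \<alpha> + p * (v $ \<beta> / V)) / T)
        + (\<Sum>i\<in>UNIV - {\<beta>} - {\<alpha>}. (T * \<eta> $ i) * (v $ i / T)))"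
    unfolding bil_def sum_remove2[OF assms(1)] twist_def cotwist_def V_def[symmetric] T_def[symmetric] p_def[symmetric]
    using assms(1) by (auto intro!: sum.cong)
  also have "\<dots> = \<eta> $ \<beta> * v $ \<beta> + (\<eta> $ \<alpha> * v $ \<alpha> + (\<Sum>i\<in>UNIV - {\<beta>} - {\<alpha>}. \<eta> $ i * v $ i))"
    using VT by (simp add: algebra_simps add_divide_distrib)
  also have "\<dots> = bil \<eta> v" unfolding bil_def sum_remove2[OF assms(1)] ..
  finally show ?thesis .
qed

lemma twist_nonzero:
  assumes "\<alpha> \<noteq> \<beta>" "0 \<le> X" "0 \<le> Y" "0 < X + Y" "\<eta> \<noteq> 0" shows "twist \<alpha> \<beta> X Y \<eta> \<noteq> 0"
proof
  assume "twist \<alpha> \<beta> X Y \<eta> = 0"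
  then have "bil \<eta> v = 0" for v
    using bil_twist_cotwist[OF assms(1-4), of \<eta> v] by (simp add: bil_def)
  moreover obtain w where "bil \<eta> w = 1" using bil_surj[OF assms(5)] .
  ultimately show False by simp
qed

text \<open>The component \<beta>, the one that the twist mixes with another, is separated from the
  rest, on which the twist is multiplication by T. The last sum is what (\<Sum> |\<eta>_i|^2)^2 has
  beyond \<Sum> |\<eta>_i|^4; it is a sum of squares of its own and is set aside.\<close>

lemma K0_twist_sq:
  fixes \<eta> :: "complex^'r::finite" and X Y :: real
  assumes "\<alpha> \<noteq> \<beta>"
  defines "r \<equiv> (\<Sum>i\<in>UNIV - {\<beta>} - {\<alpha>}. (cmod (\<eta> $ i))\<^sup>2)"
    and "v \<equiv> (cmod (of_real (X^2 + Y^2 + X * Y / 576) * \<eta> $ \<beta> - of_real (X * Y / 8) * \<eta> $ \<alpha>))^2"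
    and "T \<equiv> (X + Y)^2"
  shows "(K0 (twist \<alpha> \<beta> X Y \<eta>))\<^sup>2
    = T^4 * ((cmod (\<eta> $ \<alpha>))^2 + r)^2 + 32 * T^2 * ((cmod (\<eta> $ \<alpha>))^2 + r) * v + v^2
      + 15 * (T^4 * (\<Sum>i\<in>UNIV - {\<beta>}. \<Sum>j\<in>UNIV - {\<beta>} - {i}. (cmod (\<eta> $ i))\<^sup>2 * (cmod (\<eta> $ j))\<^sup>2))"
proof -
  define \<rho> where "\<rho> = (cmod (\<eta> $ \<alpha>))^2 + r"
  define \<sigma> where "\<sigma> = (\<Sum>i\<in>UNIV - {\<beta>}. \<Sum>j\<in>UNIV - {\<beta>} - {i}. (cmod (\<eta> $ i))\<^sup>2 * (cmod (\<eta> $ j))\<^sup>2)"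
  have \<rho>: "\<rho> = (\<Sum>i\<in>UNIV - {\<beta>}. (cmod (\<eta> $ i))\<^sup>2)"
    using assms(1) by (simp add: \<rho>_def r_def sum.remove[of "UNIV - {\<beta>}" \<alpha>])
  have \<rho>2: "\<rho>^2 = (\<Sum>i\<in>UNIV - {\<beta>}. (cmod (\<eta> $ i)) ^ 4) + \<sigma>"
    unfolding \<rho> \<sigma>_def using sum_square_split[of "UNIV - {\<beta>}" "\<lambda>i. (cmod (\<eta> $ i))\<^sup>2"] by (simp flip: power_mult)
  have cT: "cmod (of_real T * c) = T * cmod c" for c
    unfolding norm_mult norm_of_real by (simp add: T_def)
  have 1: "sqn (twist \<alpha> \<beta> X Y \<eta>) = v + T^2 * \<rho>"
    unfolding sqn_def sum.remove[of UNIV \<beta>, OF finite UNIV_I] \<rho>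
    by (simp add: twist_def T_def[symmetric] cT power_mult_distrib sum_distrib_left v_def del: of_real_power)
  have 2: "(\<Sum>i\<in>UNIV. (cmod (twist \<alpha> \<beta> X Y \<eta> $ i)) ^ 4) = v^2 + T^4 * (\<rho>^2 - \<sigma>)"
    unfolding sum.remove[of UNIV \<beta>, OF finite UNIV_I] \<rho>2
    by (simp add: twist_def T_def[symmetric] cT power_mult_distrib sum_distrib_left v_def
        power_mult[symmetric] del: of_real_power)
  show ?thesis
    unfolding K0_sq 1 2 \<rho>_def[symmetric] \<sigma>_def[symmetric]
    by (simp add: algebra_simps power2_eq_square power4_eq_xxxx)
qed

text \<open>The subtracted multiple of (X + Y)^8 |\<eta>|^4 is the margin from which the immersive
  summands are later taken; the power 8 arises as T^4.\<close>

lemma sos_twist: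
  fixes \<eta> :: "'a::complex_normed \<Rightarrow> complex^'r::finite"
  assumes "\<alpha> \<noteq> \<beta>" and X: "sos U X" and Y: "sos U Y" and \<eta>: "holo_on U \<eta>"
  shows "sos U (\<lambda>z. (K0 (twist \<alpha> \<beta> (X z) (Y z) (\<eta> z)))\<^sup>2 - (1 / 2304)^2 * (X z + Y z)^8 * (sqn (\<eta> z))\<^sup>2)"
proof -
  define r where "r = (\<lambda>z. \<Sum>i\<in>UNIV - {\<beta>} - {\<alpha>}. (cmod (\<eta> z $ i))\<^sup>2)"
  define \<sigma> where "\<sigma> = (\<lambda>z. \<Sum>i\<in>UNIV - {\<beta>}. \<Sum>j\<in>UNIV - {\<beta>} - {i}. (cmod (\<eta> z $ i))\<^sup>2 * (cmod (\<eta> z $ j))\<^sup>2)"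
  have n: "sos U (\<lambda>z. (cmod (\<eta> z $ i))\<^sup>2)" for i by (intro sos_cmod2 holo_on_nth \<eta>)
  have "sos U r" unfolding r_def by (intro sos_sum n)
  from sos_two_variables[OF X Y this holo_on_nth[OF \<eta>, of \<alpha>] holo_on_nth[OF \<eta>, of \<beta>]]
  have "sos U (\<lambda>z. (K0 (twist \<alpha> \<beta> (X z) (Y z) (\<eta> z)))\<^sup>2 - 15 * (((X z + Y z)^2)^4 * \<sigma> z)
      - (1 / 2304)^2 * ((X z + Y z)^2)^4 * ((cmod (\<eta> z $ \<alpha>))^2 + r z + (cmod (\<eta> z $ \<beta>))^2)^2)"
    by (rule sos_cong) (simp add: K0_twist_sq[OF assms(1)] r_def \<sigma>_def)
  moreover have "sos U (\<lambda>z. 15 * (((X z + Y z)^2)^4 * \<sigma> z))"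
    unfolding \<sigma>_def by (intro sos_intros X Y sos_sum n) simp
  ultimately show ?thesis
  proof (rule sos_cong[OF sos_add])
    fix z
    have "sqn (\<eta> z) = (cmod (\<eta> z $ \<alpha>))^2 + r z + (cmod (\<eta> z $ \<beta>))^2"
      unfolding sqn_def sum_remove2[OF assms(1)] r_def by simp
    then show "(K0 (twist \<alpha> \<beta> (X z) (Y z) (\<eta> z)))\<^sup>2 - 15 * (((X z + Y z)^2)^4 * \<sigma> z)
      - (1 / 2304)^2 * ((X z + Y z)^2)^4 * ((cmod (\<eta> z $ \<alpha>))^2 + r z + (cmod (\<eta> z $ \<beta>))^2)^2
      + 15 * (((X z + Y z)^2)^4 * \<sigma> z)
      = (K0 (twist \<alpha> \<beta> (X z) (Y z) (\<eta> z)))\<^sup>2 - (1 / 2304)^2 * (X z + Y z)^8 * (sqn (\<eta> z))\<^sup>2"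
      by (simp flip: power_mult)
  qed
qed

text \<open>This substitutes for monotonicity of powers: sums of squares only form a semiring, so
  each difference has to be exhibited as one. The induction uses f^(n+1) - h^(n+1) = f (f^n - h^n) +
  (f - h) h^n.\<close>

lemma sos_power_diff:
  assumes "sos U f" "sos U h" "sos U (\<lambda>z. f z - h z)" shows "sos U (\<lambda>z. f z ^ n - h z ^ n)"
proof (induction n)
  case (Suc n)
  have "sos U (\<lambda>z. f z * (f z ^ n - h z ^ n) + (f z - h z) * h z ^ n)"
    by (intro sos_intros assms Suc)
  then show ?case by (rule sos_cong) (simp add: algebra_simps)
qed (simp add: sos_const)

definition xlen :: "'i \<Rightarrow> complex^'i::finite \<Rightarrow> real" where
  "xlen k \<xi> = (cmod (\<xi> $ k))\<^sup>2"

text \<open>For a_k = 1 this is the squared length of \<xi> - \<xi>_k a. So \<open>xlen\<close> and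
  \<open>ylen\<close> measure \<xi> along and across the line of a, and the second vanishes exactly
  on that line.\<close>

definition ylen :: "'i \<Rightarrow> complex^'i \<Rightarrow> complex^'i::finite \<Rightarrow> real" where
  "ylen k a \<xi> = (\<Sum>i\<in>UNIV - {k}. (cmod (\<xi> $ i - a $ i * \<xi> $ k))\<^sup>2)"

text \<open>The parallelogram identity |x|^2 + |x - 2y|^2 = 2 |x - y|^2 + 2 |y|^2 with x = \<xi>_i
  and y = a_i \<xi>_k, summed over i \<noteq> k. It sharpens the inequality C |\<xi>|^2 \<le> X + Y
  to an identity whose remainder is a sum of squares; the constant is 1 / (2 + 2 \<Sum> |a_i|^2),
  the sum again over i \<noteq> k.\<close>

lemma sos_length_bound:
  assumes "holo_on U \<xi>"
  obtains C where "0 < C" "sos U (\<lambda>z. xlen k (\<xi> z) + ylen k a (\<xi> z) - C * sqn (\<xi> z))"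
proof -
  define s where "s = (\<Sum>i\<in>UNIV - {k}. (cmod (a $ i))\<^sup>2)"
  have s: "0 \<le> s" by (simp add: s_def sum_nonneg)
  have X: "sos U (\<lambda>z. xlen k (\<xi> z))" and Y: "sos U (\<lambda>z. ylen k a (\<xi> z))"
    unfolding xlen_def ylen_def
    by (intro sos_sum sos_cmod2 holo_on_diff holo_on_mult holo_on_const holo_on_nth assms)+
  let ?R = "\<lambda>z. \<Sum>i\<in>UNIV - {k}. (cmod (\<xi> z $ i - a $ i * \<xi> z $ k - a $ i * \<xi> z $ k))\<^sup>2"
  have R: "sos U ?R"
    by (intro sos_sum sos_cmod2 holo_on_diff holo_on_mult holo_on_const holo_on_nth assms)
  have eq: "sqn (\<xi> z) + ?R z = (1 + 2 * s) * xlen k (\<xi> z) + 2 * ylen k a (\<xi> z)" for z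
  proof -
    have "(cmod x)\<^sup>2 + (cmod (x - y - y))\<^sup>2 = 2 * (cmod (x - y))\<^sup>2 + 2 * (cmod y)\<^sup>2" for x y :: complex
      unfolding cmod_power2 by (simp add: power2_eq_square algebra_simps)
    from this[of "\<xi> z $ i" "a $ i * \<xi> z $ k" for i]
    have "(\<Sum>i\<in>UNIV - {k}. (cmod (\<xi> z $ i))\<^sup>2) + ?R z = 2 * ylen k a (\<xi> z) + 2 * s * xlen k (\<xi> z)"
      by (simp add: sum.distrib[symmetric] ylen_def s_def xlen_def sum_distrib_left sum_distrib_right
          norm_mult power_mult_distrib mult.assoc)
    then show ?thesis
      unfolding sqn_def sum.remove[of UNIV k, OF finite UNIV_I]
      by (simp add: xlen_def algebra_simps)
  qed
  have "sos U (\<lambda>z. 1 / (2 + 2 * s) * (xlen k (\<xi> z) + 2 * s * ylen k a (\<xi> z) + ?R z))"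
    using s by (intro sos_intros X Y R) auto
  then have "sos U (\<lambda>z. xlen k (\<xi> z) + ylen k a (\<xi> z) - 1 / (2 + 2 * s) * sqn (\<xi> z))"
  proof (rule sos_cong)
    fix z
    have "?R z = (1 + 2 * s) * xlen k (\<xi> z) + 2 * ylen k a (\<xi> z) - sqn (\<xi> z)" using eq[of z] by simp
    then show "1 / (2 + 2 * s) * (xlen k (\<xi> z) + 2 * s * ylen k a (\<xi> z) + ?R z)
        = xlen k (\<xi> z) + ylen k a (\<xi> z) - 1 / (2 + 2 * s) * sqn (\<xi> z)"
      using s by (simp add: field_simps)
  qed
  moreover have "0 < 1 / (2 + 2 * s)" using s by simp
  ultimately show ?thesis using that by blast
qed

lemma sos_rep_sum_list:
  assumes "\<And>i. holo_on U (f i)"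
  obtains qs where "sos_rep U qs (\<lambda>z. \<Sum>i\<in>(UNIV::'i::finite set). (cmod (f i z))\<^sup>2)" "set qs = range f"
proof -
  obtain ids :: "'i list" where ids: "set ids = UNIV" "distinct ids"
    using finite_distinct_list[OF finite, of "UNIV :: 'i set"] by blast
  have "(\<Sum>q\<leftarrow>map f ids. (cmod (q z))\<^sup>2) = (\<Sum>i\<in>UNIV. (cmod (f i z))\<^sup>2)" for z
    using sum_list_distinct_conv_sum_set[OF ids(2), of "\<lambda>i. (cmod (f i z))\<^sup>2"] ids(1) by (simp add: o_def)
  then have "sos_rep U (map f ids) (\<lambda>z. \<Sum>i\<in>UNIV. (cmod (f i z))\<^sup>2)"
    using assms by (auto simp: sos_rep_def)
  moreover have "set (map f ids) = range f" using ids(1) by simp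
  ultimately show ?thesis by (rule that)
qed

text \<open>Up to sums of squares, the margin (X + Y)^8 |\<eta>|^4 contains a multiple of |\<xi>|^2
  |\<eta>|^4, whose summands are the products \<xi>_i \<eta>_j \<eta>_m. Where \<eta> \<noteq> 0
  they form an immersion: as \<xi>_l = 1, the products with i = l detect every variation of \<eta>,
  and the others then detect that of z because \<xi> is immersive.\<close>

lemma immersive_twist:
  fixes \<xi> :: "'m::complex_normed \<Rightarrow> complex^'i::finite" and a :: "complex^'i" and \<alpha> \<beta> :: "'r::finite"
  assumes Z: "open Z" and \<xi>: "holo_on Z \<xi>" and one: "\<And>z. z \<in> Z \<Longrightarrow> \<xi> z $ l = 1"
    and imm: "\<And>z u. z \<in> Z \<Longrightarrow> (\<And>i. Dv (\<lambda>z. \<xi> z $ i) z u = 0) \<Longrightarrow> u = 0" and "\<alpha> \<noteq> \<beta>"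
  shows "immersive_sos (Z \<times> UNIV) (Z \<times> (- {0}))
    (\<lambda>(z, \<eta>). (K0 (twist \<alpha> \<beta> (xlen k (\<xi> z)) (ylen k a (\<xi> z)) \<eta>))\<^sup>2)"
proof -
  let ?U = "Z \<times> (UNIV :: (complex^'r) set)"
  define \<xi>' where "\<xi>' = (\<lambda>p::'m \<times> (complex^'r). \<xi> (fst p))"
  define X where "X = (\<lambda>p. xlen k (\<xi>' p))"
  define Y where "Y = (\<lambda>p. ylen k a (\<xi>' p))"
  define H where "H = (\<lambda>p::'m \<times> (complex^'r). sqn (snd p))"
  define L where "L = (\<lambda>p. sqn (\<xi>' p))"
  have U: "open ?U" using Z by (intro open_Times) auto
  have \<xi>': "holo_on ?U \<xi>'"
    unfolding \<xi>'_def by (rule holo_on_compose[OF holo_on_fst[OF holo_on_ident] \<xi>]) auto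
  have snd: "holo_on ?U (\<lambda>p. snd p)" by (rule holo_on_snd[OF holo_on_ident])
  have X: "sos ?U X" and Y: "sos ?U Y"
    unfolding X_def Y_def xlen_def ylen_def
    by (intro sos_sum sos_cmod2 holo_on_diff holo_on_mult holo_on_const holo_on_nth \<xi>')+
  have L: "sos ?U L" and H: "sos ?U H"
    unfolding L_def H_def sqn_def by (intro sos_sum sos_cmod2 holo_on_nth \<xi>' snd)+
  obtain C where C: "0 < C" "sos ?U (\<lambda>p. X p + Y p - C * L p)"
    using sos_length_bound[OF \<xi>', of k a] unfolding X_def Y_def L_def .
  have CL: "sos ?U (\<lambda>p. C * L p)" using C(1) by (intro sos_intros L) simp
  \<comment> \<open>The normalization \<xi>_l = 1 makes |\<xi>|^2 - 1 a sum of squares, so seven of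
    the eight factors |\<xi>|^2 can be lowered to 1.\<close>
  have L1: "sos ?U (\<lambda>p. L p - 1)"
  proof -
    have "sos ?U (\<lambda>p. \<Sum>i\<in>UNIV - {l}. (cmod (\<xi>' p $ i))\<^sup>2)"
      by (intro sos_sum sos_cmod2 holo_on_nth \<xi>')
    then show ?thesis
    proof (rule sos_cong)
      fix p assume "p \<in> ?U"
      then have "\<xi>' p $ l = 1" using one by (auto simp: \<xi>'_def)
      then show "(\<Sum>i\<in>UNIV - {l}. (cmod (\<xi>' p $ i))\<^sup>2) = L p - 1"
        unfolding L_def sqn_def sum.remove[of UNIV l, OF finite UNIV_I] by simp
    qed
  qed
  define c where "c = (1 / 2304)^2 * C ^ 8"
  have c: "0 < c" using C(1) by (simp add: c_def)
  have 1: "sos ?U (\<lambda>p. (X p + Y p)^8 - (C * L p)^8)"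
    by (rule sos_power_diff[OF sos_add[OF X Y] CL C(2)])
  have 2: "sos ?U (\<lambda>p. L p ^ 7 - 1 ^ 7)"
    by (rule sos_power_diff[OF L _ L1]) (simp add: sos_const)
  have 3: "sos ?U (\<lambda>p. (K0 (twist \<alpha> \<beta> (X p) (Y p) (snd p)))\<^sup>2 - (1 / 2304)^2 * (X p + Y p)^8 * (H p)\<^sup>2)"
    unfolding H_def by (rule sos_twist[OF \<open>\<alpha> \<noteq> \<beta>\<close> X Y snd])
  have "sos ?U (\<lambda>p. ((K0 (twist \<alpha> \<beta> (X p) (Y p) (snd p)))\<^sup>2 - (1 / 2304)^2 * (X p + Y p)^8 * (H p)\<^sup>2)
      + ((1 / 2304)^2 * ((X p + Y p)^8 - (C * L p)^8) * (H p)\<^sup>2 + c * L p * (L p ^ 7 - 1 ^ 7) * (H p)\<^sup>2))"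
    using c by (intro sos_intros 1 2 3 L H) auto
  then have rest: "sos ?U (\<lambda>p. (K0 (twist \<alpha> \<beta> (X p) (Y p) (snd p)))\<^sup>2 - c * (L p * (H p * H p)))"
  proof (rule sos_cong)
    fix p
    have alg: "Q - d * W * h + (d * (W - e * (x * y)) * h + d * e * x * (y - 1) * h) = Q - d * e * (x * h)"
      for Q d W h e x y :: real by (simp add: algebra_simps)
    have "(C * L p)^8 = C^8 * (L p * L p^7)"
      using power_add[of "L p" 1 7] by (simp add: power_mult_distrib)
    then show "((K0 (twist \<alpha> \<beta> (X p) (Y p) (snd p)))\<^sup>2 - (1 / 2304)^2 * (X p + Y p)^8 * (H p)\<^sup>2)
        + ((1 / 2304)^2 * ((X p + Y p)^8 - (C * L p)^8) * (H p)\<^sup>2 + c * L p * (L p ^ 7 - 1 ^ 7) * (H p)\<^sup>2)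
        = (K0 (twist \<alpha> \<beta> (X p) (Y p) (snd p)))\<^sup>2 - c * (L p * (H p * H p))"
      unfolding c_def power2_eq_square[of "H p"] by (simp only: power_one) (rule alg)
  qed
  obtain rs where rs: "sos_rep ?U rs (\<lambda>p. (K0 (twist \<alpha> \<beta> (X p) (Y p) (snd p)))\<^sup>2 - c * (L p * (H p * H p)))"
    using rest by (auto simp: sos_def)
  obtain ls where ls: "sos_rep ?U ls L" "set ls = range (\<lambda>i p. \<xi>' p $ i)"
    using sos_rep_sum_list[of ?U "\<lambda>i p. \<xi>' p $ i"] holo_on_nth[OF \<xi>'] unfolding L_def sqn_def by blast
  obtain hs where hs: "sos_rep ?U hs H" "set hs = range (\<lambda>i p. snd p $ i)"
    using sos_rep_sum_list[of ?U "\<lambda>i p. snd p $ i"] holo_on_nth[OF snd] unfolding H_def sqn_def by blast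
  have cs: "sos_rep ?U [\<lambda>p. of_real (sqrt c)] (\<lambda>p. c)"
    using c by (auto simp: sos_rep_def)
  define prod :: "('m \<times> (complex^'r) \<Rightarrow> complex) list \<Rightarrow> _ \<Rightarrow> _"
    where "prod = (\<lambda>ps qs. concat (map (\<lambda>p. map (\<lambda>q z. p z * q z) qs) ps))"
  define qs where "qs = prod [\<lambda>p. of_real (sqrt c)] (prod ls (prod hs hs)) @ rs"
  have "sos_rep ?U qs (\<lambda>p. c * (L p * (H p * H p)) + ((K0 (twist \<alpha> \<beta> (X p) (Y p) (snd p)))\<^sup>2 - c * (L p * (H p * H p))))"
    unfolding qs_def prod_def by (intro sos_rep_add sos_rep_mult cs ls hs rs)
  then have rep: "sos_rep ?U qs (\<lambda>(z, \<eta>). (K0 (twist \<alpha> \<beta> (xlen k (\<xi> z)) (ylen k a (\<xi> z)) \<eta>))\<^sup>2)"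
    by (simp add: X_def Y_def \<xi>'_def case_prod_beta')
  have mem: "(\<lambda>p. of_real (sqrt c) * (\<xi>' p $ i * (snd p $ j * snd p $ m))) \<in> set qs" for i j m
  proof -
    have mem: "(\<lambda>z. p z * q z) \<in> set (prod ps qs)" if "p \<in> set ps" "q \<in> set qs" for p q ps qs
      using that unfolding prod_def set_concat set_map image_image
      by (intro UN_I[of p]) simp_all
    have "(\<lambda>p. \<xi>' p $ i) \<in> set ls" "(\<lambda>p. snd p $ j) \<in> set hs" "(\<lambda>p. snd p $ m) \<in> set hs"
      using ls(2) hs(2) by auto
    from mem[OF this(1) mem[OF this(2,3)]]
    have "(\<lambda>p. of_real (sqrt c) * (\<xi>' p $ i * (snd p $ j * snd p $ m)))
        \<in> set (prod [\<lambda>p. of_real (sqrt c)] (prod ls (prod hs hs)))"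
      by (rule mem[rotated]) simp
    then show ?thesis by (simp add: qs_def)
  qed
  show ?thesis
    unfolding immersive_sos_def
  proof (intro exI[of _ qs] conjI rep ballI allI impI)
    fix p :: "'m \<times> (complex^'r)" and w
    assume p: "p \<in> Z \<times> - {0}" and D0: "\<forall>q\<in>set qs. Dv q p w = 0"
    obtain z \<eta> where p': "p = (z, \<eta>)" "z \<in> Z" "\<eta> \<noteq> 0" using p by auto
    obtain u v where w: "w = (u, v)" by (cases w)
    define d where "d = (\<lambda>i. Dv (\<lambda>z. \<xi> z $ i) z u)"
    have eq: "\<xi> z $ i * (\<eta> $ j * v $ m + v $ j * \<eta> $ m) + d i * (\<eta> $ j * \<eta> $ m) = 0" for i j m
    proof -
      have fst: "((\<lambda>p::'m \<times> (complex^'r). \<xi> (fst p) $ i) has_derivative (\<lambda>w. Dv (\<lambda>z. \<xi> z $ i) z (fst w))) (at p)"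
      proof (rule has_derivative_compose[OF has_derivative_fst[OF has_derivative_ident]])
        show "((\<lambda>z. \<xi> z $ i) has_derivative Dv (\<lambda>z. \<xi> z $ i) z) (at (fst p))"
          using holo_on_has_derivative[OF holo_on_nth[OF \<xi>] p'(2)] by (simp add: p'(1))
      qed
      have snd: "((\<lambda>p::'m \<times> (complex^'r). snd p $ j) has_derivative (\<lambda>w. snd w $ j)) (at p)" for j
        by (intro bounded_linear.has_derivative[OF bounded_linear_vec_nth] has_derivative_snd has_derivative_ident)
      have "Dv (\<lambda>p. of_real (sqrt c) * (\<xi>' p $ i * (snd p $ j * snd p $ m))) p w
        = of_real (sqrt c) * (\<xi> z $ i * (\<eta> $ j * v $ m + v $ j * \<eta> $ m) + d i * (\<eta> $ j * \<eta> $ m))"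
        using Dv_eqI[OF has_derivative_mult_right[OF has_derivative_mult[OF fst
              has_derivative_mult[OF snd[of j] snd[of m]]], of "of_real (sqrt c)"], of w]
        by (simp add: p'(1) w d_def \<xi>'_def)
      then show ?thesis using bspec[OF D0 mem[of i j m]] c by simp
    qed
    have "((\<lambda>z. \<xi> z $ l) has_derivative (\<lambda>_. 0)) (at z)"
      by (rule has_derivative_transform_within_open[OF has_derivative_const Z p'(2)]) (simp add: one)
    then have dl: "d l = 0" unfolding d_def by (rule Dv_eqI)
    have eta: "\<eta> $ j * v $ m + v $ j * \<eta> $ m = 0" for j m
      using eq[of l j m] dl one[OF p'(2)] by simp
    obtain j where j: "\<eta> $ j \<noteq> 0" using p'(3) by (auto simp: vec_eq_iff)
    have "v $ j = 0" using eta[of j j] j by simp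
    then have "v = 0" using eta[of j] j by (simp add: vec_eq_iff)
    then have "d i = 0" for i using eq[of i j j] j by simp
    then have "u = 0" unfolding d_def by (intro imm[OF p'(2)])
    with \<open>v = 0\<close> show "w = 0" by (simp add: w zero_prod_def)
  qed
qed

section \<open>The invariant metric on the standard fibre\<close>

lemma Cspace_simps [simp]: "car Cspace = UNIV" "add Cspace = (+)" "smult Cspace = scaleC"
  by (simp_all add: Cspace_def)

lemma Cbundle_simps [simp]: "bbase Cbundle = point" "pts point = {()}" "atlas point = {({()}, \<lambda>s. s)}"
  "trivs Cbundle = {({()}, \<lambda>v. v)}" "fibre Cbundle s = Cspace"
  by (simp_all add: Cbundle_def point_def fibre_def Cspace_def)

lemma ex_distinct_indices: obtains \<alpha> \<beta> :: "'q option" where "\<alpha> \<noteq> \<beta>"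
  by (rule that[of None "Some undefined"]) simp

text \<open>The standard fibre is the case of a point with the constant coordinate \<xi> = 1 in C^1:
  there X = 1, the sum defining Y is empty, and the twist is the identity. So the invariant metric
  needs no separate computation.\<close>

interpretation std: finsler_bundle
  "Cbundle :: (unit, unit, complex^('q::finite option), 'q option) vbundle" "\<lambda>v. v" "\<lambda>_ _. 1" "\<lambda>_. K0"
proof
  show "linear_iso (fibre Cbundle s) Cspace (\<lambda>v. v)" for s
    by (simp add: linear_iso_def bij_def)
  show "immersive_sos (x ` (B \<inter> U) \<times> UNIV) (x ` (B \<inter> U) \<times> (- {0}))
      (\<lambda>(z, \<eta>). (K0 (1 *\<^sub>C \<eta> :: complex^('q option)))\<^sup>2)"
    if "(B, x) \<in> atlas (bbase Cbundle)" "(U, \<phi>) \<in> trivs Cbundle"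
    for B U and x :: "unit \<Rightarrow> unit" and \<phi> :: "complex^('q option) \<Rightarrow> complex^('q option)"
  proof -
    obtain \<alpha> \<beta> :: "'q option" where ab: "\<alpha> \<noteq> \<beta>" by (rule ex_distinct_indices)
    have "immersive_sos ((UNIV :: unit set) \<times> UNIV) (UNIV \<times> (- {0}))
      (\<lambda>(z, \<eta>::complex^('q option)). (K0 (twist \<alpha> \<beta> (xlen 1 ((\<lambda>_. \<chi> _. 1) z :: complex^1))
        (ylen 1 0 ((\<lambda>_. \<chi> _. 1) z :: complex^1)) \<eta>))\<^sup>2)"
      by (rule immersive_twist[OF open_UNIV holo_on_const _ _ ab, where l=1]) auto
    moreover have "UNIV - {1} = ({} :: 1 set)" by auto
    ultimately have 1: "immersive_sos ((UNIV :: unit set) \<times> UNIV) (UNIV \<times> (- {0}))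
      (\<lambda>(z, \<eta>::complex^('q option)). (K0 (1 *\<^sub>C \<eta>))\<^sup>2)" by (simp add: xlen_def ylen_def)
    have 2: "x ` (B \<inter> U) = UNIV" using that by auto
    show ?thesis unfolding 2 by (rule 1)
  qed
qed (auto simp: K0_scale K0_pos inj_on_def UNIV_unit[symmetric])

lemma std_kk_KK: "std.kk \<in> KK"
  unfolding KK_def using std.metric_on_kk std.positively_curved_kk by (simp add: std.kk_def)

context finsler_bundle
begin

lemma image_lev:
  assumes s: "s \<in> pts (bbase E)" and \<psi>: "linear_iso Cspace (fibre E s) \<psi>"
    and \<eta>: "\<And>v. bil \<eta>' (co (\<psi> v)) = bil \<eta> v"
  shows "\<psi> ` std.lev () \<eta> t = lev s \<eta>' t"
proof -
  have b: "range \<psi> = car (fibre E s)" using \<psi> by (simp add: linear_iso_def bij_betw_def)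
  show ?thesis
  proof (intro equalityI subsetI)
    fix u assume "u \<in> \<psi> ` std.lev () \<eta> t"
    then show "u \<in> lev s \<eta>' t" using b by (auto simp: std.lev_def lev_def \<eta>)
  next
    fix u assume u: "u \<in> lev s \<eta>' t"
    then obtain v where v: "u = \<psi> v" using b by (auto simp: lev_def)
    then have "v \<in> std.lev () \<eta> t" using u by (simp add: std.lev_def lev_def \<eta>)
    then show "u \<in> \<psi> ` std.lev () \<eta> t" using v by simp
  qed
qed

lemma dual_iso:
  assumes s: "s \<in> pts (bbase E)" and \<psi>: "linear_iso Cspace (fibre E s) \<psi>" and "\<eta> \<noteq> 0"
  obtains \<eta>' where "\<And>v. bil \<eta>' (co (\<psi> v)) = bil \<eta> v" "\<eta>' \<noteq> 0"
proof -
  define F where "F = (\<lambda>w. bil \<eta> (inv \<psi> (iv s w)))"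
  have bij: "bij_betw \<psi> UNIV (car (fibre E s))" using \<psi> by (simp add: linear_iso_def)
  have inv: "inv \<psi> (\<psi> v) = v" for v
    using bij by (simp add: bij_betw_def)
  have \<psi>a: "\<psi> (v + w) = vadd E (\<psi> v) (\<psi> w)" and \<psi>s: "\<psi> (c *\<^sub>C v) = vscale E c (\<psi> v)" for v w c
    using \<psi> by (simp_all add: linear_iso_def)
  have \<psi>c: "\<psi> v \<in> car (fibre E s)" for v using bij by (auto simp: bij_betw_def)
  have iv: "iv s (co u) = u" if "u \<in> car (fibre E s)" for u
    by (rule co_inj[OF s iv_car[OF s] that co_iv[OF s]])
  have Fco: "F (co (\<psi> v)) = bil \<eta> v" for v by (simp add: F_def iv \<psi>c inv)
  have surj: "\<exists>v. w = co (\<psi> v)" for w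
  proof -
    obtain v where "iv s w = \<psi> v" using bij iv_car[OF s, of w] by (auto simp: bij_betw_def)
    then show ?thesis using co_iv[OF s, of w] by auto
  qed
  have Fadd: "F (w + w') = F w + F w'" for w w'
  proof -
    obtain v v' where "w = co (\<psi> v)" "w' = co (\<psi> v')" using surj by blast
    moreover have "co (\<psi> v) + co (\<psi> v') = co (\<psi> (v + v'))" by (simp add: \<psi>a co_add[OF s] \<psi>c)
    ultimately show ?thesis by (simp add: Fco bil_add_right)
  qed
  have Fscale: "F (c *\<^sub>C w) = c * F w" for c w
  proof -
    obtain v where "w = co (\<psi> v)" using surj by blast
    moreover have "c *\<^sub>C co (\<psi> v) = co (\<psi> (c *\<^sub>C v))" by (simp add: \<psi>s co_scale[OF s] \<psi>c)
    ultimately show ?thesis by (simp add: Fco bil_scale_right)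
  qed
  define \<eta>' where "\<eta>' = (\<chi> i. F (axis i 1))"
  have F0: "F 0 = 0" using Fscale[of 0 0] by simp
  have "F w = bil \<eta>' w" for w
  proof -
    have h1: "F (\<Sum>i\<in>I. w $ i *\<^sub>C axis i 1) = (\<Sum>i\<in>I. \<eta>' $ i * w $ i)" if "finite I" for I
      using that by (induction I rule: finite_induct) (simp_all add: F0 Fadd Fscale \<eta>'_def)
    have h2: "(\<Sum>i\<in>UNIV. w $ i *\<^sub>C axis i 1) = w"
      by (simp add: vec_eq_iff axis_def if_distrib cong: if_cong)
    show ?thesis using h1[of UNIV] unfolding h2 by (simp add: bil_def)
  qed
  then have 1: "bil \<eta>' (co (\<psi> v)) = bil \<eta> v" for v using Fco by simp
  obtain v where "bil \<eta> v = 1" using bil_surj[OF \<open>\<eta> \<noteq> 0\<close>] .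
  then have "\<eta>' \<noteq> 0" using 1[of v] by (auto simp: bil_def)
  with 1 show ?thesis by (rule that)
qed

text \<open>\<theta> is the inverse transpose of A, so the functional \<eta> on the fibre
  corresponds to A \<eta> on the standard space, and K s \<eta> = K_0(A \<eta>) says that \<theta>
  is an isometry for the metrics on O(1). Any frame \<psi> then pulls back the fibre metric as
  \<theta> \<circ> \<psi> pulls back the standard one.\<close>

lemma pull_K_kk:
  assumes s: "s \<in> pts (bbase E)" and \<psi>: "linear_iso Cspace (fibre E s) \<psi>"
    and \<theta>: "linear_iso (fibre E s) Cspace \<theta>"
    and A: "\<And>\<eta> u. u \<in> car (fibre E s) \<Longrightarrow> bil (A \<eta>) (\<theta> u) = bil \<eta> (co u)"
    and K: "\<And>\<eta>. K s \<eta> = K0 (A \<eta>)"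
  shows "pull_K \<psi> kk = pull_K (\<theta> \<circ> \<psi>) std.kk"
proof
  fix p
  show "pull_K \<psi> kk p = pull_K (\<theta> \<circ> \<psi>) std.kk p"
  proof (cases "p \<in> tot (O1 Cbundle)")
    case True
    then obtain \<eta> t where p: "p = (std.lev () \<eta> 0, std.lev () \<eta> t)" and \<eta>: "\<eta> \<noteq> 0"
      by (auto simp: std.O1_tot)
    obtain \<eta>' where \<eta>': "\<And>v. bil \<eta>' (co (\<psi> v)) = bil \<eta> v" "\<eta>' \<noteq> 0"
      using dual_iso[OF s \<psi> \<eta>] by blast
    have \<psi>c: "\<psi> v \<in> car (fibre E s)" for v using \<psi> by (auto simp: linear_iso_def bij_betw_def)
    have A0: "A \<eta>' \<noteq> 0"
    proof
      assume "A \<eta>' = 0"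
      then have "K0 (A \<eta>') = 0" by (simp add: K0_def sqn_def)
      then show False using K_pos[OF s \<eta>'(2)] K by simp
    qed
    have bij: "bij_betw (\<theta> \<circ> \<psi>) UNIV UNIV"
      using \<psi> \<theta> by (auto simp: linear_iso_def intro: bij_betw_trans)
    have iso: "linear_iso Cspace (fibre Cbundle ()) (\<theta> \<circ> \<psi>)"
      using \<psi> \<theta> \<psi>c bij by (simp add: linear_iso_def)
    have 1: "\<psi> ` std.lev () \<eta> t = lev s \<eta>' t" for t
      by (rule image_lev[OF s \<psi> \<eta>'(1)])
    have 2: "(\<theta> \<circ> \<psi>) ` std.lev () \<eta> t = std.lev () (A \<eta>') t" for t
      by (rule std.image_lev[OF _ iso]) (simp_all add: A \<psi>c \<eta>'(1))
    have "pull_K \<psi> kk p = (cmod t)\<^sup>2 / K s \<eta>'"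
      using True kk_pt[OF s \<eta>'(2), of t] by (simp add: pull_K_def p 1 pt_def)
    moreover have "pull_K (\<theta> \<circ> \<psi>) std.kk p = (cmod t)\<^sup>2 / K0 (A \<eta>')"
      using True std.kk_pt[OF _ A0, of "()" t] by (simp add: pull_K_def p 2[unfolded o_def] std.pt_def)
    ultimately show ?thesis by (simp add: K)
  qed (simp add: pull_K_def)
qed

end

lemma linear_iso_comp:
  assumes "linear_iso U V f" "linear_iso V W h" shows "linear_iso U W (h \<circ> f)"
proof -
  have "f v \<in> car V" if "v \<in> car U" for v
    using assms(1) that by (auto simp: linear_iso_def bij_betw_def)
  then show ?thesis using assms by (auto simp: linear_iso_def intro: bij_betw_trans)
qed

text \<open>The case of \<open>pull_K_kk\<close> in which the fibre is the standard one and A is a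
  monomial matrix with unimodular entries, which leaves K_0 unchanged.\<close>

lemma pull_K_signed_permutation:
  fixes \<phi> :: "complex^('q::finite option) \<Rightarrow> complex^('q option)"
  assumes \<phi>: "linear_iso Cspace Cspace \<phi>" and "bij \<pi>" "\<And>i. cmod (u i) = 1"
    and A: "\<And>\<eta> v. bil (\<chi> i. u i * \<eta> $ \<pi> i) (\<phi> v) = bil \<eta> v"
  shows "pull_K \<phi> std.kk = std.kk"
proof -
  have id: "linear_iso Cspace Cspace (\<lambda>v. v)" by (simp add: linear_iso_def bij_def)
  have "pull_K (\<lambda>v. v) std.kk = pull_K (\<phi> \<circ> (\<lambda>v. v)) std.kk"
    by (rule std.pull_K_kk[where s="()" and A="\<lambda>\<eta>. \<chi> i. u i * \<eta> $ \<pi> i"])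
      (simp_all add: \<phi> id A K0_signed_permutation[OF assms(2,3)])
  moreover have "pull_K (\<lambda>v. v) std.kk = (std.kk :: (complex^('q option)) set \<times> (complex^('q option)) set \<Rightarrow> real)"
    by (auto simp: pull_K_def std.kk_def fun_eq_iff)
  ultimately show ?thesis by (simp add: o_def)
qed

lemma hermitian_metric_Cspace:
  assumes "hermitian_metric Cspace h"
  shows "h (c *\<^sub>C v) = (cmod c)\<^sup>2 * h v" and "h (v + w) + h (v - w) = 2 * h v + 2 * h w"
    and "v \<noteq> 0 \<Longrightarrow> 0 < h v"
proof -
  obtain H where H: "positive_hermitian_form Cspace H" and h: "\<And>v. complex_of_real (h v) = H v v"
    using assms by (auto simp: hermitian_metric_def)
  note H' = H[unfolded positive_hermitian_form_def linear_functional_def Cspace_simps]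
  have add: "H (v + w) u = H v u + H w u" and scale: "H (c *\<^sub>C v) u = c * H v u" for u v w c
    using bspec[OF conjunct1[OF H'] UNIV_I, of u] by simp_all
  have sym: "H w v = cnj (H v w)" for v w
    by (rule bspec[OF bspec[OF conjunct1[OF conjunct2[OF H']] UNIV_I] UNIV_I])
  have pos: "0 < Re (H v v)" if "v \<noteq> 0" for v
    using conjunct2[OF conjunct2[OF H']] that by simp
  have add2: "H u (v + w) = H u v + H u w" and scale2: "H u (c *\<^sub>C v) = cnj c * H u v" for u v w c
    unfolding sym[of u v] sym[of u w] sym[of u "v + w"] sym[of u "c *\<^sub>C v"] add scale by simp_all
  have "complex_of_real (h (c *\<^sub>C v)) = of_real ((cmod c)\<^sup>2 * h v)"
    unfolding h scale scale2 of_real_mult complex_norm_square by simp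
  then show "h (c *\<^sub>C v) = (cmod c)\<^sup>2 * h v" by (simp only: of_real_eq_iff)
  have m: "v - w = v + (- 1) *\<^sub>C w" by (simp add: vec_eq_iff)
  have "complex_of_real (h (v + w) + h (v - w)) = of_real (2 * h v + 2 * h w)"
    unfolding of_real_add of_real_mult h m add add2 scale scale2 by simp
  then show "h (v + w) + h (v - w) = 2 * h v + 2 * h w" by (simp only: of_real_eq_iff)
  show "0 < h v" if "v \<noteq> 0" using pos[OF that] unfolding h[symmetric] by simp
qed

lemma linear_iso_monomial:
  fixes u :: "'r::finite \<Rightarrow> complex"
  assumes "bij \<pi>" "\<And>i. u i \<noteq> 0"
  shows "linear_iso Cspace Cspace (\<lambda>v. \<chi> i. u i * v $ \<pi> i)"
proof -
  have "bij (\<lambda>v. \<chi> i. u i * v $ \<pi> i)"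
  proof (rule o_bij)
    show "(\<lambda>v. \<chi> i. v $ inv \<pi> i / u (inv \<pi> i)) \<circ> (\<lambda>v. \<chi> i. u i * v $ \<pi> i) = id"
      using assms(2) by (auto simp: fun_eq_iff vec_eq_iff bij_is_surj[OF assms(1)] surj_f_inv_f)
    show "(\<lambda>v. \<chi> i. u i * v $ \<pi> i) \<circ> (\<lambda>v. \<chi> i. v $ inv \<pi> i / u (inv \<pi> i)) = id"
      using assms(2) by (auto simp: fun_eq_iff vec_eq_iff bij_is_inj[OF assms(1)])
  qed
  then show ?thesis by (simp add: linear_iso_def vec_eq_iff algebra_simps)
qed

text \<open>The image h of the standard metric inherits its symmetries. Sign changes and the
  parallelogram law make h additive on vectors with disjoint supports, so h is a combination of the
  |v_i|^2; permutations make the coefficients equal.\<close>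

lemma equivariant_std:
  fixes \<Psi> :: "((complex^('q::finite option)) set \<times> (complex^('q option)) set \<Rightarrow> real) \<Rightarrow> complex^('q option) \<Rightarrow> real"
  assumes \<Psi>: "equivariant \<Psi>"
  obtains c where "0 < c" "\<And>v. \<Psi> std.kk v = c * sqn v"
proof -
  define h where "h = \<Psi> std.kk"
  have "h \<in> HH" using \<Psi> std_kk_KK by (auto simp: equivariant_def h_def)
  then have hm: "hermitian_metric Cspace h" by (simp add: HH_def)
  note h = hermitian_metric_Cspace[OF hm]
  have inv: "h (\<chi> i. u i * v $ \<pi> i) = h v" if \<pi>: "bij \<pi>" and u: "\<And>i. cmod (u i) = 1" for \<pi> u v
  proof -
    have "u i \<noteq> 0" for i using u[of i] by auto
    then have iso: "linear_iso Cspace Cspace (\<lambda>v. \<chi> i. u i * v $ \<pi> i)" by (rule linear_iso_monomial[OF \<pi>])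
    have "bil (\<chi> i. inverse (u i) * \<eta> $ \<pi> i) (\<chi> i. u i * v $ \<pi> i) = bil \<eta> v" for \<eta> v
    proof -
      have "bil (\<chi> i. inverse (u i) * \<eta> $ \<pi> i) (\<chi> i. u i * v $ \<pi> i) = (\<Sum>i\<in>UNIV. \<eta> $ \<pi> i * v $ \<pi> i)"
        unfolding bil_def using \<open>\<And>i. u i \<noteq> 0\<close> by (auto intro!: sum.cong)
      also have "\<dots> = bil \<eta> v"
        unfolding bil_def by (rule sum.reindex_bij_betw[of \<pi> UNIV UNIV "\<lambda>i. \<eta> $ i * v $ i"]) (rule \<pi>)
      finally show ?thesis .
    qed
    then have "pull_K (\<lambda>v. \<chi> i. u i * v $ \<pi> i) std.kk = std.kk"
      by (intro pull_K_signed_permutation[OF iso \<pi>, of "\<lambda>i. inverse (u i)"]) (simp_all add: norm_inverse u)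
    moreover have "\<Psi> std.kk \<circ> (\<lambda>v. \<chi> i. u i * v $ \<pi> i) = \<Psi> (pull_K (\<lambda>v. \<chi> i. u i * v $ \<pi> i) std.kk)"
      by (rule bspec[OF mp[OF spec[OF conjunct2[OF \<Psi>[unfolded equivariant_def]]] iso] std_kk_KK])
    ultimately have "h \<circ> (\<lambda>v. \<chi> i. u i * v $ \<pi> i) = h" by (simp add: h_def)
    from fun_cong[OF this, of v] show ?thesis by simp
  qed
  have orth: "h (v + w) = h v + h w" if "\<And>i. v $ i = 0 \<or> w $ i = 0" for v w
  proof -
    define u :: "'q option \<Rightarrow> complex" where "u = (\<lambda>i. if w $ i = 0 then 1 else - 1)"
    have "(\<chi> i. u i * (v + w) $ i) = v - w" using that by (auto simp: u_def vec_eq_iff)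
    then have "h (v - w) = h (v + w)" using inv[of "\<lambda>i. i" u "v + w"] by (simp add: u_def bij_def)
    then show ?thesis using h(2)[of v w] by simp
  qed
  have h0: "h 0 = 0" using h(1)[of 0 0] by simp
  define c where "c = h (axis None 1)"
  have hax: "h (axis j 1) = c" for j
  proof -
    have "(\<chi> i. 1 * axis None 1 $ Transposition.transpose None j i) = (axis j 1 :: complex^('q option))"
      by (simp add: vec_eq_iff axis_def Transposition.transpose_def)
    then show ?thesis using inv[of "Transposition.transpose None j" "\<lambda>_. 1" "axis None 1"] by (simp add: c_def)
  qed
  have "h v = c * sqn v" for v
  proof -
    have h1: "h (\<Sum>i\<in>I. v $ i *\<^sub>C axis i 1) = c * (\<Sum>i\<in>I. (cmod (v $ i))\<^sup>2)" if "finite I" for I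
      using that
    proof (induction I rule: finite_induct)
      case (insert j I)
      have "h (v $ j *\<^sub>C axis j 1 + (\<Sum>i\<in>I. v $ i *\<^sub>C axis i 1))
          = h (v $ j *\<^sub>C axis j 1) + h (\<Sum>i\<in>I. v $ i *\<^sub>C axis i 1)"
      proof (rule orth)
        fix m
        show "(v $ j *\<^sub>C axis j 1) $ m = 0 \<or> (\<Sum>i\<in>I. v $ i *\<^sub>C axis i 1) $ m = 0"
          using insert.hyps by (auto simp: axis_def sum.neutral)
      qed
      then show ?case using insert by (simp add: h(1) hax algebra_simps)
    qed (simp add: h0)
    have h2: "(\<Sum>i\<in>UNIV. v $ i *\<^sub>C axis i 1) = v"
      by (simp add: vec_eq_iff axis_def if_distrib cong: if_cong)
    show ?thesis using h1[of UNIV] unfolding h2 by (simp add: sqn_def)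
  qed
  moreover have "0 < c" unfolding c_def by (rule h(3)) (simp add: axis_eq_0_iff)
  ultimately show ?thesis using that by (simp add: h_def)
qed

section \<open>Homogeneous coordinates on a projective algebraic manifold\<close>

text \<open>\<open>mtop\<close> applies \<open>topology\<close> to a predicate, which has a meaning
  once the predicate is closed under intersections and unions. For intersections this needs charts
  that are injective, since images under them must commute with intersections.\<close>

lemma openin_mtop:
  assumes inj: "\<And>U x. (U, x) \<in> atlas M \<Longrightarrow> inj_on x U"
  shows "openin (mtop M) A \<longleftrightarrow> A \<subseteq> pts M \<and> (\<forall>(U, x)\<in>atlas M. open (x ` (A \<inter> U)))"
proof -
  define L where "L = (\<lambda>A. A \<subseteq> pts M \<and> (\<forall>(U, x)\<in>atlas M. open (x ` (A \<inter> U))))"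
  have LI: "L A" if "A \<subseteq> pts M" "\<And>U x. (U, x) \<in> atlas M \<Longrightarrow> open (x ` (A \<inter> U))" for A
    using that by (auto simp: L_def)
  have LD: "open (x ` (A \<inter> U))" if "L A" "(U, x) \<in> atlas M" for A U x
    using that by (auto simp: L_def)
  have Lpts: "A \<subseteq> pts M" if "L A" for A using that by (simp add: L_def)
  have "istopology L"
    unfolding istopology_def
  proof (intro conjI allI impI)
    fix A B assume A: "L A" and B: "L B"
    show "L (A \<inter> B)"
    proof (rule LI)
      show "A \<inter> B \<subseteq> pts M" using Lpts[OF A] by blast
      fix U x assume U: "(U, x) \<in> atlas M"
      have "x ` (A \<inter> B \<inter> U) = x ` ((A \<inter> U) \<inter> (B \<inter> U))" by (rule arg_cong[of _ _ "image x"]) blast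
      also have "\<dots> = x ` (A \<inter> U) \<inter> x ` (B \<inter> U)"
        by (rule inj_on_image_Int[OF inj[OF U]]) auto
      also have "open \<dots>" by (intro open_Int LD[OF A U] LD[OF B U])
      finally show "open (x ` (A \<inter> B \<inter> U))" .
    qed
  next
    fix \<A> assume \<A>: "\<forall>A\<in>\<A>. L A"
    show "L (\<Union>\<A>)"
    proof (rule LI)
      show "\<Union>\<A> \<subseteq> pts M" using \<A> Lpts by blast
      fix U x assume U: "(U, x) \<in> atlas M"
      have "x ` (\<Union>\<A> \<inter> U) = (\<Union>A\<in>\<A>. x ` (A \<inter> U))" by blast
      also have "open \<dots>" using \<A> LD[OF _ U] by (intro open_UN) auto
      finally show "open (x ` (\<Union>\<A> \<inter> U))" .
    qed
  qed
  then have 1: "openin (topology L) = L" by (rule topology_inverse')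
  have 2: "mtop M = topology L" by (simp add: mtop_def L_def)
  show ?thesis unfolding 2 1 by (simp add: L_def)
qed

lemma complex_manifold_inj: "complex_manifold M \<Longrightarrow> (U, x) \<in> atlas M \<Longrightarrow> inj_on x U"
  unfolding complex_manifold_def by blast

lemma complex_manifold_pts: "complex_manifold M \<Longrightarrow> (U, x) \<in> atlas M \<Longrightarrow> U \<subseteq> pts M"
  unfolding complex_manifold_def by blast

lemma complex_manifold_cover:
  assumes "complex_manifold M" "s \<in> pts M" obtains U x where "(U, x) \<in> atlas M" "s \<in> U"
  using assms unfolding complex_manifold_def by blast

lemma complex_manifold_open_Int:
  "complex_manifold M \<Longrightarrow> (U, x) \<in> atlas M \<Longrightarrow> (V, y) \<in> atlas M \<Longrightarrow> open (x ` (U \<inter> V))"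
  unfolding complex_manifold_def by blast

lemma complex_manifold_transition:
  "complex_manifold M \<Longrightarrow> (U, x) \<in> atlas M \<Longrightarrow> (V, y) \<in> atlas M \<Longrightarrow>
    holo_on (x ` (U \<inter> V)) (y \<circ> inv_into U x)"
  unfolding complex_manifold_def by blast

lemma complex_manifold_openin:
  assumes "complex_manifold M"
  shows "openin (mtop M) A \<longleftrightarrow> A \<subseteq> pts M \<and> (\<forall>(U, x)\<in>atlas M. open (x ` (A \<inter> U)))"
  by (rule openin_mtop) (rule complex_manifold_inj[OF assms])

lemma complex_manifold_chart_openin:
  assumes "complex_manifold M" "(U, x) \<in> atlas M" shows "openin (mtop M) U"
  unfolding complex_manifold_openin[OF assms(1)]
  using complex_manifold_pts[OF assms] complex_manifold_open_Int[OF assms(1) _ assms(2)]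
  by (auto simp: Int_commute[of U])

lemma complex_manifold_topspace:
  assumes "complex_manifold M" shows "topspace (mtop M) = pts M"
proof -
  have "openin (mtop M) (pts M)"
    unfolding complex_manifold_openin[OF assms]
  proof (intro conjI ballI, simp, clarify)
    fix U x assume U: "(U, x) \<in> atlas M"
    have "pts M \<inter> U = U \<inter> U" using complex_manifold_pts[OF assms U] by blast
    then show "open (x ` (pts M \<inter> U))" using complex_manifold_open_Int[OF assms U U] by simp
  qed
  then have "pts M \<subseteq> topspace (mtop M)" by (rule openin_subset)
  moreover have "topspace (mtop M) \<subseteq> pts M"
    using openin_topspace[of "mtop M"] unfolding complex_manifold_openin[OF assms] by blast
  ultimately show ?thesis by blast
qed

lemma atlas_PP_Cbundle:
  "atlas (PP Cbundle) = {(affine_domain Cbundle {()} (\<lambda>v. v) \<tau>, \<lambda>P. ((), affine_coord Cbundle (\<lambda>v. v) \<tau> P)) | \<tau>. bij \<tau>}"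
  unfolding atlas_PP by auto

lemma std_affine_hyperplane: "bij \<tau> \<Longrightarrow> affine_hyperplane Cbundle (\<lambda>v. v) \<tau> () \<zeta> = std.lev () (aff \<tau> \<zeta>) 0"
  by (rule std.affine_hyperplane_lev[of "{()}"]) auto

lemma lev_mem_affine_domain:
  assumes \<tau>: "bij \<tau>" and "\<eta> \<noteq> 0"
  shows "std.lev () \<eta> 0 \<in> affine_domain Cbundle {()} (\<lambda>v. v) \<tau> \<longleftrightarrow> \<eta> $ \<tau> None \<noteq> 0"
proof
  assume "std.lev () \<eta> 0 \<in> affine_domain Cbundle {()} (\<lambda>v. v) \<tau>"
  then obtain \<zeta> where "std.lev () \<eta> 0 = std.lev () (aff \<tau> \<zeta>) 0"
    unfolding affine_domain_def by (auto simp: std_affine_hyperplane[OF \<tau>])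
  then obtain c where "aff \<tau> \<zeta> = c *\<^sub>C \<eta>"
    using std.lev_eq_iff[of "()" "()" \<eta> "aff \<tau> \<zeta>"] assms by auto
  then have "1 = c * \<eta> $ \<tau> None" using aff_None[OF \<tau>, of \<zeta>] by simp
  then show "\<eta> $ \<tau> None \<noteq> 0" by auto
next
  assume nz: "\<eta> $ \<tau> None \<noteq> 0"
  have "std.lev () \<eta> 0 = affine_hyperplane Cbundle (\<lambda>v. v) \<tau> () (\<chi> i. \<eta> $ \<tau> (Some i) / \<eta> $ \<tau> None)"
    unfolding std_affine_hyperplane[OF \<tau>] aff_normalize[OF \<tau> nz] using nz by (simp add: std.lev_scale)
  then show "std.lev () \<eta> 0 \<in> affine_domain Cbundle {()} (\<lambda>v. v) \<tau>"
    unfolding affine_domain_def by blast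
qed

lemma std_affine_coord:
  assumes \<tau>: "bij \<tau>" and nz: "\<eta> $ \<tau> None \<noteq> 0"
  shows "affine_coord Cbundle (\<lambda>v. v) \<tau> (std.lev () \<eta> 0) = (\<chi> i. \<eta> $ \<tau> (Some i) / \<eta> $ \<tau> None)"
proof -
  have "std.lev () \<eta> 0 = std.lev () (aff \<tau> (\<chi> i. \<eta> $ \<tau> (Some i) / \<eta> $ \<tau> None)) 0"
    unfolding aff_normalize[OF \<tau> nz] using nz by (simp add: std.lev_scale)
  then show ?thesis using std.affine_coord_lev[of "{()}" "\<lambda>v. v" "()" \<tau>] \<tau> by simp
qed

text \<open>Openness is tested in each affine chart \<tau>', where the domain of \<tau> is the locus
  on which one homogeneous coordinate does not vanish.\<close>

lemma std_affine_domain_openin: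
  fixes \<tau> :: "'i::finite option \<Rightarrow> 'i option"
  assumes \<tau>: "bij \<tau>"
  shows "openin (mtop (PP Cbundle)) (affine_domain Cbundle {()} (\<lambda>v. v) \<tau>)"
proof (subst openin_mtop)
  let ?V = "\<lambda>\<tau>::'i option \<Rightarrow> 'i option. affine_domain Cbundle {()} (\<lambda>v. v) \<tau>"
  let ?y = "\<lambda>\<tau>::'i option \<Rightarrow> 'i option. \<lambda>P. ((), affine_coord Cbundle (\<lambda>v. v) \<tau> P)"
  have V: "\<exists>\<zeta>. P = std.lev () (aff \<tau> \<zeta>) 0" if "P \<in> ?V \<tau>" "bij \<tau>" for P \<tau>
    using that(1) by (auto simp: affine_domain_def std_affine_hyperplane[OF that(2)])
  have co: "affine_coord Cbundle (\<lambda>v. v) \<tau> (std.lev () (aff \<tau> \<zeta>) 0) = \<zeta>" if "bij \<tau>" for \<tau> :: "'i option \<Rightarrow> 'i option" and \<zeta>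
    using std.affine_coord_lev[of "{()}" "\<lambda>v. v" "()" \<tau>] that by simp
  show "inj_on x U" if Ux: "(U, x) \<in> atlas (PP Cbundle)" for U and x :: "(complex^('i option)) set \<Rightarrow> unit \<times> (complex^'i)"
  proof -
    obtain \<tau> where \<tau>: "bij \<tau>" "U = ?V \<tau>" "x = ?y \<tau>" using Ux unfolding atlas_PP_Cbundle by blast
    show ?thesis
      unfolding \<tau>(2,3)
    proof (rule inj_onI)
      fix P Q assume PQ: "P \<in> ?V \<tau>" "Q \<in> ?V \<tau>" "?y \<tau> P = ?y \<tau> Q"
      obtain \<zeta> \<zeta>' where "P = std.lev () (aff \<tau> \<zeta>) 0" "Q = std.lev () (aff \<tau> \<zeta>') 0"
        using V[OF PQ(1) \<tau>(1)] V[OF PQ(2) \<tau>(1)] by blast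
      then show "P = Q" using PQ(3) by (simp add: co[OF \<tau>(1)])
    qed
  qed
  show "?V \<tau> \<subseteq> pts (PP Cbundle) \<and> (\<forall>(U, x)\<in>atlas (PP Cbundle). open (x ` (?V \<tau> \<inter> U)))"
  proof (intro conjI ballI)
    show "?V \<tau> \<subseteq> pts (PP Cbundle)"
      using V[OF _ \<tau>] aff_nonzero[OF \<tau>] unfolding std.PP_pts by fastforce
    fix p assume "p \<in> atlas (PP (Cbundle :: (unit, unit, complex^('i option), 'i option) vbundle))"
    then obtain \<tau>' where \<tau>': "bij \<tau>'" "p = (?V \<tau>', ?y \<tau>')" unfolding atlas_PP_Cbundle by blast
    have "?y \<tau>' ` (?V \<tau> \<inter> ?V \<tau>') = UNIV \<times> {\<zeta>. aff \<tau>' \<zeta> $ \<tau> None \<noteq> 0}"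
    proof (intro equalityI subsetI)
      fix q :: "unit \<times> (complex^'i)"
      assume "q \<in> ?y \<tau>' ` (?V \<tau> \<inter> ?V \<tau>')"
      then obtain P where P: "q = ?y \<tau>' P" "P \<in> ?V \<tau>" "P \<in> ?V \<tau>'" by blast
      obtain \<zeta> where \<zeta>: "P = std.lev () (aff \<tau>' \<zeta>) 0" using V[OF P(3) \<tau>'(1)] by blast
      then show "q \<in> UNIV \<times> {\<zeta>. aff \<tau>' \<zeta> $ \<tau> None \<noteq> 0}"
        using P(1,2) lev_mem_affine_domain[OF \<tau> aff_nonzero[OF \<tau>'(1)]] by (simp add: co[OF \<tau>'(1)])
    next
      fix q :: "unit \<times> (complex^'i)"
      assume q: "q \<in> UNIV \<times> {\<zeta>. aff \<tau>' \<zeta> $ \<tau> None \<noteq> 0}"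
      obtain \<zeta> where \<zeta>: "q = ((), \<zeta>)" "aff \<tau>' \<zeta> $ \<tau> None \<noteq> 0" using q by auto
      define P where "P = std.lev () (aff \<tau>' \<zeta>) 0"
      have "P \<in> ?V \<tau>"
        unfolding P_def using lev_mem_affine_domain[OF \<tau> aff_nonzero[OF \<tau>'(1)]] \<zeta>(2) by simp
      moreover have "P \<in> ?V \<tau>'"
        unfolding P_def using lev_mem_affine_domain[OF \<tau>'(1) aff_nonzero[OF \<tau>'(1)]] \<tau>'(1) by simp
      moreover have "?y \<tau>' P = q" by (simp add: P_def co[OF \<tau>'(1)] \<zeta>(1))
      ultimately show "q \<in> ?y \<tau>' ` (?V \<tau> \<inter> ?V \<tau>')" by blast
    qed
    moreover have "open {\<zeta>::complex^'i. aff \<tau>' \<zeta> $ \<tau> None \<noteq> 0}"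
    proof -
      have "continuous_on UNIV (\<lambda>\<zeta>::complex^'i. aff \<tau>' \<zeta> $ \<tau> None)"
        by (intro holo_on_continuous holo_on_aff holo_on_ident)
      then have "open ((\<lambda>\<zeta>::complex^'i. aff \<tau>' \<zeta> $ \<tau> None) -` (- {0}))" by (intro open_vimage) auto
      then show ?thesis by (simp add: vimage_def)
    qed
    ultimately have "open (?y \<tau>' ` (?V \<tau> \<inter> ?V \<tau>'))" by (simp add: open_Times)
    then show "case p of (U, x) \<Rightarrow> open (x ` (?V \<tau> \<inter> U))" by (simp add: \<tau>'(2))
  qed
qed

text \<open>A representative \<xi> s of the homogeneous coordinates of f s is chosen point by point,
  so \<xi> itself has no regularity; the quotients \<xi> / \<xi>_l are holomorphic and immersive.
  Injectivity of the embedding becomes the statement that \<xi> separates points even up to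
  scaling.\<close>

lemma projective_coordinates:
  fixes S :: "('s, 'm::complex_normed) cmanifold" and f :: "'s \<Rightarrow> (complex^('i::finite option)) set"
  assumes "projective_algebraic S f"
  obtains \<xi> :: "'s \<Rightarrow> complex^('i option)" where
    "\<And>s. s \<in> pts S \<Longrightarrow> \<xi> s \<noteq> 0"
    "\<And>s t c. s \<in> pts S \<Longrightarrow> t \<in> pts S \<Longrightarrow> \<xi> t = c *\<^sub>C \<xi> s \<Longrightarrow> s = t"
    "\<And>l. openin (mtop S) {s \<in> pts S. \<xi> s $ l \<noteq> 0}"
    "\<And>B x l. (B, x) \<in> atlas S \<Longrightarrow> holo_on (x ` (B \<inter> {s \<in> pts S. \<xi> s $ l \<noteq> 0}))
      (\<lambda>z. inverse (\<xi> (inv_into B x z) $ l) *\<^sub>C \<xi> (inv_into B x z))"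
    "\<And>B x l z u. (B, x) \<in> atlas S \<Longrightarrow> z \<in> x ` (B \<inter> {s \<in> pts S. \<xi> s $ l \<noteq> 0}) \<Longrightarrow>
      (\<And>i. Dv (\<lambda>z. (inverse (\<xi> (inv_into B x z) $ l) *\<^sub>C \<xi> (inv_into B x z)) $ i) z u = 0) \<Longrightarrow> u = 0"
proof -
  have S: "complex_manifold S" and emb: "holomorphic_embedding S (PP Cbundle) f" and alg: "algebraic_set (f ` pts S)"
    using assms by (auto simp: projective_algebraic_def)
  have hol: "holomorphic_map S (PP Cbundle) f" and embm: "embedding_map (mtop S) (mtop (PP Cbundle)) f"
    using emb by (auto simp: holomorphic_embedding_def)
  have cont: "continuous_map (mtop S) (mtop (PP Cbundle)) f" using hol by (simp add: holomorphic_map_def)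
  have ex: "\<exists>\<xi>. \<xi> \<noteq> 0 \<and> f s = std.lev () \<xi> 0" if s: "s \<in> pts S" for s
  proof -
    obtain I where "\<forall>p\<in>I. \<exists>d. homogeneous_polynomial d p" and I: "f ` pts S = {{v. (\<Sum>i\<in>UNIV. \<xi> $ i * v $ i) = 0} | \<xi>. \<xi> \<noteq> 0 \<and> (\<forall>p\<in>I. p \<xi> = 0)}"
      using alg unfolding algebraic_set_def by (elim exE conjE)
    obtain \<xi> where "\<xi> \<noteq> 0" "f s = {v. (\<Sum>i\<in>UNIV. \<xi> $ i * v $ i) = 0}"
      using imageI[OF s, of f] unfolding I mem_Collect_eq by (elim exE conjE)
    then show ?thesis by (intro exI[of _ \<xi>]) (simp add: std.lev_def bil_def)
  qed
  define \<xi> where "\<xi> = (\<lambda>s. SOME \<xi>. \<xi> \<noteq> 0 \<and> f s = std.lev () \<xi> 0)"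
  have \<xi>: "\<xi> s \<noteq> 0" "f s = std.lev () (\<xi> s) 0" if "s \<in> pts S" for s
    using someI_ex[OF ex[OF that]] by (auto simp: \<xi>_def)
  define \<tau> where "\<tau> = (\<lambda>l::'i option. Transposition.transpose None l)"
  have \<tau>: "bij (\<tau> l)" "\<tau> l None = l" for l by (auto simp: \<tau>_def)
  let ?V = "\<lambda>l. affine_domain Cbundle {()} (\<lambda>v. v) (\<tau> l)"
  let ?y = "\<lambda>l P. ((), affine_coord Cbundle (\<lambda>v. v) (\<tau> l) P)"
  have Vy: "(?V l, ?y l) \<in> atlas (PP Cbundle)" for l using \<tau>(1) unfolding atlas_PP_Cbundle by blast
  have pre: "{s \<in> pts S. \<xi> s $ l \<noteq> 0} = {s \<in> pts S. f s \<in> ?V l}" for l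
    using \<xi> lev_mem_affine_domain[OF \<tau>(1)] \<tau>(2) by auto
  have preB: "B \<inter> {s \<in> pts S. \<xi> s $ l \<noteq> 0} = B \<inter> f -` ?V l" if "(B, x) \<in> atlas S" for B x l
    unfolding pre using complex_manifold_pts[OF S that] by auto
  show ?thesis
  proof (rule that)
    show "\<xi> s \<noteq> 0" if "s \<in> pts S" for s by (rule \<xi>(1)[OF that])
    show "s = t" if "s \<in> pts S" "t \<in> pts S" "\<xi> t = c *\<^sub>C \<xi> s" for s t c
    proof -
      have "c \<noteq> 0" using \<xi>(1)[OF that(2)] that(3) by auto
      then have "f t = f s" using \<xi>(2)[OF that(1)] \<xi>(2)[OF that(2)] that(3) by (simp add: std.lev_scale)
      moreover have "inj_on f (topspace (mtop S))"
        by (rule homeomorphic_imp_injective_map[OF embm[unfolded embedding_map_def]])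
      ultimately show ?thesis using that by (auto simp: complex_manifold_topspace[OF S] inj_on_def)
    qed
    show op: "openin (mtop S) {s \<in> pts S. \<xi> s $ l \<noteq> 0}" for l
      unfolding pre using openin_continuous_map_preimage[OF cont std_affine_domain_openin[OF \<tau>(1)]]
      by (simp add: complex_manifold_topspace[OF S])
    fix B x l assume Bx: "(B, x) \<in> atlas S"
    let ?A = "x ` (B \<inter> {s \<in> pts S. \<xi> s $ l \<noteq> 0})"
    let ?F = "?y l \<circ> f \<circ> inv_into B x"
    have inv: "inv_into B x z \<in> B" "inv_into B x z \<in> pts S" "\<xi> (inv_into B x z) $ l \<noteq> 0" "x (inv_into B x z) = z"
      if "z \<in> ?A" for z
      using inv_into_image_eq[OF complex_manifold_inj[OF S Bx] Int_lower1 that] by auto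
    have holF: "holo_on ?A ?F"
      unfolding preB[OF Bx] using hol Bx Vy[of l] unfolding holomorphic_map_def by blast
    have Aop: "open ?A"
      using op[of l] Bx unfolding complex_manifold_openin[OF S] by (auto simp: Int_commute[of B])
    have F: "snd (?F z) = (\<chi> i. \<xi> (inv_into B x z) $ \<tau> l (Some i) / \<xi> (inv_into B x z) $ l)" if "z \<in> ?A" for z
      using std_affine_coord[OF \<tau>(1), of "\<xi> (inv_into B x z)" l] inv[OF that] \<xi>(2) by (simp add: \<tau>(2))
    \<comment> \<open>In the affine chart l the normalized vector \<xi> / \<xi>_l is the coefficient
      vector of the affine coordinates of f, so holomorphy and injectivity of the derivative carry
      over from the chart expression of f.\<close>
    have aff: "inverse (\<xi> (inv_into B x z) $ l) *\<^sub>C \<xi> (inv_into B x z) = aff (\<tau> l) (snd (?F z))" if "z \<in> ?A" for z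
      unfolding F[OF that] using aff_normalize[OF \<tau>(1), of "\<xi> (inv_into B x z)" l] inv(3)[OF that] by (simp add: \<tau>(2))
    have "holo_on ?A (\<lambda>z. aff (\<tau> l) (snd (?F z)))"
      by (intro holo_on_vec holo_on_aff holo_on_snd holF)
    then show hol\<xi>: "holo_on ?A (\<lambda>z. inverse (\<xi> (inv_into B x z) $ l) *\<^sub>C \<xi> (inv_into B x z))"
      by (rule holo_on_cong[OF _ Aop]) (simp only: aff)
    fix z u assume z: "z \<in> ?A"
      and D0: "\<And>i. Dv (\<lambda>z. (inverse (\<xi> (inv_into B x z) $ l) *\<^sub>C \<xi> (inv_into B x z)) $ i) z u = 0"
    have "inj (frechet_derivative ?F (at (x (inv_into B x z))))"
    proof -
      have "inv_into B x z \<in> B \<inter> f -` ?V l" using inv[OF z] preB[OF Bx, of l] by blast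
      then show ?thesis using emb Bx Vy[of l] unfolding holomorphic_embedding_def by blast
    qed
    then have injF: "inj (Dv ?F z)" using inv(4)[OF z] by simp
    note dF = holo_on_has_derivative[OF holF z]
    have comp: "snd (Dv ?F z u) $ i = 0" for i
    proof -
      have "((\<lambda>z. snd (?F z) $ i) has_derivative (\<lambda>u. snd (Dv ?F z u) $ i)) (at z)"
        by (intro bounded_linear.has_derivative[OF bounded_linear_vec_nth] has_derivative_snd dF)
      then have "((\<lambda>z. (inverse (\<xi> (inv_into B x z) $ l) *\<^sub>C \<xi> (inv_into B x z)) $ \<tau> l (Some i))
          has_derivative (\<lambda>u. snd (Dv ?F z u) $ i)) (at z)"
        by (rule has_derivative_transform_within_open[OF _ Aop z]) (simp only: aff aff_Some[OF \<tau>(1)])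
      from Dv_eqI[OF this] D0[of "\<tau> l (Some i)"] show ?thesis by simp
    qed
    have "Dv ?F z u = Dv ?F z 0"
    proof -
      have "Dv ?F z 0 = 0"
        using has_derivative_bounded_linear[OF dF] by (simp add: bounded_linear.linear linear_0)
      moreover have "Dv ?F z u = 0" using comp by (simp add: prod_eq_iff vec_eq_iff)
      ultimately show ?thesis by simp
    qed
    then show "u = 0" using injF by (simp add: inj_eq)
  qed
qed

section \<open>The bundle\<close>

lemma immersive_sos_cong:
  "immersive_sos U N Q \<Longrightarrow> (\<And>z. z \<in> U \<Longrightarrow> Q z = Q' z) \<Longrightarrow> immersive_sos U N Q'"
  unfolding immersive_sos_def sos_rep_def by auto

lemma xlen_scale: "xlen k (c *\<^sub>C \<xi>) = (cmod c)\<^sup>2 * xlen k \<xi>"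
  by (simp add: xlen_def norm_mult power_mult_distrib)

lemma ylen_scale: "ylen k a (c *\<^sub>C \<xi>) = (cmod c)\<^sup>2 * ylen k a \<xi>"
proof -
  have "(cmod (c * \<xi> $ i - a $ i * (c * \<xi> $ k)))\<^sup>2 = (cmod c)\<^sup>2 * (cmod (\<xi> $ i - a $ i * \<xi> $ k))\<^sup>2" for i
    unfolding power_mult_distrib[symmetric] norm_mult[symmetric] by (simp add: algebra_simps)
  then show ?thesis by (simp add: ylen_def sum_distrib_left)
qed

lemma xlen_nonneg: "0 \<le> xlen k \<xi>" and ylen_nonneg: "0 \<le> ylen k a \<xi>"
  by (simp_all add: xlen_def ylen_def sum_nonneg)

lemma ylen_eq_0_iff: "ylen k a \<xi> = 0 \<longleftrightarrow> (\<forall>i. i \<noteq> k \<longrightarrow> \<xi> $ i = a $ i * \<xi> $ k)"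
  by (auto simp: ylen_def sum_nonneg_eq_0_iff)

lemma len_pos:
  assumes "\<xi> \<noteq> 0" shows "0 < xlen k \<xi> + ylen k a \<xi>"
proof (rule ccontr)
  assume "\<not> 0 < xlen k \<xi> + ylen k a \<xi>"
  then have "xlen k \<xi> = 0" "ylen k a \<xi> = 0"
    using xlen_nonneg[of k \<xi>] ylen_nonneg[of k a \<xi>] by linarith+
  then have "\<xi> $ k = 0" "\<forall>i. i \<noteq> k \<longrightarrow> \<xi> $ i = a $ i * \<xi> $ k"
    by (simp_all add: xlen_def ylen_eq_0_iff)
  then have "\<xi> $ i = 0" for i by (cases "i = k") auto
  then show False using assms by (simp add: vec_eq_iff)
qed

text \<open>Replacing \<xi> by c \<xi> multiplies X and Y by |c|^2, hence A by |c|^4. Multiplying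
  \<eta> by c^4 has the same effect on K_0(A \<eta>), which is therefore a well defined function on
  the dual of O(4) \<otimes> C^r.\<close>

lemma K0_twist_normalize:
  assumes "c \<noteq> 0"
  shows "K0 (twist \<alpha> \<beta> (xlen k \<xi>) (ylen k a \<xi>) (c ^ 4 *\<^sub>C \<eta>))
    = K0 (twist \<alpha> \<beta> (xlen k (c *\<^sub>C \<xi>)) (ylen k a (c *\<^sub>C \<xi>)) \<eta>)"
  unfolding xlen_scale ylen_scale twist_homogeneous twist_scale K0_scale
  by (simp add: norm_power power_mult[symmetric])

lemma complex_manifold_chart_preimage:
  assumes M: "complex_manifold M" and B: "(B, x) \<in> atlas M" and A: "open A"
  shows "openin (mtop M) {s \<in> B. x s \<in> A}"
  unfolding complex_manifold_openin[OF M]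
proof (intro conjI ballI)
  show "{s \<in> B. x s \<in> A} \<subseteq> pts M" using complex_manifold_pts[OF M B] by blast
  fix p assume "p \<in> atlas M"
  then obtain C y where C: "(C, y) \<in> atlas M" and p: "p = (C, y)" by (cases p) auto
  have cont: "continuous_on (y ` (C \<inter> B)) (x \<circ> inv_into C y)"
    by (rule holo_on_continuous[OF complex_manifold_transition[OF M C B]])
  have "open (y ` (C \<inter> B) \<inter> (x \<circ> inv_into C y) -` A)"
    by (rule continuous_open_preimage[OF cont complex_manifold_open_Int[OF M C B] A])
  also have "y ` (C \<inter> B) \<inter> (x \<circ> inv_into C y) -` A = y ` ({s \<in> B. x s \<in> A} \<inter> C)"
  proof -
    have "inv_into C y (y s) = s" if "s \<in> C" for s
      by (rule inv_into_f_f[OF complex_manifold_inj[OF M C] that])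
    then show ?thesis by auto
  qed
  finally show "case p of (U, y) \<Rightarrow> open (y ` ({s \<in> B. x s \<in> A} \<inter> U))" by (simp add: p)
qed

locale twisted_bundle =
  fixes S :: "('s, 'm::complex_normed) cmanifold" and \<xi> :: "'s \<Rightarrow> complex^'i::finite"
    and k :: 'i and a :: "complex^'i" and \<alpha> \<beta> :: "'q::finite option"
  assumes S: "complex_manifold S" and \<xi>_nz: "\<And>s. s \<in> pts S \<Longrightarrow> \<xi> s \<noteq> 0"
    and \<xi>_open: "\<And>l. openin (mtop S) {s \<in> pts S. \<xi> s $ l \<noteq> 0}"
    and \<xi>_holo: "\<And>B x l. (B, x) \<in> atlas S \<Longrightarrow> holo_on (x ` (B \<inter> {s \<in> pts S. \<xi> s $ l \<noteq> 0}))
      (\<lambda>z. inverse (\<xi> (inv_into B x z) $ l) *\<^sub>C \<xi> (inv_into B x z))"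
    and \<xi>_imm: "\<And>B x l z u. (B, x) \<in> atlas S \<Longrightarrow> z \<in> x ` (B \<inter> {s \<in> pts S. \<xi> s $ l \<noteq> 0}) \<Longrightarrow>
      (\<And>i. Dv (\<lambda>z. (inverse (\<xi> (inv_into B x z) $ l) *\<^sub>C \<xi> (inv_into B x z)) $ i) z u = 0) \<Longrightarrow> u = 0"
    and \<alpha>\<beta>: "\<alpha> \<noteq> \<beta>"
begin

definition Uset :: "'i \<Rightarrow> 's set" where
  "Uset l = {s \<in> pts S. \<xi> s $ l \<noteq> 0}"

definition triv :: "'i \<Rightarrow> 's \<times> (complex^('q option)) \<Rightarrow> complex^('q option)" where
  "triv l p = inverse (\<xi> (fst p) $ l) ^ 4 *\<^sub>C snd p"

text \<open>O(4) \<otimes> C^r, with the fibre over s coordinatized by means of the arbitrary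
  representative \<xi> s: a vector of quartic forms p defines the section with value p(\<xi> s),
  which becomes p(\<xi> s) / \<xi>_l^4 in the trivialization over \<xi>_l \<noteq> 0. The total
  space is a product as a set, not as a manifold.\<close>

definition EE :: "('s, 'm, 's \<times> (complex^('q option)), 'q option) vbundle" where
  "EE = \<lparr>bbase = S, tot = pts S \<times> UNIV, bproj = fst,
     vadd = (\<lambda>p q. (fst p, snd p + snd q)), vscale = (\<lambda>c p. (fst p, c *\<^sub>C snd p)),
     trivs = {(Uset l, triv l) | l. True}\<rparr>"

definition KS :: "'s \<Rightarrow> complex^('q option) \<Rightarrow> real" where
  "KS s \<eta> = K0 (twist \<alpha> \<beta> (xlen k (\<xi> s)) (ylen k a (\<xi> s)) \<eta>)"

lemma EE_simps [simp]: "bbase EE = S" "tot EE = pts S \<times> UNIV" "bproj EE = fst"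
  "vadd EE = (\<lambda>p q. (fst p, snd p + snd q))" "vscale EE = (\<lambda>c p. (fst p, c *\<^sub>C snd p))"
  by (simp_all add: EE_def)

lemma EE_trivs: "(U, \<phi>) \<in> trivs EE \<longleftrightarrow> (\<exists>l. U = Uset l \<and> \<phi> = triv l)"
  by (auto simp: EE_def)

lemma EE_fibre:
  assumes "s \<in> pts S" shows "car (fibre EE s) = {s} \<times> UNIV"
  using assms by (auto simp: fibre_def)

lemma EE_ops [simp]: "add (fibre EE s) = (\<lambda>p q. (fst p, snd p + snd q))"
  "smult (fibre EE s) = (\<lambda>c p. (fst p, c *\<^sub>C snd p))"
  by (simp_all add: fibre_def)

lemma linear_iso_EE:
  assumes s: "s \<in> pts S" and f: "\<And>v w. f (v + w) = f v + f w" "\<And>c v. f (c *\<^sub>C v) = c *\<^sub>C f v" "bij f"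
  shows "linear_iso (fibre EE s) Cspace (\<lambda>p. f (snd p))"
proof -
  have "bij_betw (\<lambda>p. f (snd p)) ({s} \<times> UNIV) UNIV"
    using f(3) unfolding bij_betw_def inj_on_def by (force simp: image_iff surj_def)
  then show ?thesis by (simp add: linear_iso_def EE_fibre[OF s] f)
qed

lemma bij_scaleC: "c \<noteq> 0 \<Longrightarrow> bij (\<lambda>v::complex^'r. c *\<^sub>C v)"
  by (rule o_bij[of "\<lambda>v. inverse c *\<^sub>C v"]) (auto simp: scaleC_scaleC)

lemma triv_iso:
  assumes "s \<in> Uset l" shows "linear_iso (fibre EE s) Cspace (triv l)"
proof -
  have s: "s \<in> pts S" "\<xi> s $ l \<noteq> 0" using assms by (auto simp: Uset_def)
  have 1: "linear_iso (fibre EE s) Cspace (\<lambda>p. inverse (\<xi> s $ l) ^ 4 *\<^sub>C snd p)"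
    by (rule linear_iso_EE[OF s(1)]) (use s(2) in \<open>auto simp: scaleC_add_right scaleC_scaleC mult.commute intro: bij_scaleC\<close>)
  have "bij_betw (triv l) ({s} \<times> UNIV) UNIV"
  proof (rule bij_betw_cong[THEN iffD1])
    show "bij_betw (\<lambda>p. inverse (\<xi> s $ l) ^ 4 *\<^sub>C snd p) ({s} \<times> UNIV) (UNIV :: (complex^('q option)) set)"
      using 1 by (simp add: linear_iso_def EE_fibre[OF s(1)])
  qed (auto simp: triv_def)
  then show ?thesis
    by (simp add: linear_iso_def EE_fibre[OF s(1)] triv_def scaleC_add_right scaleC_scaleC mult.commute)
qed

lemma Uset_openin: "openin (mtop S) (Uset l)"
  unfolding Uset_def by (rule \<xi>_open)

lemma chart_openin:
  assumes "(B, x) \<in> atlas S" "openin (mtop S) A" shows "open (x ` (B \<inter> A))"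
  using assms(2) assms(1) unfolding complex_manifold_openin[OF S] by (auto simp: Int_commute[of B])

lemma Uset_cover:
  assumes "s \<in> pts S" obtains l where "s \<in> Uset l"
proof -
  obtain l where "\<xi> s $ l \<noteq> 0" using \<xi>_nz[OF assms] by (auto simp: vec_eq_iff)
  then show ?thesis using that assms by (auto simp: Uset_def)
qed

lemma Uset_ex: "s \<in> pts S \<Longrightarrow> \<exists>l. s \<in> Uset l"
  by (erule Uset_cover) (rule exI)

text \<open>The multiplier g must be a function of the trivialization, whose index l is not part of
  its data. It is recovered as a component of the image of a basis vector, which is \<xi>_l to the
  power -4.\<close>

sublocale finsler_bundle EE snd "\<lambda>\<phi> s. \<phi> (s, axis None 1) $ None" KS
proof
  fix s assume "s \<in> pts (bbase EE)"
  then have s: "s \<in> pts S" by simp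
  have "linear_iso (fibre EE s) Cspace (\<lambda>p. (\<lambda>v. v) (snd p))"
    by (rule linear_iso_EE[OF s]) (auto simp: bij_def)
  then show "linear_iso (fibre EE s) Cspace snd" by (simp add: eta_contract_eq)
  show "vadd EE v w \<in> car (fibre EE s)" if "v \<in> car (fibre EE s)" "w \<in> car (fibre EE s)" for v w
    using that by (auto simp: EE_fibre[OF s])
  show "vscale EE c v \<in> car (fibre EE s)" if "v \<in> car (fibre EE s)" for c v
    using that by (auto simp: EE_fibre[OF s])
  show "0 < KS s \<eta>" if "\<eta> \<noteq> 0" for \<eta>
    unfolding KS_def
    by (intro K0_pos twist_nonzero \<alpha>\<beta> xlen_nonneg ylen_nonneg len_pos \<xi>_nz s that)
next
  show "KS s (c *\<^sub>C \<eta>) = (cmod c)\<^sup>2 * KS s \<eta>" for s c \<eta>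
    by (simp add: KS_def twist_scale K0_scale)
  show "inj_on x B" if "(B, x) \<in> atlas (bbase EE)" for B x
    using complex_manifold_inj[OF S] that by simp
  show "open (x ` (B \<inter> U \<inter> U'))"
    if "(B, x) \<in> atlas (bbase EE)" "(U, \<phi>) \<in> trivs EE" "(U', \<phi>') \<in> trivs EE" for B x U \<phi> U' \<phi>'
  proof -
    have "openin (mtop S) (U \<inter> U')" using that(2,3) Uset_openin by (auto simp: EE_trivs)
    from chart_openin[OF _ this, of B x] that(1) show ?thesis by (simp add: Int_assoc)
  qed
  fix U and \<phi> :: "'s \<times> (complex^('q option)) \<Rightarrow> complex^('q option)"
  assume "(U, \<phi>) \<in> trivs EE"
  then obtain l where U: "U = Uset l" and \<phi>: "\<phi> = triv l" by (auto simp: EE_trivs)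
  have g: "\<phi> (s, axis None 1) $ None = inverse (\<xi> s $ l) ^ 4" for s
    by (simp add: \<phi> triv_def)
  show "s \<in> pts (bbase EE)" if "s \<in> U" for s using that by (simp add: U Uset_def)
  show "\<phi> v = \<phi> (s, axis None 1) $ None *\<^sub>C snd v" if "s \<in> U" "v \<in> car (fibre EE s)" for s v
    unfolding g using that by (auto simp: U Uset_def EE_fibre \<phi> triv_def)
  show "\<phi> (s, axis None 1) $ None \<noteq> 0" if "s \<in> U" for s
    unfolding g using that by (simp add: U Uset_def)
  show "immersive_sos (x ` (B \<inter> U) \<times> UNIV) (x ` (B \<inter> U) \<times> - {0})
      (\<lambda>(z, \<eta>). (KS (inv_into B x z) (\<phi> (inv_into B x z, axis None 1) $ None *\<^sub>C \<eta>))\<^sup>2)"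
    if "(B, x) \<in> atlas (bbase EE)" for B x
  proof -
    have B: "(B, x) \<in> atlas S" using that by simp
    have inv: "\<xi> (inv_into B x z) $ l \<noteq> 0" if "z \<in> x ` (B \<inter> Uset l)" for z
      using inv_into_image_eq[OF complex_manifold_inj[OF S B] Int_lower1 that] by (simp add: Uset_def)
    have "immersive_sos (x ` (B \<inter> Uset l) \<times> UNIV) (x ` (B \<inter> Uset l) \<times> - {0})
      (\<lambda>(z, \<eta>). (K0 (twist \<alpha> \<beta> (xlen k (inverse (\<xi> (inv_into B x z) $ l) *\<^sub>C \<xi> (inv_into B x z)))
        (ylen k a (inverse (\<xi> (inv_into B x z) $ l) *\<^sub>C \<xi> (inv_into B x z))) \<eta>))\<^sup>2)"
    proof (rule immersive_twist[OF chart_openin[OF B Uset_openin] _ _ _ \<alpha>\<beta>])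
      show "holo_on (x ` (B \<inter> Uset l)) (\<lambda>z. inverse (\<xi> (inv_into B x z) $ l) *\<^sub>C \<xi> (inv_into B x z))"
        unfolding Uset_def by (rule \<xi>_holo[OF B])
      show "(inverse (\<xi> (inv_into B x z) $ l) *\<^sub>C \<xi> (inv_into B x z)) $ l = 1"
        if "z \<in> x ` (B \<inter> Uset l)" for z using inv[OF that] by simp
      show "u = 0" if "z \<in> x ` (B \<inter> Uset l)"
        "\<And>i. Dv (\<lambda>z. (inverse (\<xi> (inv_into B x z) $ l) *\<^sub>C \<xi> (inv_into B x z)) $ i) z u = 0" for z u
        by (rule \<xi>_imm[OF B that[unfolded Uset_def]])
    qed
    then show ?thesis
      unfolding U
    proof (rule immersive_sos_cong)
      fix p assume "p \<in> x ` (B \<inter> Uset l) \<times> (UNIV :: (complex^('q option)) set)"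
      then obtain z \<eta> where p: "p = (z, \<eta>)" "z \<in> x ` (B \<inter> Uset l)" by auto
      have "inverse (\<xi> (inv_into B x z) $ l) \<noteq> 0" using inv[OF p(2)] by simp
      then show "(case p of (z, \<eta>) \<Rightarrow> (K0 (twist \<alpha> \<beta> (xlen k (inverse (\<xi> (inv_into B x z) $ l) *\<^sub>C \<xi> (inv_into B x z)))
          (ylen k a (inverse (\<xi> (inv_into B x z) $ l) *\<^sub>C \<xi> (inv_into B x z))) \<eta>))\<^sup>2)
        = (case p of (z, \<eta>) \<Rightarrow> (KS (inv_into B x z) (\<phi> (inv_into B x z, axis None 1) $ None *\<^sub>C \<eta>))\<^sup>2)"
        unfolding p(1) prod.case KS_def g
        by (intro arg_cong[where f="\<lambda>t. t^2"] K0_twist_normalize[symmetric])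
    qed
  qed
qed

section \<open>The total space of the bundle as a complex manifold\<close>

lemma atlas_total_EE:
  "atlas (total_manifold EE) = {((B \<inter> Uset l) \<times> UNIV, \<lambda>p. (x (fst p), triv l p)) | B x l. (B, x) \<in> atlas S}"
proof -
  have "{v \<in> tot EE. bproj EE v \<in> B \<inter> Uset l} = (B \<inter> Uset l) \<times> UNIV" for B l
    by (auto simp: Uset_def)
  moreover have "atlas (total_manifold EE) = {({v \<in> tot EE. bproj EE v \<in> B \<inter> Uset l},
      \<lambda>v. (x (bproj EE v), triv l v)) | B x l. (B, x) \<in> atlas (bbase EE)}"
    unfolding atlas_total_manifold EE_trivs by blast
  ultimately show ?thesis by simp
qed

lemma pts_total_EE: "pts (total_manifold EE) = pts S \<times> UNIV"
  by (simp add: total_manifold_def)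

definition tchart :: "('s \<Rightarrow> 'm) \<Rightarrow> 'i \<Rightarrow> 's \<times> (complex^('q option)) \<Rightarrow> 'm \<times> (complex^('q option))" where
  "tchart x l = (\<lambda>p. (x (fst p), triv l p))"

lemma tchart_inj:
  assumes "(B, x) \<in> atlas S" shows "inj_on (tchart x l) ((B \<inter> Uset l) \<times> UNIV)"
proof (rule inj_onI)
  fix p q assume p: "p \<in> (B \<inter> Uset l) \<times> UNIV" and q: "q \<in> (B \<inter> Uset l) \<times> UNIV" and eq: "tchart x l p = tchart x l q"
  have "fst p = fst q"
    by (rule inj_onD[OF complex_manifold_inj[OF S assms]]) (use p q eq in \<open>auto simp: tchart_def\<close>)
  moreover have "snd p = snd q"
  proof -
    have "\<xi> (fst p) $ l \<noteq> 0" using p by (auto simp: Uset_def)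
    then have "bij (\<lambda>v::complex^('q option). inverse (\<xi> (fst p) $ l) ^ 4 *\<^sub>C v)" by (intro bij_scaleC) simp
    then show ?thesis
      using eq \<open>fst p = fst q\<close> by (auto simp: tchart_def triv_def bij_def inj_eq)
  qed
  ultimately show "p = q" by (rule prod_eqI)
qed

lemma tchart_image:
  assumes "A \<subseteq> Uset l" shows "tchart x l ` (A \<times> UNIV) = x ` A \<times> UNIV"
proof (intro equalityI subsetI)
  show "p \<in> x ` A \<times> UNIV" if "p \<in> tchart x l ` (A \<times> UNIV)" for p
    using that by (auto simp: tchart_def)
  fix p assume "p \<in> x ` A \<times> (UNIV :: (complex^('q option)) set)"
  then obtain s w where p: "p = (x s, w)" "s \<in> A" by auto
  then have "\<xi> s $ l \<noteq> 0" using assms by (auto simp: Uset_def)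
  then have "tchart x l (s, (\<xi> s $ l) ^ 4 *\<^sub>C w) = p"
    by (simp add: tchart_def triv_def p(1) scaleC_scaleC power_mult_distrib[symmetric])
  then show "p \<in> tchart x l ` (A \<times> UNIV)" using p(2) by (intro image_eqI[of _ _ "(s, (\<xi> s $ l) ^ 4 *\<^sub>C w)"]) auto
qed

lemma ratio_holo:
  assumes "(B, x) \<in> atlas S" shows "holo_on (x ` (B \<inter> Uset l)) (\<lambda>z. \<xi> (inv_into B x z) $ m / \<xi> (inv_into B x z) $ l)"
  using holo_on_nth[OF \<xi>_holo[OF assms, of l], of m] by (simp add: Uset_def divide_inverse mult.commute)

lemma total_openin_iff:
  "openin (mtop (total_manifold EE)) A \<longleftrightarrow> A \<subseteq> pts S \<times> UNIV \<and>
    (\<forall>B x l. (B, x) \<in> atlas S \<longrightarrow> open (tchart x l ` (A \<inter> (B \<inter> Uset l) \<times> UNIV)))"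
proof (subst openin_mtop)
  show "inj_on c U" if "(U, c) \<in> atlas (total_manifold EE)" for U c
    using that tchart_inj unfolding atlas_total_EE tchart_def by blast
  have "(\<forall>p\<in>atlas (total_manifold EE). case p of (U, c) \<Rightarrow> open (c ` (A \<inter> U))) \<longleftrightarrow>
      (\<forall>B x l. (B, x) \<in> atlas S \<longrightarrow> open (tchart x l ` (A \<inter> (B \<inter> Uset l) \<times> UNIV)))"
    unfolding atlas_total_EE tchart_def by blast
  then show "A \<subseteq> pts (total_manifold EE) \<and> (\<forall>p\<in>atlas (total_manifold EE). case p of (U, c) \<Rightarrow> open (c ` (A \<inter> U))) \<longleftrightarrow>
      A \<subseteq> pts S \<times> UNIV \<and> (\<forall>B x l. (B, x) \<in> atlas S \<longrightarrow> open (tchart x l ` (A \<inter> (B \<inter> Uset l) \<times> UNIV)))"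
    unfolding pts_total_EE by simp
qed

text \<open>As \<xi> need not be continuous, the topology of the total space need not be the product
  topology of S and C^r. These sets are products with respect to the trivialization l and play the
  part of basic open sets.\<close>

definition box :: "'s set \<Rightarrow> 'i \<Rightarrow> (complex^('q option)) set \<Rightarrow> ('s \<times> (complex^('q option))) set" where
  "box V l G = {p. fst p \<in> V \<inter> Uset l \<and> triv l p \<in> G}"

text \<open>Passing from the trivialization l' to l multiplies the fibre coordinate by (\<xi>_l' /
  \<xi>_l)^4, which is holomorphic in the charts of S. So a box for l is open in every chart built
  with l'.\<close>

lemma box_openin:
  assumes V: "openin (mtop S) V" and G: "open G"
  shows "openin (mtop (total_manifold EE)) (box V l G)"
  unfolding total_openin_iff
proof (intro conjI allI impI)
  show "box V l G \<subseteq> pts S \<times> UNIV" by (auto simp: box_def Uset_def)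
  fix B x l' assume B: "(B, x) \<in> atlas S"
  let ?A = "x ` (B \<inter> (V \<inter> Uset l \<inter> Uset l'))"
  let ?h = "\<lambda>p::'m \<times> (complex^('q option)). (\<xi> (inv_into B x (fst p)) $ l' / \<xi> (inv_into B x (fst p)) $ l) ^ 4 *\<^sub>C snd p"
  have "open ?A" by (intro chart_openin[OF B] openin_Int V Uset_openin)
  then have op: "open (?A \<times> (UNIV :: (complex^('q option)) set))" by (intro open_Times) auto
  have "holo_on (x ` (B \<inter> Uset l)) (\<lambda>z. \<xi> (inv_into B x z) $ l' / \<xi> (inv_into B x z) $ l)" by (rule ratio_holo[OF B])
  then have r: "holo_on (?A \<times> UNIV) (\<lambda>p::'m \<times> (complex^('q option)). \<xi> (inv_into B x (fst p)) $ l' / \<xi> (inv_into B x (fst p)) $ l)"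
    by (rule holo_on_compose[OF holo_on_fst[OF holo_on_ident]]) auto
  have "holo_on (?A \<times> UNIV) ?h"
  proof (rule holo_on_vec)
    fix i
    have "holo_on (?A \<times> UNIV) (\<lambda>p::'m \<times> (complex^('q option)). (\<xi> (inv_into B x (fst p)) $ l' / \<xi> (inv_into B x (fst p)) $ l) ^ 4 * snd p $ i)"
      by (intro holo_on_mult holo_on_power r holo_on_nth holo_on_snd holo_on_ident)
    then show "holo_on (?A \<times> UNIV) (\<lambda>p. ?h p $ i)" by simp
  qed
  then have "open (?A \<times> UNIV \<inter> ?h -` G)"
    by (intro continuous_open_preimage[OF holo_on_continuous _ G] op)
  also have "?A \<times> UNIV \<inter> ?h -` G = tchart x l' ` (box V l G \<inter> (B \<inter> Uset l') \<times> UNIV)"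
  proof -
    have h: "?h (tchart x l' p) = triv l p" if "fst p \<in> B" "fst p \<in> Uset l'" for p
    proof -
      have "inv_into B x (x (fst p)) = fst p" by (rule inv_into_f_f[OF complex_manifold_inj[OF S B] that(1)])
      moreover have "\<xi> (fst p) $ l' \<noteq> 0" using that(2) by (simp add: Uset_def)
      moreover have "(b / c) ^ 4 * inverse b ^ 4 = inverse c ^ 4" if "b \<noteq> 0" for b c :: complex
      proof -
        have "(b / c) * inverse b = inverse c" using that by (simp add: field_simps)
        then show ?thesis by (simp only: power_mult_distrib[symmetric])
      qed
      ultimately show ?thesis by (simp add: tchart_def triv_def scaleC_scaleC)
    qed
    have "B \<inter> (V \<inter> Uset l \<inter> Uset l') \<subseteq> Uset l'" by blast
    from tchart_image[OF this, of x]
    have 1: "?A \<times> UNIV = tchart x l' ` ((B \<inter> (V \<inter> Uset l \<inter> Uset l')) \<times> UNIV)" ..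
    have "tchart x l' ` ((B \<inter> (V \<inter> Uset l \<inter> Uset l')) \<times> UNIV) \<inter> ?h -` G
      = tchart x l' ` {p \<in> (B \<inter> (V \<inter> Uset l \<inter> Uset l')) \<times> UNIV. ?h (tchart x l' p) \<in> G}" by blast
    also have "{p \<in> (B \<inter> (V \<inter> Uset l \<inter> Uset l')) \<times> UNIV. ?h (tchart x l' p) \<in> G} = box V l G \<inter> (B \<inter> Uset l') \<times> UNIV"
      using h by (auto simp: box_def)
    finally show ?thesis unfolding 1 .
  qed
  finally show "open (tchart x l' ` (box V l G \<inter> (B \<inter> Uset l') \<times> UNIV))" .
qed

lemma cylinder_openin:
  assumes V: "openin (mtop S) V" shows "openin (mtop (total_manifold EE)) (V \<times> UNIV)"
proof -
  have "V \<subseteq> pts S" using openin_subset[OF V] complex_manifold_topspace[OF S] by simp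
  then have "V \<times> UNIV = (\<Union>l. box V l UNIV)" using Uset_ex by (auto simp: box_def)
  then show ?thesis using box_openin[OF V open_UNIV] by (auto intro!: openin_Union)
qed

end

context twisted_bundle
begin

text \<open>In coordinates the transition is that of S together with multiplication of the fibre
  coordinate by (\<xi>_l / \<xi>_l')^4, the transition function of O(4).\<close>

lemma total_transition:
  assumes B: "(B, x) \<in> atlas S" and B': "(B', x') \<in> atlas S"
  shows "open (tchart x l ` ((B \<inter> Uset l) \<times> UNIV \<inter> (B' \<inter> Uset l') \<times> UNIV))"
    and "holo_on (tchart x l ` ((B \<inter> Uset l) \<times> UNIV \<inter> (B' \<inter> Uset l') \<times> UNIV))
      (tchart x' l' \<circ> inv_into ((B \<inter> Uset l) \<times> UNIV) (tchart x l))"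
proof -
  let ?D = "B \<inter> (B' \<inter> Uset l \<inter> Uset l')"
  have D: "(B \<inter> Uset l) \<times> UNIV \<inter> (B' \<inter> Uset l') \<times> UNIV = ?D \<times> (UNIV :: (complex^('q option)) set)" by blast
  have img: "tchart x l ` (?D \<times> UNIV) = x ` ?D \<times> UNIV" by (rule tchart_image) blast
  have opD: "open (x ` ?D)"
    by (intro chart_openin[OF B] openin_Int complex_manifold_chart_openin[OF S B'] Uset_openin)
  then have op: "open (x ` ?D \<times> (UNIV :: (complex^('q option)) set))" by (intro open_Times) auto
  then show "open (tchart x l ` ((B \<inter> Uset l) \<times> UNIV \<inter> (B' \<inter> Uset l') \<times> UNIV))"
    unfolding D img .
  let ?h = "\<lambda>p::'m \<times> (complex^('q option)). ((x' \<circ> inv_into B x) (fst p),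
    (\<xi> (inv_into B x (fst p)) $ l / \<xi> (inv_into B x (fst p)) $ l') ^ 4 *\<^sub>C snd p)"
  have h: "holo_on (x ` ?D \<times> UNIV) ?h"
  proof (rule holo_on_Pair)
    have "holo_on (x ` ?D) (x' \<circ> inv_into B x)"
      by (rule holo_on_subset[OF complex_manifold_transition[OF S B B']]) blast
    then show "holo_on (x ` ?D \<times> UNIV) (\<lambda>p::'m \<times> (complex^('q option)). (x' \<circ> inv_into B x) (fst p))"
      by (rule holo_on_compose[OF holo_on_fst[OF holo_on_ident]]) auto
    have r: "holo_on (x ` ?D \<times> UNIV) (\<lambda>p::'m \<times> (complex^('q option)). \<xi> (inv_into B x (fst p)) $ l / \<xi> (inv_into B x (fst p)) $ l')"
      by (rule holo_on_compose[OF holo_on_fst[OF holo_on_ident] ratio_holo[OF B]]) auto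
    show "holo_on (x ` ?D \<times> UNIV) (\<lambda>p::'m \<times> (complex^('q option)).
      (\<xi> (inv_into B x (fst p)) $ l / \<xi> (inv_into B x (fst p)) $ l') ^ 4 *\<^sub>C snd p)"
    proof (rule holo_on_vec)
      fix i
      have "holo_on (x ` ?D \<times> UNIV) (\<lambda>p::'m \<times> (complex^('q option)). (\<xi> (inv_into B x (fst p)) $ l / \<xi> (inv_into B x (fst p)) $ l') ^ 4 * snd p $ i)"
        by (intro holo_on_mult holo_on_power r holo_on_nth holo_on_snd holo_on_ident)
      then show "holo_on (x ` ?D \<times> UNIV) (\<lambda>p::'m \<times> (complex^('q option)).
        ((\<xi> (inv_into B x (fst p)) $ l / \<xi> (inv_into B x (fst p)) $ l') ^ 4 *\<^sub>C snd p) $ i)" by simp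
    qed
  qed
  have eq: "?h p = (tchart x' l' \<circ> inv_into ((B \<inter> Uset l) \<times> UNIV) (tchart x l)) p"
    if p: "p \<in> x ` ?D \<times> UNIV" for p
  proof -
    obtain s w where s: "p = (x s, w)" "s \<in> ?D" using p by auto
    have nz: "\<xi> s $ l \<noteq> 0" using s(2) by (auto simp: Uset_def)
    have inv: "inv_into B x (x s) = s" by (rule inv_into_f_f[OF complex_manifold_inj[OF S B]]) (use s in auto)
    have 1: "(b / c) ^ 4 = inverse c ^ 4 * b ^ 4" for b c :: complex
      by (simp add: divide_inverse power_mult_distrib mult.commute)
    have "tchart x l (s, (\<xi> s $ l) ^ 4 *\<^sub>C w) = p"
      using nz by (simp add: tchart_def triv_def s(1) scaleC_scaleC power_mult_distrib[symmetric])
    then have "inv_into ((B \<inter> Uset l) \<times> UNIV) (tchart x l) p = (s, (\<xi> s $ l) ^ 4 *\<^sub>C w)"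
      using s(2) by (intro inv_into_f_eq[OF tchart_inj[OF B]]) auto
    then show ?thesis by (simp add: tchart_def triv_def s(1) inv 1 scaleC_scaleC)
  qed
  have "holo_on (x ` ?D \<times> UNIV) (tchart x' l' \<circ> inv_into ((B \<inter> Uset l) \<times> UNIV) (tchart x l))"
    by (rule holo_on_cong[OF h op eq])
  then show "holo_on (tchart x l ` ((B \<inter> Uset l) \<times> UNIV \<inter> (B' \<inter> Uset l') \<times> UNIV))
      (tchart x' l' \<circ> inv_into ((B \<inter> Uset l) \<times> UNIV) (tchart x l))"
    unfolding D img .
qed

lemma total_topspace: "topspace (mtop (total_manifold EE)) = pts S \<times> UNIV"
proof
  have "openin (mtop S) (pts S)"
    using openin_topspace[of "mtop S"] complex_manifold_topspace[OF S] by simp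
  from openin_subset[OF cylinder_openin[OF this]]
  show "pts S \<times> UNIV \<subseteq> topspace (mtop (total_manifold EE))" .
  show "topspace (mtop (total_manifold EE)) \<subseteq> pts S \<times> UNIV"
    using openin_topspace[of "mtop (total_manifold EE)"] unfolding total_openin_iff by blast
qed

text \<open>Points over different base points are separated by cylinders, points of the same fibre
  by boxes in a common trivialization.\<close>

lemma total_Hausdorff: "Hausdorff_space (mtop (total_manifold EE))"
  unfolding Hausdorff_space_def total_topspace
proof (intro allI impI, elim conjE)
  fix p q :: "'s \<times> (complex^('q option))"
  assume p: "p \<in> pts S \<times> UNIV" and q: "q \<in> pts S \<times> UNIV" and pq: "p \<noteq> q"
  show "\<exists>U V. openin (mtop (total_manifold EE)) U \<and> openin (mtop (total_manifold EE)) V \<and> p \<in> U \<and> q \<in> V \<and> disjnt U V"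
  proof (cases "fst p = fst q")
    case False
    have "Hausdorff_space (mtop S)" using S by (simp add: complex_manifold_def)
    from spec[OF spec[OF this[unfolded Hausdorff_space_def complex_manifold_topspace[OF S]], of "fst p"], of "fst q"]
    obtain U V where UV: "openin (mtop S) U" "openin (mtop S) V" "fst p \<in> U" "fst q \<in> V" "disjnt U V"
      using False p q by (auto simp: mem_Times_iff)
    have "p \<in> U \<times> UNIV" "q \<in> V \<times> UNIV" "disjnt (U \<times> (UNIV :: (complex^('q option)) set)) (V \<times> UNIV)"
      using UV(3-5) by (auto simp: mem_Times_iff disjnt_def)
    then show ?thesis
      by (intro exI[of _ "U \<times> UNIV"] exI[of _ "V \<times> UNIV"] conjI cylinder_openin UV)
  next
    case True
    then have "snd p \<noteq> snd q" using pq by (simp add: prod_eq_iff)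
    obtain l where l: "fst p \<in> Uset l" using Uset_ex[of "fst p"] p by auto
    have "bij (\<lambda>v::complex^('q option). inverse (\<xi> (fst p) $ l) ^ 4 *\<^sub>C v)"
      using l by (intro bij_scaleC) (simp add: Uset_def)
    then have "triv l p \<noteq> triv l q"
      using \<open>snd p \<noteq> snd q\<close> True by (simp add: triv_def bij_def inj_eq)
    obtain G H where GH: "open G" "open H" "triv l p \<in> G" "triv l q \<in> H" "G \<inter> H = {}"
      using hausdorff[OF \<open>triv l p \<noteq> triv l q\<close>] by (elim exE conjE)
    have "p \<in> box (Uset l) l G" "q \<in> box (Uset l) l H" "disjnt (box (Uset l) l G) (box (Uset l) l H)"
      using GH(3-5) l True by (auto simp: box_def disjnt_def)
    then show ?thesis
      by (intro exI[of _ "box (Uset l) l G"] exI[of _ "box (Uset l) l H"] conjI box_openin Uset_openin GH)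
  qed
qed

text \<open>The boxes over a countable basis of S, a countable basis of C^r and the finitely many
  indices l form a basis; a neighbourhood of a point is shrunk to a product in a chart
  first.\<close>

lemma total_second_countable: "second_countable_space (mtop (total_manifold EE))"
proof -
  have "second_countable_space (mtop S)" using S by (simp add: complex_manifold_def)
  then obtain \<B> where \<B>: "countable \<B>" "\<forall>V\<in>\<B>. openin (mtop S) V"
    "\<forall>U s. openin (mtop S) U \<and> s \<in> U \<longrightarrow> (\<exists>V\<in>\<B>. s \<in> V \<and> V \<subseteq> U)"
    unfolding second_countable_space_def by (elim exE conjE)
  obtain \<G> :: "(complex^('q option)) set set" where \<G>: "countable \<G>" "topological_basis \<G>"
    using ex_countable_basis by blast
  define \<C> where "\<C> = (\<lambda>(V, l, G). box V l G) ` (\<B> \<times> (UNIV :: 'i set) \<times> \<G>)"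
  show ?thesis
    unfolding second_countable_space_def
  proof (intro exI[of _ \<C>] conjI ballI allI impI)
    show "countable \<C>"
      unfolding \<C>_def by (intro countable_image countable_SIGMA \<B>(1) \<G>(1) countable_finite[OF finite])
    show "openin (mtop (total_manifold EE)) W" if W: "W \<in> \<C>" for W
    proof -
      obtain V l G where "W = box V l G" "V \<in> \<B>" "G \<in> \<G>" using W by (auto simp: \<C>_def)
      then show ?thesis using \<B>(2) topological_basis_open[OF \<G>(2)] by (simp add: box_openin)
    qed
    fix Om p assume Om: "openin (mtop (total_manifold EE)) Om \<and> p \<in> Om"
    have Op: "openin (mtop (total_manifold EE)) Om" "p \<in> Om" using Om by auto
    have "fst p \<in> pts S" using openin_subset[OF Op(1)] Op(2) unfolding total_topspace by auto
    obtain B x where B: "(B, x) \<in> atlas S" "fst p \<in> B"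
      using complex_manifold_cover[OF S \<open>fst p \<in> pts S\<close>] .
    obtain l where l: "fst p \<in> Uset l" using Uset_ex[OF \<open>fst p \<in> pts S\<close>] by blast
    have "open (tchart x l ` (Om \<inter> (B \<inter> Uset l) \<times> UNIV))" 
      using conjunct2[OF iffD1[OF total_openin_iff Op(1)]] B(1) by simp
    moreover have "tchart x l p \<in> tchart x l ` (Om \<inter> (B \<inter> Uset l) \<times> UNIV)"
      using Op(2) B(2) l by (intro imageI) (auto simp: mem_Times_iff)
    ultimately obtain A G where AG: "open A" "open G" "tchart x l p \<in> A \<times> G"
      "A \<times> G \<subseteq> tchart x l ` (Om \<inter> (B \<inter> Uset l) \<times> UNIV)" by (rule open_prod_elim)
    have "openin (mtop S) ({s \<in> B. x s \<in> A} \<inter> Uset l)"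
      by (intro openin_Int complex_manifold_chart_preimage[OF S B(1) AG(1)] Uset_openin)
    moreover have "fst p \<in> {s \<in> B. x s \<in> A} \<inter> Uset l" using B(2) l AG(3) by (simp add: tchart_def)
    ultimately obtain V where V: "V \<in> \<B>" "fst p \<in> V" "V \<subseteq> {s \<in> B. x s \<in> A} \<inter> Uset l"
      using mp[OF spec[OF spec[OF \<B>(3), of "{s \<in> B. x s \<in> A} \<inter> Uset l"], of "fst p"]] by auto
    have "triv l p \<in> G" using AG(3) by (simp add: tchart_def)
    obtain G' where G': "G' \<in> \<G>" "triv l p \<in> G'" "G' \<subseteq> G"
      by (rule topological_basisE[OF \<G>(2) AG(2) \<open>triv l p \<in> G\<close>])
    have "box V l G' \<subseteq> Om"
    proof
      fix q assume q: "q \<in> box V l G'"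
      then have qV: "fst q \<in> V" "fst q \<in> Uset l" "triv l q \<in> G'" by (auto simp: box_def)
      have "tchart x l q \<in> A \<times> G" using qV V(3) G'(3) by (auto simp: tchart_def)
      then obtain r where r: "r \<in> Om" "r \<in> (B \<inter> Uset l) \<times> UNIV" "tchart x l q = tchart x l r"
        by (elim imageE[OF subsetD[OF AG(4)]]) (elim IntE)
      have "q \<in> (B \<inter> Uset l) \<times> UNIV" using qV V(3) by (auto simp: mem_Times_iff)
      from inj_onD[OF tchart_inj[OF B(1)] r(3) this r(2)] show "q \<in> Om" using r(1) by simp
    qed
    moreover have "p \<in> box V l G'" using V(2) l G'(2) by (simp add: box_def)
    moreover have "box V l G' \<in> \<C>"
      unfolding \<C>_def using V(1) G'(1) by (intro image_eqI[of _ _ "(V, l, G')"]) auto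
    ultimately show "\<exists>V\<in>\<C>. p \<in> V \<and> V \<subseteq> Om" by (intro bexI[of _ "box V l G'"] conjI)
  qed
qed

lemma total_complex_manifold: "complex_manifold (total_manifold EE)"
  unfolding complex_manifold_def
proof (intro conjI total_Hausdorff total_second_countable)
  show "(\<Union>(U, x)\<in>atlas (total_manifold EE). U) = pts (total_manifold EE)"
  proof (intro equalityI subsetI)
    show "p \<in> pts (total_manifold EE)" if "p \<in> (\<Union>(U, x)\<in>atlas (total_manifold EE). U)" for p
      using that unfolding atlas_total_EE pts_total_EE by (auto simp: Uset_def)
    fix p assume "p \<in> pts (total_manifold EE)"
    then have s: "fst p \<in> pts S" by (auto simp: pts_total_EE)
    obtain B x where B: "(B, x) \<in> atlas S" "fst p \<in> B" using complex_manifold_cover[OF S s] .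
    obtain l where l: "fst p \<in> Uset l" using Uset_ex[OF s] by blast
    have "((B \<inter> Uset l) \<times> UNIV, \<lambda>p. (x (fst p), triv l p)) \<in> atlas (total_manifold EE)"
      unfolding atlas_total_EE using B(1) by blast
    moreover have "p \<in> (B \<inter> Uset l) \<times> UNIV" using B(2) l by (auto simp: mem_Times_iff)
    ultimately show "p \<in> (\<Union>(U, x)\<in>atlas (total_manifold EE). U)" by blast
  qed
  have atlasE: "\<exists>B x l. (B, x) \<in> atlas S \<and> U = (B \<inter> Uset l) \<times> UNIV \<and> c = tchart x l"
    if "(U, c) \<in> atlas (total_manifold EE)" for U c
    using that unfolding atlas_total_EE tchart_def by blast
  show "\<forall>(U, c)\<in>atlas (total_manifold EE). inj_on c U \<and> open (c ` U)"
  proof (intro ballI, clarify)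
    fix U c assume "(U, c) \<in> atlas (total_manifold EE)"
    then obtain B x l where B: "(B, x) \<in> atlas S" and Uc: "U = (B \<inter> Uset l) \<times> UNIV" "c = tchart x l"
      using atlasE by blast
    show "inj_on c U \<and> open (c ` U)"
      unfolding Uc using tchart_inj[OF B] total_transition(1)[OF B B, of l l] by simp
  qed
  show "\<forall>(U, c)\<in>atlas (total_manifold EE). \<forall>(V, d)\<in>atlas (total_manifold EE).
      open (c ` (U \<inter> V)) \<and> holo_on (c ` (U \<inter> V)) (d \<circ> inv_into U c)"
  proof (intro ballI, clarify)
    fix U c V d assume Uc: "(U, c) \<in> atlas (total_manifold EE)" and Vd: "(V, d) \<in> atlas (total_manifold EE)"
    obtain B x l where B: "(B, x) \<in> atlas S" and Uc: "U = (B \<inter> Uset l) \<times> UNIV" "c = tchart x l"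
      using atlasE[OF Uc] by blast
    obtain B' x' l' where B': "(B', x') \<in> atlas S" and Vd: "V = (B' \<inter> Uset l') \<times> UNIV" "d = tchart x' l'"
      using atlasE[OF Vd] by blast
    show "open (c ` (U \<inter> V)) \<and> holo_on (c ` (U \<inter> V)) (d \<circ> inv_into U c)"
      unfolding Uc Vd using total_transition[OF B B'] by blast
  qed
qed

lemma holomorphic_vector_bundle_EE: "holomorphic_vector_bundle EE"
  unfolding holomorphic_vector_bundle_def
proof (intro conjI)
  show "complex_manifold (bbase EE)" using S by simp
  show "bproj EE ` tot EE \<subseteq> pts (bbase EE)" by auto
  show "\<forall>s\<in>pts (bbase EE). \<forall>v\<in>car (fibre EE s).
      (\<forall>w\<in>car (fibre EE s). vadd EE v w \<in> car (fibre EE s)) \<and> (\<forall>c. vscale EE c v \<in> car (fibre EE s))"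
    using closed_add closed_scale by blast
  show "(\<Union>(U, \<phi>)\<in>trivs EE. U) = pts (bbase EE)"
  proof (intro equalityI subsetI)
    show "s \<in> pts (bbase EE)" if "s \<in> (\<Union>(U, \<phi>)\<in>trivs EE. U)" for s
      using that by (auto simp: EE_trivs Uset_def)
    fix s assume "s \<in> pts (bbase EE)"
    then obtain l where "s \<in> Uset l" using Uset_ex[of s] by auto
    moreover have "(Uset l, triv l) \<in> trivs EE" by (auto simp: EE_trivs)
    ultimately show "s \<in> (\<Union>(U, \<phi>)\<in>trivs EE. U)" by blast
  qed
  show "\<forall>(U, \<phi>)\<in>trivs EE. openin (mtop (bbase EE)) U \<and> (\<forall>s\<in>U. linear_iso (fibre EE s) Cspace \<phi>)"
    using Uset_openin triv_iso by (auto simp: EE_trivs)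
  show "complex_manifold (total_manifold EE)" by (rule total_complex_manifold)
qed

end

section \<open>Failure of the submean value inequality\<close>

text \<open>The mean over the circle is at most the maximum on it. By compactness and continuity
  this maximum is a value on the circle, hence strictly below the value at the centre.\<close>

lemma psh_on_no_strict_max:
  assumes psh: "psh_on U u" and U: "\<And>c. cmod c \<le> 1 \<Longrightarrow> z + c *\<^sub>C w \<in> U"
    and cont: "continuous_on {0..2*pi} (\<lambda>t. u (z + cis t *\<^sub>C w))"
    and less: "\<And>t. u (z + cis t *\<^sub>C w) < u z"
  shows False
proof -
  let ?g = "\<lambda>t. u (z + cis t *\<^sub>C w)"
  have "\<exists>t0\<in>{0..2*pi}. \<forall>t\<in>{0..2*pi}. ?g t \<le> ?g t0"
    by (rule continuous_attains_sup[OF compact_Icc _ cont]) simp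
  then obtain t0 where t0: "\<forall>t\<in>{0..2*pi}. ?g t \<le> ?g t0" by (rule bexE)
  have "u z \<le> integral {0..2*pi} ?g / (2*pi)"
    using psh U unfolding psh_on_def by blast
  also have "integral {0..2*pi} ?g \<le> integral {0..2*pi} (\<lambda>_. ?g t0)"
    by (intro integral_le bspec[OF t0] integrable_continuous_real[OF cont] integrable_const_ivl)
  then have "integral {0..2*pi} ?g / (2*pi) \<le> ?g t0"
    by (simp add: pos_divide_le_eq mult.commute)
  finally show False using less[of t0] by simp
qed

lemma cotwist_add: "cotwist \<alpha> \<beta> X Y (v + w) = cotwist \<alpha> \<beta> X Y v + cotwist \<alpha> \<beta> X Y w"
  by (simp add: cotwist_def vec_eq_iff add_divide_distrib distrib_left)

lemma cotwist_scale: "cotwist \<alpha> \<beta> X Y (c *\<^sub>C v) = c *\<^sub>C cotwist \<alpha> \<beta> X Y v"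
  by (simp add: cotwist_def vec_eq_iff distrib_left add_divide_distrib mult.left_commute)

lemma cotwist_bij:
  fixes \<alpha> \<beta> :: "'r::finite"
  assumes "\<alpha> \<noteq> \<beta>" "0 \<le> X" "0 \<le> Y" "0 < X + Y"
  shows "bij (cotwist \<alpha> \<beta> X Y)"
proof -
  define V where "V = complex_of_real (X^2 + Y^2 + X * Y / 576)"
  define T where "T = complex_of_real ((X + Y)^2)"
  define p where "p = complex_of_real (X * Y / 8)"
  have V: "V \<noteq> 0" using twist_factors(1)[OF assms(2-4)] unfolding V_def of_real_eq_0_iff by linarith
  have T: "T \<noteq> 0" using twist_factors(2)[OF assms(2-4)] unfolding T_def of_real_eq_0_iff by linarith
  have ct: "cotwist \<alpha> \<beta> X Y v = (\<chi> i. if i = \<beta> then v $ \<beta> / V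
     else if i = \<alpha> then (v $ \<alpha> + p * (v $ \<beta> / V)) / T else v $ i / T)" for v
    by (simp only: cotwist_def V_def T_def p_def)
  define h where "h = (\<lambda>w::complex^'r. \<chi> i. if i = \<beta> then V * w $ \<beta>
     else if i = \<alpha> then T * w $ \<alpha> - p * w $ \<beta> else T * w $ i)"
  show ?thesis
  proof (rule o_bij)
    show "h \<circ> cotwist \<alpha> \<beta> X Y = id"
      using assms(1) V T by (auto simp: fun_eq_iff h_def ct vec_eq_iff)
    show "cotwist \<alpha> \<beta> X Y \<circ> h = id"
      using assms(1) V T by (auto simp: fun_eq_iff h_def ct vec_eq_iff)
  qed
qed

lemma sqn_twist_normalize:
  assumes "c \<noteq> 0"
  shows "sqn (twist \<alpha> \<beta> (xlen k \<xi>) (ylen k a \<xi>) (c ^ 4 *\<^sub>C \<eta>))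
    = sqn (twist \<alpha> \<beta> (xlen k (c *\<^sub>C \<xi>)) (ylen k a (c *\<^sub>C \<xi>)) \<eta>)"
  unfolding xlen_scale ylen_scale twist_homogeneous twist_scale sqn_scale
  by (simp add: norm_power power_mult[symmetric])

text \<open>Cauchy-Schwarz, with equality at the conjugate of y scaled to the boundary of the
  ball.\<close>

lemma Sup_functional:
  fixes y :: "complex^'r::finite"
  assumes "0 < c"
  shows "Sup {(cmod (bil y u))\<^sup>2 | u. c * sqn u \<le> 1} = sqn y / c"
proof (rule cSup_eq_maximum)
  have CS: "(cmod (bil y u))\<^sup>2 \<le> sqn y * sqn u" for u
    using complex_Cauchy_Schwarz[of "\<lambda>i. y $ i" "\<lambda>i. cnj (u $ i)" UNIV] by (simp add: bil_def sqn_def)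
  show "b \<le> sqn y / c" if b: "b \<in> {(cmod (bil y u))\<^sup>2 | u. c * sqn u \<le> 1}" for b
  proof -
    obtain u where u: "b = (cmod (bil y u))\<^sup>2" "c * sqn u \<le> 1" using b by blast
    have "b \<le> sqn y * sqn u" unfolding u(1) by (rule CS)
    also have "\<dots> \<le> sqn y * (1 / c)"
      using u(2) assms by (intro mult_left_mono sqn_nonneg) (simp add: pos_le_divide_eq mult.commute)
    finally show ?thesis by simp
  qed
  show "sqn y / c \<in> {(cmod (bil y u))\<^sup>2 | u. c * sqn u \<le> 1}"
  proof (cases "y = 0")
    case True
    then show ?thesis by (auto simp: sqn_def bil_def intro!: exI[of _ 0])
  next
    case False
    define N where "N = sqn y"
    have N: "0 < N" unfolding N_def by (rule sqn_pos[OF False])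
    define d where "d = 1 / sqrt (c * N)"
    have d: "d^2 = 1 / (c * N)" using N assms by (simp add: d_def power_divide)
    define u where "u = of_real d *\<^sub>C (\<chi> i. cnj (y $ i))"
    have su: "sqn u = d^2 * N"
      unfolding u_def sqn_scale by (simp add: sqn_def N_def)
    have "bil y (\<chi> i. cnj (y $ i)) = of_real N"
      unfolding bil_def N_def sqn_def of_real_sum by (intro sum.cong refl) (simp add: complex_norm_square[symmetric])
    then have "(cmod (bil y u))\<^sup>2 = d^2 * N^2"
      by (simp add: u_def bil_scale_right norm_mult power_mult_distrib)
    also have "\<dots> = N / c" unfolding d using N assms by (simp add: power2_eq_square)
    finally have "(cmod (bil y u))\<^sup>2 = N / c" .
    moreover have "c * sqn u \<le> 1" unfolding su d using N assms by simp
    ultimately show ?thesis by (auto simp: N_def intro!: exI[of _ u])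
  qed
qed

text \<open>For \<eta> with real entries x, y at \<alpha>, \<beta> and zeros elsewhere, the first
  variation of |A(1,t) \<eta>|^2 at t = 0 is 4 x^2 + y^2 / 288 - x y / 4. For y = 32 its minimum is
  at x = 1, with the negative value -4/9.\<close>

definition test_vector :: "'r \<Rightarrow> 'r \<Rightarrow> complex^'r::finite" where
  "test_vector \<alpha> \<beta> = (\<chi> i. if i = \<alpha> then 1 else if i = \<beta> then 32 else 0)"

lemma sqn_twist_test_vector:
  assumes "\<alpha> \<noteq> \<beta>"
  shows "sqn (twist \<alpha> \<beta> 1 t (test_vector \<alpha> \<beta>)) = (1 + t)^4 + (32 - 5 / 72 * t + 32 * t^2)^2"
proof -
  have "32 - 5 / 72 * t + 32 * t^2 = (1^2 + t^2 + 1 * t / 576) * 32 - 1 * t / 8 * 1" by simp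
  then have "complex_of_real (1^2 + t^2 + 1 * t / 576) * 32 - of_real (1 * t / 8) * 1 = of_real (32 - 5 / 72 * t + 32 * t^2)"
    by (simp only: of_real_diff of_real_mult of_real_numeral of_real_1)
  then have b: "twist \<alpha> \<beta> 1 t (test_vector \<alpha> \<beta>) $ \<beta> = of_real (32 - 5 / 72 * t + 32 * t^2)"
    using assms by (simp add: twist_def test_vector_def)
  have a: "twist \<alpha> \<beta> 1 t (test_vector \<alpha> \<beta>) $ \<alpha> = of_real ((1 + t)^2)"
    using assms by (simp add: twist_def test_vector_def)
  have o: "twist \<alpha> \<beta> 1 t (test_vector \<alpha> \<beta>) $ i = 0" if "i \<in> UNIV - {\<beta>} - {\<alpha>}" for i
    using that by (simp add: twist_def test_vector_def)
  show ?thesis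
    unfolding sqn_def sum_remove2[OF assms] a b norm_of_real power2_abs
    using o by (simp flip: power_mult)
qed

text \<open>The linear term -4/9 t decides. The other coefficients are about 2054 for t^2 and at
  most 1025 beyond, so for t < 1/10000 their contribution to the bracket is below 1/3.\<close>

lemma sqn_twist_test_vector_less:
  assumes "\<alpha> \<noteq> \<beta>" "0 < t" "t < 1 / 10000"
  shows "sqn (twist \<alpha> \<beta> 1 t (test_vector \<alpha> \<beta>)) < sqn (twist \<alpha> \<beta> 1 0 (test_vector \<alpha> \<beta>))"
proof -
  have "(1 + t)^4 + (32 - 5 / 72 * t + 32 * t^2)^2 - (1 + 32^2)
      = t * (- (4 / 9) + 10647961 / 5184 * t - 4 / 9 * t^2 + 1025 * (t * t^2))"
    by (simp add: algebra_simps power2_eq_square power4_eq_xxxx)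
  also have "\<dots> < 0"
  proof (rule mult_pos_neg[OF assms(2)])
    have t2: "0 \<le> t^2" "t^2 \<le> 1" using assms by (simp_all add: power_le_one)
    have "t * t^2 \<le> t" using mult_left_mono[OF t2(2), of t] assms by simp
    then show "- (4 / 9) + 10647961 / 5184 * t - 4 / 9 * t^2 + 1025 * (t * t^2) < 0"
      using t2 assms(3) by linarith
  qed
  finally show ?thesis unfolding sqn_twist_test_vector[OF assms(1)] by simp
qed

section \<open>The induced metric, its dual, and the maximum along a constant section\<close>

context twisted_bundle
begin

text \<open>The frame \<psi> in \<open>induced\<close> is an arbitrary choice. By
  \<open>pull_K_kk\<close> the metric pulled back by \<psi> is the standard one pulled back by an
  automorphism of C^r; equivariance takes this automorphism out of \<Psi>, and \<psi> cancels
  against its inverse. The constant c does not depend on s.\<close>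

lemma induced_metric_EE:
  assumes \<Psi>: "equivariant \<Psi>" and c: "\<And>v. \<Psi> std.kk v = c * sqn v" and s: "s \<in> pts S"
  shows "induced_metric \<Psi> EE kk (s, v) = c * sqn (cotwist \<alpha> \<beta> (xlen k (\<xi> s)) (ylen k a (\<xi> s)) v)"
proof -
  let ?ct = "cotwist \<alpha> \<beta> (xlen k (\<xi> s)) (ylen k a (\<xi> s))"
  let ?\<theta> = "\<lambda>p. ?ct (snd p)"
  note len = xlen_nonneg[of k "\<xi> s"] ylen_nonneg[of k a "\<xi> s"] len_pos[OF \<xi>_nz[OF s], of k a]
  have \<theta>: "linear_iso (fibre EE s) Cspace ?\<theta>"
    by (rule linear_iso_EE[OF s cotwist_add cotwist_scale cotwist_bij[OF \<alpha>\<beta> len]])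
  define \<psi> :: "complex^('q option) \<Rightarrow> 's \<times> (complex^('q option))" where "\<psi> = (SOME \<psi>. linear_iso Cspace (fibre EE s) \<psi>)"
  have "linear_iso Cspace (fibre EE s) (\<lambda>v. (s, v))"
    by (auto simp: linear_iso_def EE_fibre[OF s] bij_betw_def inj_on_def)
  then have \<psi>: "linear_iso Cspace (fibre EE s) \<psi>" unfolding \<psi>_def by (rule someI[of "linear_iso (Cspace :: (complex^('q option)) cvspace) (fibre EE s)"])
  have iso: "linear_iso Cspace Cspace (?\<theta> \<circ> \<psi>)" by (rule linear_iso_comp[OF \<psi> \<theta>])
  have "pull_K \<psi> kk = pull_K (?\<theta> \<circ> \<psi>) std.kk"
    by (rule pull_K_kk[OF _ \<psi> \<theta>, where A="twist \<alpha> \<beta> (xlen k (\<xi> s)) (ylen k a (\<xi> s))"])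
      (simp_all add: s KS_def bil_twist_cotwist[OF \<alpha>\<beta> len])
  then have "\<Psi> (pull_K \<psi> kk) = \<Psi> std.kk \<circ> (?\<theta> \<circ> \<psi>)"
    using bspec[OF mp[OF spec[OF conjunct2[OF \<Psi>[unfolded equivariant_def]]] iso] std_kk_KK] by simp
  moreover have "\<psi> (inv \<psi> (s, v)) = (s, v)"
  proof (rule f_inv_into_f)
    show "(s, v) \<in> range \<psi>" using \<psi> by (simp add: linear_iso_def bij_betw_def EE_fibre[OF s])
  qed
  ultimately show ?thesis
    by (simp add: induced_metric_def induced_def Let_def \<psi>_def[symmetric] c)
qed

definition functional_at :: "'s \<Rightarrow> complex^('q option) \<Rightarrow> 's \<times> ('s \<times> (complex^('q option)) \<Rightarrow> complex)" where
  "functional_at s \<eta> = (s, restrict (\<lambda>p. bil \<eta> (snd p)) ({s} \<times> UNIV))"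

lemma functional_at_tot:
  assumes s: "s \<in> pts S" shows "functional_at s \<eta> \<in> tot (dual EE)"
  using s by (auto simp: functional_at_def dual_def linear_functional_def EE_fibre[OF s] bil_add_right bil_scale_right)

lemma tot_dual_EE:
  assumes "p \<in> tot (dual EE)" obtains \<eta> where "fst p \<in> pts S" "p = functional_at (fst p) \<eta>"
proof -
  obtain s f where p: "p = (s, f)" by (cases p)
  have s: "s \<in> pts S" and f: "linear_functional (fibre EE s) f" and ext: "f \<in> extensional ({s} \<times> UNIV)"
    using assms by (auto simp: dual_def p EE_fibre)
  have add: "f (s, v + w) = f (s, v) + f (s, w)" and scale: "f (s, c *\<^sub>C v) = c * f (s, v)" for v w c
    using f by (simp_all add: linear_functional_def EE_fibre[OF s])
  define \<eta> where "\<eta> = (\<chi> i. f (s, axis i 1))"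
  have f0: "f (s, 0) = 0" using scale[of 0 0] by simp
  have "f (s, v) = bil \<eta> v" for v
  proof -
    have h1: "f (s, \<Sum>i\<in>I. v $ i *\<^sub>C axis i 1) = (\<Sum>i\<in>I. \<eta> $ i * v $ i)" if "finite I" for I
      using that by (induction I rule: finite_induct) (simp_all add: f0 add scale \<eta>_def)
    have h2: "(\<Sum>i\<in>UNIV. v $ i *\<^sub>C axis i 1) = v"
      by (simp add: vec_eq_iff axis_def if_distrib cong: if_cong)
    show ?thesis using h1[of UNIV] unfolding h2 by (simp add: bil_def)
  qed
  then have "f = restrict (\<lambda>p. bil \<eta> (snd p)) ({s} \<times> UNIV)"
    by (intro extensionalityI[OF ext]) auto
  then show ?thesis using that[of \<eta>] s by (simp add: p functional_at_def)
qed

text \<open>The substitution u = \<open>cotwist\<close> v carries the unit ball to c |u|^2 \<le> 1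
  and the functional \<eta> to \<open>twist\<close> \<eta>, so the supremum is that over a euclidean
  ball.\<close>

lemma dual_metric_EE:
  assumes h: "\<And>v. h (s, v) = c * sqn (cotwist \<alpha> \<beta> (xlen k (\<xi> s)) (ylen k a (\<xi> s)) v)"
    and s: "s \<in> pts S" and c: "0 < c"
  shows "dual_metric EE h (functional_at s \<eta>) = sqn (twist \<alpha> \<beta> (xlen k (\<xi> s)) (ylen k a (\<xi> s)) \<eta>) / c"
proof -
  let ?ct = "cotwist \<alpha> \<beta> (xlen k (\<xi> s)) (ylen k a (\<xi> s))"
  let ?y = "twist \<alpha> \<beta> (xlen k (\<xi> s)) (ylen k a (\<xi> s)) \<eta>"
  note len = xlen_nonneg[of k "\<xi> s"] ylen_nonneg[of k a "\<xi> s"] len_pos[OF \<xi>_nz[OF s], of k a]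
  have surj: "surj ?ct" using cotwist_bij[OF \<alpha>\<beta> len] by (simp add: bij_def)
  have "{(cmod (snd (functional_at s \<eta>) v))\<^sup>2 | v. v \<in> car (fibre EE s) \<and> h v \<le> 1}
      = {(cmod (bil ?y u))\<^sup>2 | u. c * sqn u \<le> 1}" (is "?L = ?R")
  proof (intro equalityI subsetI)
    fix b assume "b \<in> ?L"
    then obtain v where v: "b = (cmod (snd (functional_at s \<eta>) (s, v)))\<^sup>2" "h (s, v) \<le> 1"
      by (auto simp: EE_fibre[OF s])
    then have "b = (cmod (bil ?y (?ct v)))\<^sup>2" "c * sqn (?ct v) \<le> 1"
      by (simp_all add: functional_at_def bil_twist_cotwist[OF \<alpha>\<beta> len] h)
    then show "b \<in> ?R" by blast
  next
    fix b assume "b \<in> ?R"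
    then obtain u where u: "b = (cmod (bil ?y u))\<^sup>2" "c * sqn u \<le> 1" by blast
    obtain v where v: "u = ?ct v" using surj by (rule surjE)
    have "b = (cmod (snd (functional_at s \<eta>) (s, v)))\<^sup>2" "h (s, v) \<le> 1" "(s, v) \<in> car (fibre EE s)"
      using u unfolding v by (simp_all add: functional_at_def bil_twist_cotwist[OF \<alpha>\<beta> len] h EE_fibre[OF s])
    then show "b \<in> ?L" by blast
  qed
  then show ?thesis
    using Sup_functional[OF c, of ?y] by (simp add: dual_metric_def functional_at_def)
qed

text \<open>The trivialization of the dual bundle is contragredient: it multiplies \<eta> by
  \<xi>_l^4, whence the inverse fourth power in the parametrization.\<close>

lemma dual_chart:
  assumes B: "(B, x) \<in> atlas S"
  obtains A c where "(A, c) \<in> atlas (total_manifold (dual EE))"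
    "c ` A = x ` (B \<inter> Uset l) \<times> UNIV"
    "\<And>z \<eta>. z \<in> x ` (B \<inter> Uset l) \<Longrightarrow> inv_into A c (z, \<eta>)
      = functional_at (inv_into B x z) (inverse (\<xi> (inv_into B x z) $ l) ^ 4 *\<^sub>C \<eta>)"
proof -
  define A where "A = {v \<in> tot (dual EE). bproj (dual EE) v \<in> B \<inter> Uset l}"
  define \<phi> where "\<phi> = (\<lambda>(s, f :: 's \<times> (complex^('q option)) \<Rightarrow> complex). \<chi> j. f (inv_into (car (fibre EE s)) (triv l) (axis j 1)))"
  define c where "c = (\<lambda>v. (x (bproj (dual EE) v), \<phi> v))"
  define \<Theta> where "\<Theta> = (\<lambda>(z, \<eta>). functional_at (inv_into B x z) (inverse (\<xi> (inv_into B x z) $ l) ^ 4 *\<^sub>C \<eta>))"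
  have "(Uset l, \<phi>) \<in> trivs (dual EE)"
    unfolding trivs_dual \<phi>_def using EE_trivs by blast
  then have atl: "(A, c) \<in> atlas (total_manifold (dual EE))"
    unfolding atlas_total_manifold A_def c_def using B by auto
  have \<phi>: "\<phi> (functional_at s \<eta>) = (\<xi> s $ l) ^ 4 *\<^sub>C \<eta>" if s: "s \<in> Uset l" for s \<eta>
  proof -
    have s': "s \<in> pts S" "\<xi> s $ l \<noteq> 0" using s by (auto simp: Uset_def)
    have "inv_into (car (fibre EE s)) (triv l) w = (s, (\<xi> s $ l) ^ 4 *\<^sub>C w)" for w
    proof (rule inv_into_f_eq)
      show "inj_on (triv l) (car (fibre EE s))"
        using triv_iso[OF s] by (simp add: linear_iso_def bij_betw_def)
    qed (use s' in \<open>simp_all add: EE_fibre triv_def scaleC_scaleC power_mult_distrib[symmetric]\<close>)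
    then show ?thesis
      by (simp add: \<phi>_def functional_at_def vec_eq_iff bil_scale_right bil_axis)
  qed
  have inv: "inv_into B x z \<in> B \<inter> Uset l \<and> x (inv_into B x z) = z" if "z \<in> x ` (B \<inter> Uset l)" for z
    by (rule inv_into_image_eq[OF complex_manifold_inj[OF S B] Int_lower1 that])
  have 1: "\<Theta> w \<in> A \<and> c (\<Theta> w) = w" if w: "w \<in> x ` (B \<inter> Uset l) \<times> UNIV" for w
  proof -
    obtain z \<eta> where w': "w = (z, \<eta>)" "z \<in> x ` (B \<inter> Uset l)" using w by auto
    define s where "s = inv_into B x z"
    have s: "s \<in> B" "s \<in> Uset l" "x s = z" using inv[OF w'(2)] by (auto simp: s_def)
    then have nz: "s \<in> pts S" "\<xi> s $ l \<noteq> 0" by (auto simp: Uset_def)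
    have fst: "fst (functional_at s \<zeta>) = s" for \<zeta> by (simp add: functional_at_def)
    have "\<Theta> w = functional_at s (inverse (\<xi> s $ l) ^ 4 *\<^sub>C \<eta>)" by (simp add: \<Theta>_def w'(1) s_def)
    then show ?thesis
      using s nz functional_at_tot[OF nz(1)]
      by (simp add: A_def c_def w'(1) fst \<phi>[OF s(2)] scaleC_scaleC power_mult_distrib[symmetric])
  qed
  have 2: "A \<subseteq> \<Theta> ` (x ` (B \<inter> Uset l) \<times> UNIV)"
  proof
    fix p assume p: "p \<in> A"
    then have s: "fst p \<in> B" "fst p \<in> Uset l" and t: "p \<in> tot (dual EE)" by (auto simp: A_def)
    obtain \<eta> where \<eta>: "p = functional_at (fst p) \<eta>" using tot_dual_EE[OF t] .
    have nz: "\<xi> (fst p) $ l \<noteq> 0" using s(2) by (simp add: Uset_def)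
    have "inv_into B x (x (fst p)) = fst p"
      by (rule inv_into_f_f[OF complex_manifold_inj[OF S B] s(1)])
    then have "\<Theta> (x (fst p), (\<xi> (fst p) $ l) ^ 4 *\<^sub>C \<eta>) = functional_at (fst p) \<eta>"
      using nz by (simp add: \<Theta>_def scaleC_scaleC power_mult_distrib[symmetric])
    then show "p \<in> \<Theta> ` (x ` (B \<inter> Uset l) \<times> UNIV)"
      using s \<eta> by (intro image_eqI[of _ _ "(x (fst p), (\<xi> (fst p) $ l) ^ 4 *\<^sub>C \<eta>)"]) auto
  qed
  show ?thesis
  proof (rule that[OF atl])
    show "c ` A = x ` (B \<inter> Uset l) \<times> UNIV" by (rule parametrized_chart(1)[OF 1 2])
    show "inv_into A c (z, \<eta>) = functional_at (inv_into B x z) (inverse (\<xi> (inv_into B x z) $ l) ^ 4 *\<^sub>C \<eta>)"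
      if z: "z \<in> x ` (B \<inter> Uset l)" for z \<eta>
    proof -
      have "(z, \<eta>) \<in> x ` (B \<inter> Uset l) \<times> UNIV" using z by simp
      from parametrized_chart(2)[OF 1 2 this] show ?thesis by (simp add: \<Theta>_def)
    qed
  qed
qed

text \<open>In a chart with \<xi>_k normalized to 1, the dual metric at the constant section \<eta>
  is |A(1, t(z)) \<eta>|^2 / c. Here t vanishes at s_0 and is positive at every other point of the
  chart, since \<xi> separates points. For the test vector this function has a strict local maximum
  at s_0, contradicting the submean value inequality on a small disc in any base direction.\<close>

lemma not_semipositively_curved:
  assumes \<Psi>: "equivariant \<Psi>" and s0: "s0 \<in> pts S" "\<xi> s0 $ k \<noteq> 0"
    and a: "a = inverse (\<xi> s0 $ k) *\<^sub>C \<xi> s0"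
    and inj: "\<And>s t c. s \<in> pts S \<Longrightarrow> t \<in> pts S \<Longrightarrow> \<xi> t = c *\<^sub>C \<xi> s \<Longrightarrow> s = t"
    and w0: "w0 \<noteq> (0::'m)"
  shows "\<not> semipositively_curved EE (induced_metric \<Psi> EE kk)"
proof
  assume "semipositively_curved EE (induced_metric \<Psi> EE kk)"
  then have psh: "psh (total_manifold (dual EE)) (dual_metric EE (induced_metric \<Psi> EE kk))" (is "psh _ ?h")
    by (simp add: semipositively_curved_def seminegatively_curved_def)
  obtain c where c: "0 < c" "\<And>v. \<Psi> std.kk v = c * sqn v" using equivariant_std[OF \<Psi>] by blast
  obtain B x where B: "(B, x) \<in> atlas S" "s0 \<in> B" using complex_manifold_cover[OF S s0(1)] .
  let ?D = "x ` (B \<inter> Uset k)"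
  let ?\<eta> = "test_vector \<alpha> \<beta>"
  define \<Xi> where "\<Xi> = (\<lambda>z. inverse (\<xi> (inv_into B x z) $ k) *\<^sub>C \<xi> (inv_into B x z))"
  define t where "t = (\<lambda>z. ylen k a (\<Xi> z))"
  define z0 where "z0 = x s0"
  obtain A ch where A: "(A, ch) \<in> atlas (total_manifold (dual EE))" "ch ` A = ?D \<times> UNIV"
    and A_inv: "\<And>z \<eta>. z \<in> ?D \<Longrightarrow> inv_into A ch (z, \<eta>)
      = functional_at (inv_into B x z) (inverse (\<xi> (inv_into B x z) $ k) ^ 4 *\<^sub>C \<eta>)"
    using dual_chart[OF B(1), of k] by blast
  have inv: "inv_into B x z \<in> B \<inter> Uset k \<and> x (inv_into B x z) = z" if "z \<in> ?D" for z
    by (rule inv_into_image_eq[OF complex_manifold_inj[OF S B(1)] Int_lower1 that])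
  have inv_D: "inv_into B x z \<in> pts S" "\<xi> (inv_into B x z) $ k \<noteq> 0" if "z \<in> ?D" for z
    using inv[OF that] by (auto simp: Uset_def)
  have z0: "z0 \<in> ?D" "inv_into B x z0 = s0"
    using s0 B by (auto simp: z0_def Uset_def inv_into_f_f[OF complex_manifold_inj[OF S B(1)]])
  have t0: "t z0 = 0" using s0(2) by (simp add: t_def \<Xi>_def z0(2) ylen_eq_0_iff a)
  have tpos: "0 < t z" if z: "z \<in> ?D" "z \<noteq> z0" for z
  proof (rule ccontr)
    assume "\<not> 0 < t z"
    then have "t z = 0" using ylen_nonneg[of k a "\<Xi> z"] by (simp add: t_def)
    then have 0: "\<Xi> z $ i = a $ i * \<Xi> z $ k" if "i \<noteq> k" for i
      using that unfolding t_def ylen_eq_0_iff by blast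
    have "\<Xi> z $ k = 1" using inv_D(2)[OF z(1)] by (simp add: \<Xi>_def)
    moreover have "a $ k = 1" using s0(2) by (simp add: a)
    ultimately have "\<Xi> z $ i = a $ i" for i using 0[of i] by (cases "i = k") auto
    then have "\<Xi> z = a" by (simp add: vec_eq_iff)
    then have "\<xi> (inv_into B x z) $ k *\<^sub>C \<Xi> z = \<xi> (inv_into B x z) $ k *\<^sub>C a" by simp
    then have "\<xi> (inv_into B x z) = (\<xi> (inv_into B x z) $ k * inverse (\<xi> s0 $ k)) *\<^sub>C \<xi> s0"
      using inv_D(2)[OF z(1)] by (simp add: \<Xi>_def a scaleC_scaleC)
    from inj[OF s0(1) inv_D(1)[OF z(1)] this] show False
      using z(2) inv[OF z(1)] by (simp add: z0_def)
  qed
  have "holo_on ?D \<Xi>" unfolding Uset_def \<Xi>_def by (rule \<xi>_holo[OF B(1)])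
  then have "continuous_on ?D \<Xi>" by (rule holo_on_continuous)
  then have tcont: "continuous_on ?D t"
    unfolding t_def ylen_def by (intro continuous_intros)
  have opD: "open ?D" by (rule chart_openin[OF B(1) Uset_openin])
  have u: "(?h \<circ> inv_into A ch) (z, ?\<eta>) = sqn (twist \<alpha> \<beta> 1 (t z) ?\<eta>) / c" if z: "z \<in> ?D" for z
  proof -
    have "xlen k (\<Xi> z) = 1" using inv_D(2)[OF z] by (simp add: xlen_def \<Xi>_def)
    moreover have "?h (functional_at (inv_into B x z) (inverse (\<xi> (inv_into B x z) $ k) ^ 4 *\<^sub>C ?\<eta>))
        = sqn (twist \<alpha> \<beta> (xlen k (\<xi> (inv_into B x z))) (ylen k a (\<xi> (inv_into B x z)))
            (inverse (\<xi> (inv_into B x z) $ k) ^ 4 *\<^sub>C ?\<eta>)) / c"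
      by (rule dual_metric_EE[OF induced_metric_EE[OF \<Psi> c(2) inv_D(1)[OF z]] inv_D(1)[OF z] c(1)])
    moreover have "sqn (twist \<alpha> \<beta> (xlen k (\<xi> (inv_into B x z))) (ylen k a (\<xi> (inv_into B x z)))
            (inverse (\<xi> (inv_into B x z) $ k) ^ 4 *\<^sub>C ?\<eta>)) = sqn (twist \<alpha> \<beta> (xlen k (\<Xi> z)) (t z) ?\<eta>)"
      unfolding t_def \<Xi>_def using inv_D(2)[OF z] by (intro sqn_twist_normalize) simp
    ultimately show ?thesis by (simp add: A_inv[OF z])
  qed
  have "open (?D \<inter> t -` {..<1/10000})"
    by (rule continuous_open_preimage[OF tcont opD open_lessThan])
  moreover have "z0 \<in> ?D \<inter> t -` {..<1/10000}" using z0(1) t0 by simp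
  ultimately obtain e where e: "0 < e" "ball z0 e \<subseteq> ?D \<inter> t -` {..<1/10000}"
    unfolding open_contains_ball by blast
  define w where "w = (e / (2 * norm w0)) *\<^sub>R w0"
  have nw: "norm w = e / 2" using w0 e(1) by (simp add: w_def)
  have near: "z0 + d *\<^sub>C w \<in> ?D" "t (z0 + d *\<^sub>C w) < 1/10000" if "cmod d \<le> 1" for d
  proof -
    have "cmod d * norm w \<le> 1 * norm w" using that by (intro mult_right_mono) auto
    then have "norm (d *\<^sub>C w) < e" using nw e(1) unfolding norm_scaleC by linarith
    then have "z0 + d *\<^sub>C w \<in> ball z0 e" by (simp add: dist_norm)
    then have "z0 + d *\<^sub>C w \<in> ?D \<inter> t -` {..<1/10000}" using e(2) by (rule set_mp[rotated])
    then show "z0 + d *\<^sub>C w \<in> ?D" "t (z0 + d *\<^sub>C w) < 1/10000" by simp_all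
  qed
  have dir: "(z0, ?\<eta>) + d *\<^sub>C (w, 0) = (z0 + d *\<^sub>C w, ?\<eta>)" for d
    by (simp add: scaleC_prod_def)
  show False
  proof (rule psh_on_no_strict_max)
    show "psh_on (?D \<times> UNIV) (?h \<circ> inv_into A ch)"
      using psh A unfolding psh_def by (metis (no_types, lifting) case_prodD)
    show "(z0, ?\<eta>) + d *\<^sub>C (w, 0) \<in> ?D \<times> UNIV" if "cmod d \<le> 1" for d
      unfolding dir using near(1)[OF that] by simp
    have val: "(?h \<circ> inv_into A ch) ((z0, ?\<eta>) + cis \<theta> *\<^sub>C (w, 0)) = sqn (twist \<alpha> \<beta> 1 (t (z0 + cis \<theta> *\<^sub>C w)) ?\<eta>) / c" for \<theta>
      unfolding dir by (rule u[OF near(1)]) simp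
    have circ: "z0 + cis \<theta> *\<^sub>C w \<in> ?D" for \<theta> by (rule near(1)) simp
    have "continuous_on UNIV (\<lambda>\<theta>. z0 + cis \<theta> *\<^sub>C w)"
    proof -
      have "cis \<theta> = complex_of_real (cos \<theta>) + complex_of_real (sin \<theta>) * \<i>" for \<theta>
        by (simp add: complex_eq_iff)
      then have "z0 + cis \<theta> *\<^sub>C w = z0 + (cos \<theta> *\<^sub>R w + sin \<theta> *\<^sub>R (\<i> *\<^sub>C w))" for \<theta>
        by (simp only: scaleC_add_left scaleC_scaleC[symmetric] scaleC_of_real)
      then show ?thesis by (simp only:) (intro continuous_intros)
    qed
    then have "continuous_on UNIV (\<lambda>\<theta>. t (z0 + cis \<theta> *\<^sub>C w))"
      by (rule continuous_on_compose2[OF tcont]) (use circ in auto)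
    then have "continuous_on {0..2*pi} (\<lambda>\<theta>. t (z0 + cis \<theta> *\<^sub>C w))"
      by (rule continuous_on_subset) simp
    then show "continuous_on {0..2*pi} (\<lambda>\<theta>. (?h \<circ> inv_into A ch) ((z0, ?\<eta>) + cis \<theta> *\<^sub>C (w, 0)))"
      unfolding val sqn_twist_test_vector[OF \<alpha>\<beta>] using c(1) by (intro continuous_intros) auto
    show "(?h \<circ> inv_into A ch) ((z0, ?\<eta>) + cis \<theta> *\<^sub>C (w, 0)) < (?h \<circ> inv_into A ch) (z0, ?\<eta>)" for \<theta>
    proof -
      have "norm (cis \<theta> *\<^sub>C w) \<noteq> 0" using nw e(1) by (auto simp: norm_scaleC)
      then have "z0 + cis \<theta> *\<^sub>C w \<noteq> z0" by auto
      from sqn_twist_test_vector_less[OF \<alpha>\<beta> tpos[OF circ this] near(2)] show ?thesis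
        unfolding val u[OF z0(1)] t0 using c(1) by (simp add: divide_strict_right_mono)
    qed
  qed
qed

end

theorem theorem2p1:
  fixes S :: "('s, complex^'n::finite) cmanifold"
    and f :: "'s \<Rightarrow> (complex^('i::finite option)) set"
  assumes "projective_algebraic S f" and "pts S \<noteq> {}"
  shows "\<exists>(E :: ('s, complex^'n, 's \<times> (complex^('q option)), 'q::finite option) vbundle) k.
           bbase E = S \<and> holomorphic_vector_bundle E \<and>
           metric_on (O1 E) k \<and> positively_curved (O1 E) k \<and>
           \<not> (\<exists>\<Psi>. equivariant \<Psi> \<and> semipositively_curved E (induced_metric \<Psi> E k))"
proof (rule projective_coordinates[OF assms(1)])
  fix \<xi> :: "'s \<Rightarrow> complex^('i option)" assume \<xi>:
    "\<And>s. s \<in> pts S \<Longrightarrow> \<xi> s \<noteq> 0"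
    "\<And>s t c. s \<in> pts S \<Longrightarrow> t \<in> pts S \<Longrightarrow> \<xi> t = c *\<^sub>C \<xi> s \<Longrightarrow> s = t"
    "\<And>l. openin (mtop S) {s \<in> pts S. \<xi> s $ l \<noteq> 0}"
    "\<And>B x l. (B, x) \<in> atlas S \<Longrightarrow> holo_on (x ` (B \<inter> {s \<in> pts S. \<xi> s $ l \<noteq> 0}))
      (\<lambda>z. inverse (\<xi> (inv_into B x z) $ l) *\<^sub>C \<xi> (inv_into B x z))"
    "\<And>B x l z u. (B, x) \<in> atlas S \<Longrightarrow> z \<in> x ` (B \<inter> {s \<in> pts S. \<xi> s $ l \<noteq> 0}) \<Longrightarrow>
      (\<And>i. Dv (\<lambda>z. (inverse (\<xi> (inv_into B x z) $ l) *\<^sub>C \<xi> (inv_into B x z)) $ i) z u = 0) \<Longrightarrow> u = 0"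
  obtain \<alpha> \<beta> :: "'q option" where \<alpha>\<beta>: "\<alpha> \<noteq> \<beta>" by (rule ex_distinct_indices)
  obtain s0 where s0: "s0 \<in> pts S" using assms(2) by blast
  obtain l where l: "\<xi> s0 $ l \<noteq> 0" using \<xi>(1)[OF s0] by (auto simp: vec_eq_iff)
  define a where "a = inverse (\<xi> s0 $ l) *\<^sub>C \<xi> s0"
  have S: "complex_manifold S" using assms(1) by (simp add: projective_algebraic_def)
  interpret twisted_bundle S \<xi> l a \<alpha> \<beta>
    by (rule twisted_bundle.intro[OF S \<xi>(1,3-5) \<alpha>\<beta>])
  \<comment> \<open>A nonzero tangent direction: the model space is C^n with n \<ge> 1, so S has
    positive dimension.\<close>
  have w0: "axis undefined 1 \<noteq> (0 :: complex^'n)" by (simp add: axis_eq_0_iff)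
  show ?thesis
    by (intro exI[of _ EE] exI[of _ kk] conjI EE_simps(1) holomorphic_vector_bundle_EE metric_on_kk
        positively_curved_kk notI, elim exE conjE notE[OF not_semipositively_curved[OF _ s0 l a_def \<xi>(2) w0], rotated -1])
qed

end
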